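(* Let $0<\beta\le 1$ and, for each $n\in\mathbb N$, let the random variables $(\tilde a_n(i,j))_{1\le i,j\le n}$ be Curie-Weiss($\beta,n^2$)-distributed. Define the triangular scheme $(a_n)_n$ by $a_n(i,j)=\tilde a_n(i,j)$ if $i\le j$ and $a_n(i,j)=\tilde a_n(j,i)$ if $i>j$, for all $n\in\mathbb N$ and $(i,j)\in[n]\times[n]$. Let $b=(b_n)_n$ be a sequence of $n$-bandwidths and let $(X_n)_n$ be the periodic random band matrices which are based on $(a_n)_n$ with bandwidth $b$. Then: i) The triangular scheme $(a_n)_n$ is $\frac12$-almost uncorrelated. ii) If $b_n\to\infty$ as $n\to\infty$, then the semicircle law holds for $(X_n)_n$ in probability. iii) If $\frac1{b_n^3}$ is summable over $n$, then the semicircle law holds almost surely for $(X_n)_n$. (In particular this applies to full matrices, $b_n=n$.)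
   Context: $\mathbb N=\{1,2,\dots\}$, $[n]=\{1,\dots,n\}$, $\square_n=[n]\times[n]$. All random variables are defined on a common probability space $(\Omega,\mathcal A,\mathbb P)$ with expectation $\mathbb E$. For $m\in\mathbb N$ and $\beta>0$, random variables $Y_1,\dots,Y_m$ are Curie-Weiss($\beta,m$)-distributed if for all $y_1,\dots,y_m\in\{-1,1\}$: $\mathbb P(Y_1=y_1,\dots,Y_m=y_m)=\frac1{Z_{\beta,m}}\exp\!\big(\frac{\beta}{2m}(\sum_{i=1}^m y_i)^2\big)$, where $Z_{\beta,m}$ is a normalization constant. A triangular scheme is a sequence $(a_n)_{n\in\mathbb N}$ where each $a_n=(a_n(p,q))_{(p,q)\in\square_n}$ is a symmetric $n\times n$ matrix of real-valued random variables. Pairs $(a,b),(c,d)\in\mathbb N^2$ are fundamentally different if $\{a,b\}\ne\{c,d\}$; several pairs are called fundamentally different if they are pairwise so. Let $\alpha>0$. A triangular scheme $(a_n)_n$ is $\alpha$-almost uncorrelated if (all moments of the entries exist and) there are constants $(C_k)_k$ and $(C^{(m)}_n)_{n,m}$ with $\lim_{n\to\infty}C^{(m)}_n=0$ for each $m\in\mathbb N$, such that for all $N,l\in\mathbb N$ and all fundamentally different pairs $(p_1,q_1),\dots,(p_l,q_l)\in\square_N$: (AAU1) for all $\delta_1,\dots,\delta_l\in\mathbb N$ and all $n\ge N$: $|\mathbb E\, a_n(p_1,q_1)^{\delta_1}\cdots a_n(p_l,q_l)^{\delta_l}|\le C_{\delta_1+\dots+\delta_l}\, n^{-\alpha\cdot\#\{i\in\{1,\dots,l\}:\delta_i=1\}}$;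 (AAU2) for all $n\ge N$: $|\mathbb E\, a_n(p_1,q_1)^2\cdots a_n(p_l,q_l)^2-1|\le C^{(l)}_n$. For $n\in\mathbb N$, an ($n$-)bandwidth is a number $b_n\in\{b\in\mathbb N: b<n,\ b\text{ odd}\}\cup\{n\}$. If $b_n=n$, all index pairs $(i,j)\in\square_n$ are $b_n$-relevant; if $b_n<n$, the pair $(i,j)$ is $b_n$-relevant iff $|i-j|\le\frac{b_n-1}{2}$ or $|i-j|\ge n-\frac{b_n-1}{2}$. The periodic random band matrices based on $(a_n)_n$ with bandwidth $b=(b_n)_n$ are the $n\times n$ matrices $X_n$ with $X_n(i,j)=b_n^{-1/2}a_n(i,j)$ if $(i,j)$ is $b_n$-relevant and $X_n(i,j)=0$ otherwise. The empirical spectral distribution of $X_n$ is $\sigma_n=\frac1n\sum_{i=1}^n\delta_{\lambda_i}$, with $\lambda_1\le\dots\le\lambda_n$ the eigenvalues of $X_n$. The semicircle distribution $\sigma$ has Lebesgue density $\frac1{2\pi}\sqrt{4-x^2}\,\mathbf 1_{[-2,2]}(x)$. The semicircle law holds for $(X_n)_n$ in probability (resp. almost surely) if for every bounded continuous $f:\mathbb R\to\mathbb R$ one has $\int f\,d\sigma_n\to\int f\,d\sigma$ in probability (resp. almost surely) as $n\to\infty$. *)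

theory Defs
  imports "HOL-Probability.Probability" "Jordan_Normal_Form.Char_Poly"
begin

text \<open>
  Throughout, \<open>M\<close> is the underlying probability space. A family of random matrices is a function
  \<open>a :: nat \<Rightarrow> nat \<Rightarrow> nat \<Rightarrow> 'w \<Rightarrow> real\<close>, where \<open>a n p q\<close> is the \<open>(p,q)\<close> entry of the \<open>n\<close>-th matrix.
  The mathematical indices start at 1, so values at \<open>n = 0\<close> or outside \<open>{1..n} \<times> {1..n}\<close> are
  irrelevant.
\<close>

subsection \<open>Curie-Weiss distribution\<close>

text \<open>
  The \<open>m\<close> random variables are indexed by a finite set \<open>I\<close> with \<open>m = card I\<close>; the density is
  invariant under relabelling.
\<close>

definition cw_weight :: "real \<Rightarrow> 'i set \<Rightarrow> ('i \<Rightarrow> real) \<Rightarrow> real" where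
  "cw_weight \<beta> I y = exp (\<beta> / (2 * real (card I)) * (\<Sum>i\<in>I. y i)\<^sup>2)"

definition cw_norm :: "real \<Rightarrow> 'i set \<Rightarrow> real" where
  "cw_norm \<beta> I = (\<Sum>y\<in>I \<rightarrow>\<^sub>E {-1, 1}. cw_weight \<beta> I y)"

definition curie_weiss :: "'w measure \<Rightarrow> real \<Rightarrow> 'i set \<Rightarrow> ('i \<Rightarrow> 'w \<Rightarrow> real) \<Rightarrow> bool" where
  "curie_weiss M \<beta> I Y \<longleftrightarrow>
     (\<forall>i\<in>I. Y i \<in> borel_measurable M) \<and>
     (\<forall>y\<in>I \<rightarrow>\<^sub>E {-1, 1}.
        measure M {\<omega>\<in>space M. \<forall>i\<in>I. Y i \<omega> = y i} = 1 / cw_norm \<beta> I * cw_weight \<beta> I y)"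

subsection \<open>Almost uncorrelated triangular schemes\<close>

definition square :: "nat \<Rightarrow> (nat \<times> nat) set" where
  "square n = {1..n} \<times> {1..n}"

definition triangular_scheme :: "'w measure \<Rightarrow> (nat \<Rightarrow> nat \<Rightarrow> nat \<Rightarrow> 'w \<Rightarrow> real) \<Rightarrow> bool" where
  "triangular_scheme M a \<longleftrightarrow>
     (\<forall>n\<ge>1. \<forall>(p, q)\<in>square n.
        a n p q \<in> borel_measurable M \<and> (\<forall>\<omega>\<in>space M. a n p q \<omega> = a n q p \<omega>))"

definition fundamentally_different :: "nat \<times> nat \<Rightarrow> nat \<times> nat \<Rightarrow> bool" where
  "fundamentally_different r s \<longleftrightarrow> {fst r, snd r} \<noteq> {fst s, snd s}"

text \<open>
  \<open>C k\<close> is the constant $C_k$ and \<open>D m n\<close> is $C^{(m)}_n$; the pairs are \<open>(p i, q i)\<close> for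
  \<open>i \<in> {1..l}\<close>.
\<close>

definition almost_uncorrelated ::
  "'w measure \<Rightarrow> real \<Rightarrow> (nat \<Rightarrow> nat \<Rightarrow> nat \<Rightarrow> 'w \<Rightarrow> real) \<Rightarrow> bool" where
  "almost_uncorrelated M \<alpha> a \<longleftrightarrow>
     triangular_scheme M a \<and>
     (\<forall>n\<ge>1. \<forall>(p, q)\<in>square n. \<forall>k::nat. integrable M (\<lambda>\<omega>. a n p q \<omega> ^ k)) \<and>
     (\<exists>(C :: nat \<Rightarrow> real) (D :: nat \<Rightarrow> nat \<Rightarrow> real).
        (\<forall>m\<ge>1. D m \<longlonglongrightarrow> 0) \<and>
        (\<forall>N\<ge>1. \<forall>l\<ge>1. \<forall>p q :: nat \<Rightarrow> nat.
           (\<forall>i\<in>{1..l}. (p i, q i) \<in> square N) \<longrightarrow>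
           (\<forall>i\<in>{1..l}. \<forall>j\<in>{1..l}. i \<noteq> j \<longrightarrow> fundamentally_different (p i, q i) (p j, q j)) \<longrightarrow>
           (\<forall>\<delta> :: nat \<Rightarrow> nat. (\<forall>i\<in>{1..l}. \<delta> i \<ge> 1) \<longrightarrow>
              (\<forall>n\<ge>N. \<bar>\<integral>\<omega>. (\<Prod>i=1..l. a n (p i) (q i) \<omega> ^ \<delta> i) \<partial>M\<bar>
                 \<le> C (\<Sum>i=1..l. \<delta> i) * real n powr (- \<alpha> * real (card {i\<in>{1..l}. \<delta> i = 1})))) \<and>
           (\<forall>n\<ge>N. \<bar>(\<integral>\<omega>. (\<Prod>i=1..l. (a n (p i) (q i) \<omega>)\<^sup>2) \<partial>M) - 1\<bar> \<le> D l n)))"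

subsection \<open>Periodic random band matrices\<close>

definition bandwidth :: "nat \<Rightarrow> nat \<Rightarrow> bool" where
  "bandwidth n b \<longleftrightarrow> b \<in> {b. 1 \<le> b \<and> b < n \<and> odd b} \<union> {n}"

definition relevant :: "nat \<Rightarrow> nat \<Rightarrow> nat \<Rightarrow> nat \<Rightarrow> bool" where
  "relevant n b i j \<longleftrightarrow>
     b = n \<or>
     \<bar>real i - real j\<bar> \<le> (real b - 1) / 2 \<or>
     \<bar>real i - real j\<bar> \<ge> real n - (real b - 1) / 2"

text \<open>The library's matrices are indexed from 0, whence the shift by one.\<close>

definition band_matrix ::
  "(nat \<Rightarrow> nat \<Rightarrow> nat \<Rightarrow> 'w \<Rightarrow> real) \<Rightarrow> (nat \<Rightarrow> nat) \<Rightarrow> nat \<Rightarrow> 'w \<Rightarrow> real mat" where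
  "band_matrix a b n \<omega> =
     Matrix.mat n n (\<lambda>(i, j).
       if relevant n (b n) (i + 1) (j + 1)
       then real (b n) powr (- 1 / 2) * a n (i + 1) (j + 1) \<omega>
       else 0)"

subsection \<open>Spectral distributions and the semicircle law\<close>

text \<open>
  The real eigenvalues in increasing order, repeated according to algebraic multiplicity. For a
  symmetric real \<open>n \<times> n\<close> matrix this list has length \<open>n\<close>.
\<close>

definition real_eigenvalues :: "real mat \<Rightarrow> real list" where
  "real_eigenvalues A = sorted_list_of_multiset (proots (char_poly A))"

text \<open>The image of the uniform distribution on the index set under $i \mapsto \lambda_i$, that is,
  $\frac{1}{n} \sum_i \delta_{\lambda_i}$.\<close>

definition esd :: "real mat \<Rightarrow> real measure" where
  "esd A = distr (uniform_count_measure {..<dim_row A}) borel (\<lambda>i. real_eigenvalues A ! i)"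

definition semicircle :: "real measure" where
  "semicircle = density lborel
     (\<lambda>x. ennreal (1 / (2 * pi) * sqrt (4 - x\<^sup>2) * indicator {-2..2} x))"

text \<open>
  Measurability is part of the definition because \<open>measure\<close> is 0 on sets that are not measurable.
\<close>

definition tendsto_in_prob :: "'w measure \<Rightarrow> (nat \<Rightarrow> 'w \<Rightarrow> real) \<Rightarrow> real \<Rightarrow> bool" where
  "tendsto_in_prob M Y c \<longleftrightarrow>
     (\<forall>n\<ge>1. Y n \<in> borel_measurable M) \<and>
     (\<forall>\<epsilon>>0. (\<lambda>n. measure M {\<omega>\<in>space M. \<bar>Y n \<omega> - c\<bar> > \<epsilon>}) \<longlonglongrightarrow> 0)"

definition semicircle_law_in_prob :: "'w measure \<Rightarrow> (nat \<Rightarrow> 'w \<Rightarrow> real mat) \<Rightarrow> bool" where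
  "semicircle_law_in_prob M X \<longleftrightarrow>
     (\<forall>f :: real \<Rightarrow> real. continuous_on UNIV f \<longrightarrow> bounded (range f) \<longrightarrow>
        tendsto_in_prob M (\<lambda>n \<omega>. \<integral>x. f x \<partial>esd (X n \<omega>)) (\<integral>x. f x \<partial>semicircle))"

definition semicircle_law_almost_surely :: "'w measure \<Rightarrow> (nat \<Rightarrow> 'w \<Rightarrow> real mat) \<Rightarrow> bool" where
  "semicircle_law_almost_surely M X \<longleftrightarrow>
     (\<forall>f :: real \<Rightarrow> real. continuous_on UNIV f \<longrightarrow> bounded (range f) \<longrightarrow>
        (AE \<omega> in M. (\<lambda>n. \<integral>x. f x \<partial>esd (X n \<omega>)) \<longlonglongrightarrow> (\<integral>x. f x \<partial>semicircle)))"

end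

theory Submission
  imports Defs
    "HOL-Computational_Algebra.Formal_Power_Series"
    "Jordan_Normal_Form.Schur_Decomposition"
begin

text \<open>
  By the Hubbard--Stratonovich transformation the Curie--Weiss distribution is a mixture of product
  measures: given a real parameter \<open>t\<close>, the spins are independent with mean \<open>tanh t\<close>, and \<open>t\<close> has
  density proportional to \<open>exp (- m t\<^sup>2 / (2 \<beta>)) * cosh t ^ m\<close> with \<open>m = n\<^sup>2\<close>. For \<open>\<beta> \<le> 1\<close> all
  moments of \<open>sqrt n * \<bar>tanh t\<bar>\<close> are bounded in \<open>n\<close>, which yields the decay of correlations.

  For the semicircle law, the \<open>k\<close>-th spectral moment is a sum over closed walks of length \<open>k\<close> in the
  band graph. Conditionally on \<open>t\<close>, a walk contributes \<open>tanh t ^ s\<close>, where \<open>s\<close> is the number of edges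
  traversed an odd number of times. Walks with \<open>s = 0\<close> satisfy the convolution recursion of the
  semicircle moments up to a relative error \<open>O (1 / b)\<close>. A closed walk with \<open>s > 0\<close> has at most
  \<open>(k + s) / 2\<close> vertices, since an edge of odd multiplicity is not a bridge; this bounds the
  conditional mean, and, applied to pairs of walks glued along a common edge, it gives conditional
  variance \<open>O (1 / (n b))\<close>. Chebyshev's inequality for the conditional fluctuation and Markov's
  inequality for the fourth power of the deviation of the conditional mean bound the deviation
  probabilities by a multiple of \<open>1 / (n b) + 1 / b ^ 4\<close>, which is summable when \<open>1 / b ^ 3\<close> is.
\<close>

subsection \<open>Multiplicities of edges in closed walks\<close>

text \<open>The unconditional variance of a spectral moment picks up pairs of walks without a common
  edge, which remain correlated through the common field \<open>t\<close>. Given \<open>t\<close>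
  their covariance vanishes exactly, and the price is a random conditional mean. Its distance to a
  deterministic value is controlled only to order \<open>1 / b\<close>, so a second moment would
  leave \<open>1 / b ^ 2\<close>, which need not be summable; the fourth moment costs no more than a
  higher moment of the field.

  The decay by \<open>n powr (-1/2)\<close> per odd edge at \<beta> = 1 is exactly what the counting
  can afford: an odd edge allows half a vertex more, that is a factor \<open>sqrt b\<close>, and
  \<open>b \<le> n\<close>. Hence all estimates are in powers of
  \<open>sqrt b * \<bar>tanh t\<bar>\<close>, hold for every \<open>t\<close>, and have constants
  depending only on the length \<open>k\<close>; the field is integrated out afterwards.

  The term \<open>1 / (n * b)\<close> is summable because it is at most \<open>1 / b ^ 3\<close> or
  at most \<open>n powr (-3/2)\<close>, according to whether \<open>b ^ 2\<close> exceeds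
  \<open>n\<close>.\<close>

definition ed :: "nat \<Rightarrow> nat \<Rightarrow> nat \<times> nat" where
  "ed x y = (min x y, max x y)"

lemma ed_commute: "ed x y = ed y x"
  by (simp add: ed_def min.commute max.commute)

lemma ed_eq_iff: "ed x y = ed u v \<longleftrightarrow> (x = u \<and> y = v) \<or> (x = v \<and> y = u)"
  by (auto simp: ed_def min_def max_def split: if_splits)

text \<open>A walk is a root \<open>x\<close> with the list of its later vertices. Edges are sorted
  pairs, hence indices of the upper triangle, from which the symmetric scheme reads its entries;
  loops are allowed.\<close>

fun edges :: "nat \<Rightarrow> nat list \<Rightarrow> (nat \<times> nat) list" where
  "edges x [] = []"
| "edges x (y # ys) = ed x y # edges y ys"

lemma edges_append: "edges x (ys @ zs) = edges x ys @ edges (last (x # ys)) zs"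
  by (induction ys arbitrary: x) auto

lemma length_edges [simp]: "length (edges x ys) = length ys"
  by (induction ys arbitrary: x) auto

text \<open>Spins square to 1, so these edges carry all that survives of the product of the spins
  along \<open>es\<close>.\<close>

definition odd_edges :: "'e list \<Rightarrow> 'e set" where
  "odd_edges es = {e. odd (count_list es e)}"

lemma odd_edges_subset: "odd_edges es \<subseteq> set es"
  by (auto simp: odd_edges_def) (metis count_notin even_zero)

lemma finite_odd_edges [simp]: "finite (odd_edges es)"
  by (rule finite_subset[OF odd_edges_subset]) simp

section \<open>Reachability, cuts and the number of vertices of a walk\<close>

definition adj :: "(nat \<times> nat) set \<Rightarrow> (nat \<times> nat) set" where
  "adj E = {(x, y). ed x y \<in> E}"

lemma sym_adj: "sym (adj E)"
  by (auto simp: sym_def adj_def ed_commute)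

lemma adj_mono: "E \<subseteq> F \<Longrightarrow> (adj E)\<^sup>* \<subseteq> (adj F)\<^sup>*"
  by (intro rtrancl_mono) (auto simp: adj_def)

text \<open>Each reachable vertex other than the root is charged to the last edge of a shortest path to it.\<close>

lemma card_reachable_le:
  assumes "finite E" "finite V" and reach: "\<And>v. v \<in> V \<Longrightarrow> (x, v) \<in> (adj E)\<^sup>*"
  shows "card V \<le> card E + 1"
proof -
  define d where "d v = (LEAST n. (x, v) \<in> adj E ^^ n)" for v
  have d: "(x, v) \<in> adj E ^^ d v" if "v \<in> V" for v
    using reach[OF that] unfolding d_def rtrancl_power by (rule LeastI_ex)
  have "\<exists>p. (p, v) \<in> adj E \<and> d p < d v" if v: "v \<in> V - {x}" for v
  proof -
    have "d v \<noteq> 0" using d[of v] v by (metis DiffD1 DiffD2 insertI1 relpow_0_E)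
    then obtain m where m: "d v = Suc m" using not0_implies_Suc by blast
    then obtain p where p: "(x, p) \<in> adj E ^^ m" "(p, v) \<in> adj E"
      using d[of v] v by auto
    have "d p \<le> m" unfolding d_def by (rule Least_le) (rule p)
    with p m show ?thesis by auto
  qed
  then obtain p where p: "\<And>v. v \<in> V - {x} \<Longrightarrow> (p v, v) \<in> adj E \<and> d (p v) < d v"
    by metis
  have "inj_on (\<lambda>v. ed (p v) v) (V - {x})"
  proof (rule inj_onI)
    fix v w assume v: "v \<in> V - {x}" and w: "w \<in> V - {x}" and eq: "ed (p v) v = ed (p w) w"
    \<comment> \<open>The other case, \<open>p v = w\<close> and \<open>p w = v\<close>, would give
      \<open>d w < d v < d w\<close>.\<close>
    then show "v = w" using p[OF v] p[OF w] by (auto simp: ed_eq_iff)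
  qed
  moreover have "(\<lambda>v. ed (p v) v) ` (V - {x}) \<subseteq> E"
  proof (rule image_subsetI)
    fix v assume "v \<in> V - {x}"
    from p[OF this] show "ed (p v) v \<in> E" by (simp add: adj_def)
  qed
  ultimately have "card (V - {x}) \<le> card E"
    using card_inj_on_le assms(1) by blast
  moreover have "card V \<le> card (V - {x}) + 1"
    by (metis Suc_eq_plus1 Suc_pred add.commute add_leD1 assms(2) card_Diff_singleton_if diff_le_self le_SucI order_refl card_gt_0_iff emptyE le_diff_conv)
  ultimately show ?thesis by simp
qed

lemma walk_reaches:
  assumes "v \<in> set (x # ys)"
  shows "(x, v) \<in> (adj (set (edges x ys)))\<^sup>*"
  using assms
proof (induction ys arbitrary: x)
  case (Cons y ys)
  show ?case
  proof (cases "v = x")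
    case False
    then have "(y, v) \<in> (adj (set (edges y ys)))\<^sup>*"
      using Cons by auto
    then have "(y, v) \<in> (adj (set (edges x (y # ys))))\<^sup>*"
      using adj_mono[of "set (edges y ys)" "set (edges x (y # ys))"] by auto
    moreover have "(x, y) \<in> adj (set (edges x (y # ys)))"
      by (auto simp: adj_def)
    ultimately show ?thesis by (rule converse_rtrancl_into_rtrancl[rotated])
  qed auto
qed auto

text \<open>A path through the deleted edge takes the given detour instead; \<open>adj\<close> is
  symmetric, so the detour serves both directions.\<close>

lemma rtrancl_adj_remove:
  assumes "(u, v) \<in> (adj (E - {ed u v}))\<^sup>*"
  shows "(adj E)\<^sup>* \<subseteq> (adj (E - {ed u v}))\<^sup>*"
proof -
  have vu: "(v, u) \<in> (adj (E - {ed u v}))\<^sup>*"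
    using assms sym_rtrancl[OF sym_adj] by (meson symE)
  have "(y, z) \<in> (adj (E - {ed u v}))\<^sup>*" if "(y, z) \<in> adj E" for y z
  proof (cases "ed y z = ed u v")
    case True
    then show ?thesis using assms vu by (auto simp: ed_eq_iff)
  next
    case False
    then show ?thesis using that by (intro r_into_rtrancl) (auto simp: adj_def)
  qed
  then have "adj E \<subseteq> (adj (E - {ed u v}))\<^sup>*"
    by auto
  then show ?thesis
    using rtrancl_subset_rtrancl by blast
qed

lemma card_vertices_le_edges:
  "card (set (x # ys)) \<le> card (set (edges x ys)) + 1"
  by (rule card_reachable_le) (use walk_reaches in auto)

text \<open>The edge can be spared without disconnecting the graph of the walk, so the bound for
  connected graphs applies with one edge fewer.\<close>

lemma card_vertices_le_edges_removable:
  assumes uv: "ed u v \<in> set (edges x ys)"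
    and "(u, v) \<in> (adj (set (edges x ys) - {ed u v}))\<^sup>*"
  shows "card (set (x # ys)) \<le> card (set (edges x ys))"
proof -
  have "card (set (x # ys)) \<le> card (set (edges x ys) - {ed u v}) + 1"
    by (rule card_reachable_le) (use walk_reaches rtrancl_adj_remove[OF assms(2)] in auto)
  also have "\<dots> = card (set (edges x ys))"
    using uv by (metis List.finite_set Suc_eq_plus1 card_Suc_Diff1)
  finally show ?thesis .
qed

text \<open>Steps over \<open>ed u v\<close> change sides of the cut \<open>S\<close> and no other
  steps do, so their parity compares the two ends of the walk.\<close>

lemma odd_count_crossing_iff:
  assumes "u \<notin> S" "v \<in> S"
    and "\<And>y z. ed y z \<in> set (edges x ys) \<Longrightarrow> ed y z \<noteq> ed u v \<Longrightarrow> y \<in> S \<longleftrightarrow> z \<in> S"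
  shows "odd (count_list (edges x ys) (ed u v)) \<longleftrightarrow> (x \<in> S) \<noteq> (last (x # ys) \<in> S)"
  using assms(3)
proof (induction ys arbitrary: x)
  case (Cons y ys)
  have IH: "odd (count_list (edges y ys) (ed u v)) \<longleftrightarrow> (y \<in> S) \<noteq> (last (y # ys) \<in> S)"
    by (rule Cons.IH) (use Cons.prems in auto)
  show ?case
  proof (cases "ed x y = ed u v")
    case True
    then have "(x \<in> S) \<noteq> (y \<in> S)" using assms(1,2) by (auto simp: ed_eq_iff)
    then show ?thesis using IH True by auto
  next
    case False
    then have "(x \<in> S) = (y \<in> S)" using Cons.prems[of x y] by auto
    then show ?thesis using IH False by auto
  qed
qed auto

text \<open>A closed walk crosses every cut an even number of times, so an edge of odd multiplicity is
  not a bridge.\<close>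

lemma odd_edge_not_bridge:
  assumes closed: "last (x # ys) = x" and odd: "ed u v \<in> odd_edges (edges x ys)"
  shows "(u, v) \<in> (adj (set (edges x ys) - {ed u v}))\<^sup>*"
proof (rule ccontr)
  \<comment> \<open>The cut used below is the component of \<open>v\<close> after deletion of the
    edge; under the assumption it misses \<open>u\<close>.\<close>
  define R where "R = (adj (set (edges x ys) - {ed u v}))\<^sup>*"
  assume "(u, v) \<notin> (adj (set (edges x ys) - {ed u v}))\<^sup>*"
  then have uv: "(v, u) \<notin> R"
    using sym_rtrancl[OF sym_adj] unfolding R_def by (meson symE)
  have "y \<in> {w. (v, w) \<in> R} \<longleftrightarrow> z \<in> {w. (v, w) \<in> R}"
    if "ed y z \<in> set (edges x ys)" "ed y z \<noteq> ed u v" for y z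
  proof -
    have "(y, z) \<in> adj (set (edges x ys) - {ed u v})" "(z, y) \<in> adj (set (edges x ys) - {ed u v})"
      using that by (auto simp: adj_def ed_commute)
    then show ?thesis unfolding R_def by (auto intro: rtrancl_into_rtrancl)
  qed
  then have "odd (count_list (edges x ys) (ed u v)) \<longleftrightarrow>
      (x \<in> {w. (v, w) \<in> R}) \<noteq> (last (x # ys) \<in> {w. (v, w) \<in> R})"
    by (intro odd_count_crossing_iff) (use uv in \<open>auto simp: R_def\<close>)
  with closed odd show False by (auto simp: odd_edges_def)
qed

lemma edge_exists: "f \<in> set (edges x ys) \<Longrightarrow> \<exists>u v. f = ed u v"
  by (induction ys arbitrary: x) auto

text \<open>An odd edge is not a bridge within \<open>qs\<close>, hence not within the larger walk.
  Allowing \<open>qs\<close> to be any closed part makes this apply to the excursions of a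
  decomposed walk and to one half of a glued pair.\<close>

lemma card_vertices_le_if_odd_subwalk:
  assumes closed: "last (y # qs) = y" and odd: "odd_edges (edges y qs) \<noteq> {}"
    and sub: "set (edges y qs) \<subseteq> set (edges x ys)"
  shows "card (set (x # ys)) \<le> card (set (edges x ys))"
proof -
  obtain f where f: "f \<in> odd_edges (edges y qs)" using odd by blast
  then have fset: "f \<in> set (edges y qs)" by (rule subsetD[OF odd_edges_subset])
  then obtain u v where uv: "f = ed u v" using edge_exists by blast
  have "(u, v) \<in> (adj (set (edges y qs) - {ed u v}))\<^sup>*"
    using odd_edge_not_bridge[OF closed] f uv by blast
  then have "(u, v) \<in> (adj (set (edges x ys) - {ed u v}))\<^sup>*"
    using adj_mono[of "set (edges y qs) - {ed u v}" "set (edges x ys) - {ed u v}"] sub by blast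
  then show ?thesis
    using card_vertices_le_edges_removable fset sub uv by blast
qed

section \<open>Number of edges against length and parity\<close>

lemma length_eq_sum_count: "(\<Sum>e\<in>set es. count_list es e) = length es"
  by (rule sum_count_set) auto

text \<open>At every edge used, the multiplicity plus 1 for odd parity is at least 2.\<close>

lemma two_card_edges_le: "2 * card (set es) \<le> length es + card (odd_edges es)"
proof -
  have "2 * card (set es) = (\<Sum>e\<in>set es. 2)" by simp
  also have "\<dots> \<le> (\<Sum>e\<in>set es. count_list es e + (if e \<in> odd_edges es then 1 else 0))"
  proof (rule sum_mono)
    fix e assume "e \<in> set es"
    then have "count_list es e \<noteq> 0" by (simp add: count_list_0_iff)
    then show "2 \<le> count_list es e + (if e \<in> odd_edges es then 1 else 0)"
      unfolding odd_edges_def mem_Collect_eq by presburger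
  qed
  also have "\<dots> = length es + card (set es \<inter> odd_edges es)"
    by (simp add: sum.distrib length_eq_sum_count sum.If_cases)
  also have "set es \<inter> odd_edges es = odd_edges es" by (rule Int_absorb1[OF odd_edges_subset])
  finally show ?thesis .
qed

text \<open>A multiplicity of at least 3, corrected by 1 if odd, is at least 4; this gains 2 over
  the preceding count.\<close>

lemma two_card_edges_less_if_triple:
  assumes "count_list es f \<ge> 3"
  shows "2 * card (set es) + 2 \<le> length es + card (odd_edges es)"
proof -
  have f: "f \<in> set es" using assms by (metis count_notin not_numeral_le_zero)
  have "2 * card (set es) + 2 = (\<Sum>e\<in>set es. 2 + (if e = f then 2 else 0))"
    using f by (subst sum.distrib) simp
  also have "\<dots> \<le> (\<Sum>e\<in>set es. count_list es e + (if e \<in> odd_edges es then 1 else 0))"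
  proof (rule sum_mono)
    fix e assume "e \<in> set es"
    then have "count_list es e \<noteq> 0" by (simp add: count_list_0_iff)
    moreover have "count_list es e \<ge> 3" if "e = f" using assms that by simp
    ultimately show "2 + (if e = f then 2 else 0) \<le> count_list es e + (if e \<in> odd_edges es then 1 else 0)"
      unfolding odd_edges_def mem_Collect_eq by (cases "e = f"; simp; presburger)
  qed
  also have "\<dots> = length es + card (set es \<inter> odd_edges es)"
    by (simp add: sum.distrib length_eq_sum_count sum.If_cases)
  also have "set es \<inter> odd_edges es = odd_edges es" by (rule Int_absorb1[OF odd_edges_subset])
  finally show ?thesis .
qed

lemma two_card_vertices_le_if_odd_subwalk:
  assumes "last (y # qs) = y" "odd_edges (edges y qs) \<noteq> {}"
    and "set (edges y qs) \<subseteq> set (edges x ys)"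
  shows "2 * card (set (x # ys)) \<le> length ys + card (odd_edges (edges x ys))"
  using card_vertices_le_if_odd_subwalk[OF assms] two_card_edges_le[of "edges x ys"]
  by (simp only: length_edges)

text \<open>The additional vertex of the tree bound costs 2 after doubling, exactly what the triple
  edge gains.\<close>

lemma two_card_vertices_le_if_triple:
  assumes "count_list (edges x ys) f \<ge> 3"
  shows "2 * card (set (x # ys)) \<le> length ys + card (odd_edges (edges x ys))"
  using card_vertices_le_edges[of x ys] two_card_edges_less_if_triple[OF assms]
  by (simp only: length_edges)

text \<open>A tree-like even closed walk returns over its first edge exactly once.\<close>

lemma even_closed_walk_decompose:
  assumes closed: "last (i # x # zs) = i" and even: "odd_edges (edges i (x # zs)) = {}"
    and tree: "2 * card (set (i # x # zs)) > length (x # zs)"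
  obtains ps rs where "zs = ps @ i # rs" "last (x # ps) = x" "last (i # rs) = i"
    "odd_edges (edges x ps) = {}" "odd_edges (edges i rs) = {}"
proof -
  define f where "f = ed i x"
  have "even (count_list (edges i (x # zs)) f)"
    using even unfolding odd_edges_def by blast
  then have "odd (count_list (edges x zs) f)"
    by (simp add: f_def)
  then have "f \<in> set (edges x zs)"
    by (metis count_notin even_zero)
  \<comment> \<open>\<open>ps\<close> stops just before the first reuse of \<open>f\<close>, whose
    direction is still open.\<close>
  then have "\<exists>ps y rs. zs = ps @ y # rs \<and> f = ed (last (x # ps)) y \<and> f \<notin> set (edges x ps)"
  proof (induction zs arbitrary: x)
    case (Cons z zs)
    show ?case
    proof (cases "f = ed x z")
      case True
      then show ?thesis by (intro exI[of _ "[]"]) auto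
    next
      case False
      then have "f \<in> set (edges z zs)" using Cons.prems by auto
      then obtain ps y rs where "zs = ps @ y # rs" "f = ed (last (z # ps)) y" "f \<notin> set (edges z ps)"
        using Cons.IH by blast
      then show ?thesis using False
        by (intro exI[of _ "z # ps"] exI[of _ y] exI[of _ rs]) auto
    qed
  qed auto
  then obtain ps y rs where zs: "zs = ps @ y # rs" and f: "f = ed (last (x # ps)) y"
    and nf: "f \<notin> set (edges x ps)" by blast
  have sub: "set (edges x ps) \<subseteq> set (edges i (x # zs))" "set (edges y rs) \<subseteq> set (edges i (x # zs))"
    by (auto simp: zs edges_append)
  have nt: "\<not> 2 * card (set (i # x # zs)) \<le> length (x # zs) + card (odd_edges (edges i (x # zs)))"
    using tree even by (simp del: edges.simps)
  \<comment> \<open>If \<open>f\<close> were crossed from \<open>i\<close> to \<open>x\<close>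
    again, \<open>ps\<close> would join \<open>x\<close> to \<open>i\<close> without using
    \<open>f\<close>; then \<open>f\<close> would not be a bridge and a vertex would be lost,
    against \<open>tree\<close>.\<close>
  have "last (x # ps) = x \<and> y = i"
  proof (rule ccontr)
    assume "\<not> ?thesis"
    then have l: "last (x # ps) = i" using f by (auto simp: f_def ed_eq_iff)
    have "(x, i) \<in> (adj (set (edges x ps)))\<^sup>*"
      by (rule walk_reaches) (metis l last_in_set list.distinct(1))
    then have "(x, i) \<in> (adj (set (edges i (x # zs)) - {ed x i}))\<^sup>*"
      using adj_mono[of "set (edges x ps)" "set (edges i (x # zs)) - {ed x i}"] nf sub
      by (auto simp: f_def ed_commute)
    then have "card (set (i # x # zs)) \<le> card (set (edges i (x # zs)))"
      by (rule card_vertices_le_edges_removable[rotated]) (simp add: ed_commute)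
    then show False
      using nt two_card_edges_le[of "edges i (x # zs)"] by (simp only: length_edges)
  qed
  then have l: "last (x # ps) = x" and y: "y = i" by auto
  have cr: "last (i # rs) = i" using closed by (auto simp: zs y split: if_splits)
  show thesis
  proof
    show "zs = ps @ i # rs" using zs y by simp
    \<comment> \<open>An odd edge in either closed piece would cost the whole walk a vertex, again
      against \<open>tree\<close>.\<close>
    show "odd_edges (edges x ps) = {}"
      using two_card_vertices_le_if_odd_subwalk[OF l _ sub(1)] nt by blast
    show "odd_edges (edges i rs) = {}"
      using two_card_vertices_le_if_odd_subwalk[OF cr] sub(2) y nt by blast
  qed (use l cr in auto)
qed

subsection \<open>Counting even closed walks\<close>

text \<open>Periodicity makes the band regular, and regularity with symmetry is all that the
  counting takes from the band. The diagonal is relevant, so loops must be allowed.\<close>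

locale band_graph =
  fixes V :: "nat set" and N :: "nat \<Rightarrow> nat set" and b :: nat
  assumes finite_V [simp]: "finite V"
    and N_subset: "x \<in> V \<Longrightarrow> N x \<subseteq> V"
    and card_N: "x \<in> V \<Longrightarrow> card (N x) = b"
    and N_sym: "x \<in> V \<Longrightarrow> y \<in> N x \<Longrightarrow> x \<in> N y"
    and b_pos: "0 < b"
begin

lemma finite_N: "x \<in> V \<Longrightarrow> finite (N x)"
  using N_subset finite_V finite_subset by blast

fun walk :: "nat \<Rightarrow> nat list \<Rightarrow> bool" where
  "walk x [] \<longleftrightarrow> True"
| "walk x (y # ys) \<longleftrightarrow> y \<in> N x \<and> walk y ys"

lemma walk_append: "walk x (ys @ zs) \<longleftrightarrow> walk x ys \<and> walk (last (x # ys)) zs"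
  by (induction ys arbitrary: x) auto

lemma walk_subset: "x \<in> V \<Longrightarrow> walk x ys \<Longrightarrow> set (x # ys) \<subseteq> V"
  using N_subset by (induction ys arbitrary: x) auto

lemma walk_last: "x \<in> V \<Longrightarrow> walk x ys \<Longrightarrow> last (x # ys) \<in> V"
  using walk_subset by (metis last_in_set list.discI subsetD)

definition walks :: "nat \<Rightarrow> nat \<Rightarrow> nat list set" where
  "walks k x = {ys. length ys = k \<and> walk x ys}"

lemma finite_walks [simp]: "x \<in> V \<Longrightarrow> finite (walks k x)"
  by (rule finite_subset[OF _ finite_lists_length_eq[OF finite_V, of k]])
    (use walk_subset in \<open>auto simp: walks_def\<close>)

lemma walks_0 [simp]: "walks 0 x = {[]}"
  by (auto simp: walks_def)

text \<open>Walks recurse from the front, but the weight of a new vertex depends on the set already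
  visited; the induction on the length therefore has to extend walks at the end.\<close>

lemma sum_walks_snoc:
  assumes "x \<in> V"
  shows "(\<Sum>ys\<in>walks (Suc k) x. f ys) = (\<Sum>ys\<in>walks k x. \<Sum>y\<in>N (last (x # ys)). f (ys @ [y]))"
proof -
  have "(\<Sum>ys\<in>walks k x. \<Sum>y\<in>N (last (x # ys)). f (ys @ [y])) =
      (\<Sum>(ys, y)\<in>Sigma (walks k x) (\<lambda>ys. N (last (x # ys))). f (ys @ [y]))"
    by (rule sum.Sigma) (use assms walk_last finite_N finite_walks in \<open>auto simp: walks_def simp del: last.simps\<close>)
  also have "\<dots> = (\<Sum>ys\<in>walks (Suc k) x. f ys)"
  proof (rule sum.reindex_bij_witness[of _ "\<lambda>ys. (butlast ys, last ys)" "\<lambda>(ys, y). ys @ [y]"])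
    fix ys assume ys: "ys \<in> walks (Suc k) x"
    then have e: "butlast ys @ [last ys] = ys"
      by (intro append_butlast_last_id) (auto simp: walks_def)
    have "walk x (butlast ys @ [last ys])"
      using ys e by (simp add: walks_def)
    then show "(butlast ys, last ys) \<in> Sigma (walks k x) (\<lambda>ys. N (last (x # ys)))"
      using ys unfolding walk_append by (auto simp: walks_def)
    show "(case (butlast ys, last ys) of (ys, y) \<Rightarrow> ys @ [y]) = ys" using e by simp
  qed (auto simp: walks_def walk_append)
  finally show ?thesis ..
qed

text \<open>Weighting a walk by one factor \<open>1/b\<close> per distinct vertex compensates exactly for the
  \<open>b\<close> possible choices of each newly visited vertex.\<close>

lemma sum_walks_inverse_power_le:
  assumes x: "x \<in> V"
  shows "(\<Sum>ys\<in>walks k x. (1 / real b) ^ card (set (x # ys))) \<le> fact (k + 1) / real b"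
proof (induction k)
  case (Suc k)
  let ?c = "\<lambda>ys. card (set (x # ys))"
  \<comment> \<open>At most \<open>k + 1\<close> neighbours are already visited and leave the weight
    unchanged; the others multiply it by \<open>1 / b\<close> and together add at most one more
    copy.\<close>
  have step: "(\<Sum>y\<in>N (last (x # ys)). (1 / real b) ^ ?c (ys @ [y])) \<le> real (k + 2) * (1 / real b) ^ ?c ys"
    if ys: "ys \<in> walks k x" for ys
  proof -
    have l: "last (x # ys) \<in> V" using walk_last x ys by (auto simp: walks_def)
    let ?N = "N (last (x # ys))" and ?S = "set (x # ys)"
    have fin: "finite ?N" using finite_N l by blast
    have "(\<Sum>y\<in>?N. (1 / real b) ^ ?c (ys @ [y])) \<le>
        (\<Sum>y\<in>?N. (if y \<in> ?S then (1 / real b) ^ ?c ys else 0) + (1 / real b) * (1 / real b) ^ ?c ys)"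
    proof (rule sum_mono)
      fix y
      have "set (x # ys @ [y]) = insert y ?S" by auto
      then have "?c (ys @ [y]) = (if y \<in> ?S then ?c ys else Suc (?c ys))"
        by (auto simp: insert_absorb)
      then show "(1 / real b) ^ ?c (ys @ [y]) \<le>
        (if y \<in> ?S then (1 / real b) ^ ?c ys else 0) + (1 / real b) * (1 / real b) ^ ?c ys"
        by (auto simp del: set_simps)
    qed
    also have "\<dots> = real (card (?N \<inter> ?S)) * (1 / real b) ^ ?c ys + real (card ?N) * (1 / real b) * (1 / real b) ^ ?c ys"
      using fin by (simp add: sum.distrib sum.If_cases del: set_simps)
    also have "real (card ?N) * (1 / real b) = 1" using card_N[OF l] b_pos by simp
    also have "real (card (?N \<inter> ?S)) \<le> real (k + 1)"
    proof -
      have "card (?N \<inter> ?S) \<le> card ?S" by (rule card_mono) auto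
      also have "\<dots> \<le> length (x # ys)" by (rule card_length)
      finally show ?thesis using ys by (simp add: walks_def)
    qed
    finally show ?thesis by (simp add: algebra_simps mult_right_mono del: set_simps)
  qed
  have "(\<Sum>ys\<in>walks (Suc k) x. (1 / real b) ^ ?c ys) \<le> (\<Sum>ys\<in>walks k x. real (k + 2) * (1 / real b) ^ ?c ys)"
    unfolding sum_walks_snoc[OF x] by (rule sum_mono) (rule step)
  also have "\<dots> = real (k + 2) * (\<Sum>ys\<in>walks k x. (1 / real b) ^ ?c ys)"
    by (simp add: sum_distrib_left del: set_simps)
  also have "\<dots> \<le> real (k + 2) * (fact (k + 1) / real b)"
    by (rule mult_left_mono) (use Suc in auto)
  also have "\<dots> = fact (Suc k + 1) / real b" by (simp add: algebra_simps)
  finally show ?case .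
qed auto

section \<open>Even closed walks and their splitting at a return over the first edge\<close>

definition closed_walks :: "nat \<Rightarrow> nat \<Rightarrow> nat list set" where
  "closed_walks k x = {ys \<in> walks k x. last (x # ys) = x}"

lemma finite_closed_walks [simp]: "x \<in> V \<Longrightarrow> finite (closed_walks k x)"
  by (auto simp: closed_walks_def)

definition even_walks :: "nat \<Rightarrow> nat \<Rightarrow> nat list set" where
  "even_walks k x = {ys \<in> closed_walks k x. odd_edges (edges x ys) = {}}"

lemmas walk_set_defs = even_walks_def closed_walks_def walks_def

lemma finite_even_walks [simp]: "x \<in> V \<Longrightarrow> finite (even_walks k x)"
  by (auto simp: even_walks_def)

lemma even_walks_0 [simp]: "even_walks 0 x = {[]}"
  by (auto simp: even_walks_def closed_walks_def odd_edges_def)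

lemma even_walks_odd:
  assumes "odd k" shows "even_walks k x = {}"
proof -
  have False if "ys \<in> even_walks k x" for ys
  proof -
    have "length (edges x ys) = k" "odd_edges (edges x ys) = {}"
      using that by (auto simp: walk_set_defs)
    moreover have "even (\<Sum>e\<in>set (edges x ys). count_list (edges x ys) e)"
      using \<open>odd_edges (edges x ys) = {}\<close> by (intro dvd_sum) (auto simp: odd_edges_def)
    ultimately show False using assms by (simp only: length_eq_sum_count)
  qed
  then show ?thesis by blast
qed

text \<open>The shape behind the Catalan recursion: out to \<open>y\<close>, an even excursion of
  length \<open>j\<close>, back to \<open>x\<close>, an even rest. The return need not be the first
  one, so the sets for different \<open>j\<close> may overlap.\<close>

definition splits_at :: "nat \<Rightarrow> nat \<Rightarrow> nat \<Rightarrow> nat list set" where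
  "splits_at k x j =
     (\<lambda>(y, ps, rs). y # ps @ x # rs) ` (SIGMA y:N x. even_walks j y \<times> even_walks (k - j) x)"

lemma even_count_if_odd_edges_empty: "even (count_list es e)" if "odd_edges es = {}"
  using that by (auto simp: odd_edges_def)

lemma splits_at_subset:
  assumes x: "x \<in> V" and "j \<le> k"
  shows "splits_at k x j \<subseteq> even_walks (k + 2) x"
proof
  fix w assume "w \<in> splits_at k x j"
  then obtain y ps rs where w: "w = y # ps @ x # rs" and y: "y \<in> N x"
    and ps: "ps \<in> even_walks j y" and rs: "rs \<in> even_walks (k - j) x"
    unfolding splits_at_def by auto
  have l: "last (y # ps) = y" "last (x # rs) = x"
    using ps rs by (auto simp: even_walks_def closed_walks_def)
  have "even (count_list (edges x w) e)" for e
  proof -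
    have "edges x w = ed x y # edges y ps @ ed x y # edges x rs"
      using l(1) by (simp add: w edges_append ed_commute split: if_splits)
    moreover have "even (count_list (edges y ps) e)" "even (count_list (edges x rs) e)"
      using ps rs by (auto simp: even_walks_def even_count_if_odd_edges_empty)
    ultimately show ?thesis by simp
  qed
  moreover have "walk x w"
    using y ps rs l N_sym[OF x y]
    by (auto simp: w walk_set_defs walk_append simp del: last.simps)
  moreover have "length w = k + 2"
    using ps rs assms(2) by (auto simp: w walk_set_defs)
  moreover have "last (x # w) = x" using l(2) by (simp add: w)
  ultimately show "w \<in> even_walks (k + 2) x"
    by (auto simp: walk_set_defs odd_edges_def)
qed

text \<open>For fixed \<open>j\<close> the position of the return is known, so the concatenated list
  determines its pieces.\<close>

lemma card_splits_at:
  assumes x: "x \<in> V"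
  shows "card (splits_at k x j) = (\<Sum>y\<in>N x. card (even_walks j y) * card (even_walks (k - j) x))"
proof -
  have "inj_on (\<lambda>(y, ps, rs). y # ps @ x # rs) (SIGMA y:N x. even_walks j y \<times> even_walks (k - j) x)"
  proof (rule inj_onI)
    fix p p'
    assume p: "p \<in> (SIGMA y:N x. even_walks j y \<times> even_walks (k - j) x)"
        "p' \<in> (SIGMA y:N x. even_walks j y \<times> even_walks (k - j) x)"
      and eq: "(\<lambda>(y, ps, rs). y # ps @ x # rs) p = (\<lambda>(y, ps, rs). y # ps @ x # rs) p'"
    obtain y ps rs y' ps' rs' where pp: "p = (y, ps, rs)" "p' = (y', ps', rs')"
      using prod_cases3 by metis
    have "length ps = j" "length ps' = j"
      using p by (simp_all add: pp walk_set_defs)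
    then show "p = p'" using eq by (simp add: pp)
  qed
  then have "card (splits_at k x j) = card (SIGMA y:N x. even_walks j y \<times> even_walks (k - j) x)"
    unfolding splits_at_def by (rule card_image)
  also have "\<dots> = (\<Sum>y\<in>N x. card (even_walks j y \<times> even_walks (k - j) x))"
    by (rule card_SigmaI) (use x subsetD[OF N_subset[OF x]] finite_N in auto)
  finally show ?thesis by (simp add: card_cartesian_product)
qed

text \<open>Even walks with \<open>k / 2 + 1\<close> vertices, the maximum, run over a tree and use
  each edge twice; this set collects the others.\<close>

definition bad_walks :: "nat \<Rightarrow> nat \<Rightarrow> nat list set" where
  "bad_walks k x = {ys \<in> even_walks k x. 2 * card (set (x # ys)) \<le> k}"

lemma finite_bad_walks [simp]: "x \<in> V \<Longrightarrow> finite (bad_walks k x)"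
  by (auto simp: bad_walks_def)

lemma splits_at_cover:
  assumes x: "x \<in> V"
  shows "even_walks (k + 2) x \<subseteq> bad_walks (k + 2) x \<union> (\<Union>j\<le>k. splits_at k x j)"
proof
  fix w assume w: "w \<in> even_walks (k + 2) x"
  show "w \<in> bad_walks (k + 2) x \<union> (\<Union>j\<le>k. splits_at k x j)"
  proof (cases "2 * card (set (x # w)) \<le> k + 2")
    case True
    then show ?thesis using w by (auto simp: bad_walks_def)
  next
    case False
    have lw: "length w = k + 2" "walk x w" "last (x # w) = x" "odd_edges (edges x w) = {}"
      using w by (auto simp: walk_set_defs)
    then obtain y zs where wy: "w = y # zs" by (cases w) auto
    obtain ps rs where d: "zs = ps @ x # rs" "last (y # ps) = y" "last (x # rs) = x"
      "odd_edges (edges y ps) = {}" "odd_edges (edges x rs) = {}"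
      by (rule even_closed_walk_decompose[of x y zs]) (use lw wy False in auto)
    have wk: "y \<in> N x" "walk y ps" "walk x rs"
      using lw(2) by (auto simp: wy d walk_append)
    have len: "length ps + length rs = k" using lw(1) by (simp add: wy d)
    then have "length rs = k - length ps" by simp
    then have "w \<in> splits_at k x (length ps)"
      unfolding splits_at_def using d wk
      by (intro image_eqI[of _ _ "(y, ps, rs)"]) (auto simp: wy walk_set_defs)
    then show ?thesis using len by auto
  qed
qed

text \<open>The first step and the two returns use \<open>ed x y\<close> three times in all, as the
  earlier return is an inner step of the longer excursion.\<close>

lemma splits_at_overlap:
  assumes x: "x \<in> V" and "j < j'" "j' \<le> k" and w: "w \<in> splits_at k x j" "w \<in> splits_at k x j'"
  shows "w \<in> bad_walks (k + 2) x"
proof -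
  obtain y ps rs where d: "w = y # ps @ x # rs" "ps \<in> even_walks j y"
    using w(1) unfolding splits_at_def by auto
  obtain y' ps' rs' where d': "w = y' # ps' @ x # rs'" "ps' \<in> even_walks j' y'"
    using w(2) unfolding splits_at_def by auto
  have y: "y' = y" using d d' by simp
  have l: "length ps = j" "length ps' = j'" "last (y # ps) = y" "last (y # ps') = y"
    using d d' y by (auto simp: walk_set_defs)
  obtain us where us: "ps' = ps @ x # us"
  proof -
    have "ps @ x # rs = ps' @ x # rs'" using d d' by simp
    then have "take j' (ps @ x # rs) = ps'" using l by (metis append_eq_conv_conj)
    then have "ps' = ps @ take (j' - j) (x # rs)" using l(1) assms(2) by simp
    then show ?thesis using that assms(2) by (cases "j' - j") auto
  qed
  have "edges x w = ed x y # edges y ps @ ed y x # edges x us @ ed y x # edges x rs'"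
    using d'(1) y us l by (simp add: edges_append split: if_splits)
  then have "count_list (edges x w) (ed x y) \<ge> 3" by (simp add: ed_commute)
  moreover have "w \<in> even_walks (k + 2) x" using splits_at_subset[OF x] w(2) assms(3) by blast
  ultimately show ?thesis
    using two_card_vertices_le_if_triple[of x w "ed x y"]
    by (auto simp: bad_walks_def walk_set_defs)
qed

text \<open>Each walk is counted with the number of its split positions, which is 1 unless the walk
  is bad and never exceeds \<open>k + 1\<close>.\<close>

lemma card_even_walks_recursion:
  assumes x: "x \<in> V"
  shows "\<bar>real (card (even_walks (k + 2) x)) -
      (\<Sum>j\<le>k. \<Sum>y\<in>N x. real (card (even_walks j y)) * real (card (even_walks (k - j) x)))\<bar>
    \<le> real (k + 1) * real (card (bad_walks (k + 2) x))"
proof -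
  let ?E = "even_walks (k + 2) x" and ?B = "bad_walks (k + 2) x"
  have fin: "finite ?E" "finite ?B" using x by auto
  have BE: "?B \<subseteq> ?E" by (auto simp: bad_walks_def)
  define m where "m w = card {j \<in> {..k}. w \<in> splits_at k x j}" for w
  have "(\<Sum>j\<le>k. \<Sum>y\<in>N x. real (card (even_walks j y)) * real (card (even_walks (k - j) x)))
      = real (\<Sum>j\<le>k. card (splits_at k x j))"
    by (simp add: card_splits_at[OF x])
  also have "(\<Sum>j\<le>k. card (splits_at k x j)) = (\<Sum>j\<le>k. \<Sum>w\<in>?E. if w \<in> splits_at k x j then 1 else 0)"
    using splits_at_subset[OF x] fin
    by (intro sum.cong refl) (simp add: sum.If_cases Int_absorb1)
  also have "\<dots> = (\<Sum>w\<in>?E. m w)"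
    unfolding m_def by (subst sum.swap) (simp add: sum.If_cases Int_def)
  finally have eq: "(\<Sum>j\<le>k. \<Sum>y\<in>N x. real (card (even_walks j y)) * real (card (even_walks (k - j) x)))
      = (\<Sum>w\<in>?E. real (m w))" by simp
  have le: "\<bar>1 - real (m w)\<bar> \<le> (if w \<in> ?B then real (k + 1) else 0)" if w: "w \<in> ?E" for w
  proof (cases "w \<in> ?B")
    case True
    have "m w \<le> card {..k}" unfolding m_def by (rule card_mono) auto
    then show ?thesis using True by simp
  next
    case False
    then obtain j where j: "j \<le> k" "w \<in> splits_at k x j" using splits_at_cover[OF x] w by blast
    have "j' = j" if "j' \<le> k" "w \<in> splits_at k x j'" for j'
    proof (rule ccontr)
      assume "j' \<noteq> j"
      then consider "j' < j" | "j < j'" by linarith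
      then show False
        using splits_at_overlap[OF x _ _ that(2) j(2)] splits_at_overlap[OF x _ _ j(2) that(2)]
          j(1) that(1) False by cases auto
    qed
    then have "{j \<in> {..k}. w \<in> splits_at k x j} = {j}" using j by blast
    then show ?thesis using False by (simp add: m_def)
  qed
  have "\<bar>real (card ?E) - (\<Sum>w\<in>?E. real (m w))\<bar> = \<bar>\<Sum>w\<in>?E. 1 - real (m w)\<bar>"
    by (simp add: sum_subtractf)
  also have "\<dots> \<le> (\<Sum>w\<in>?E. if w \<in> ?B then real (k + 1) else 0)"
    by (rule order_trans[OF sum_abs]) (rule sum_mono, rule le)
  also have "\<dots> = real (k + 1) * real (card ?B)"
    using fin BE by (simp add: sum.If_cases Int_absorb1)
  finally show ?thesis unfolding eq .
qed

text \<open>With at most \<open>k / 2\<close> vertices, \<open>sqrt b ^ k\<close> provides a factor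
  \<open>b\<close> for every vertex, and the weighted count of all walks applies.\<close>

lemma card_bad_walks_le:
  assumes x: "x \<in> V"
  shows "real (card (bad_walks k x)) / sqrt (real b) ^ k \<le> fact (k + 1) / real b"
proof -
  have "real (card (bad_walks k x)) / sqrt (real b) ^ k = (\<Sum>ys\<in>bad_walks k x. (1 / sqrt (real b)) ^ k)"
    by (simp add: power_one_over)
  also have "\<dots> \<le> (\<Sum>ys\<in>bad_walks k x. (1 / real b) ^ card (set (x # ys)))"
  proof (rule sum_mono)
    fix ys assume "ys \<in> bad_walks k x"
    then have "2 * card (set (x # ys)) \<le> k" by (auto simp: bad_walks_def)
    then have "(1 / sqrt (real b)) ^ k \<le> (1 / sqrt (real b)) ^ (2 * card (set (x # ys)))"
      by (rule power_decreasing) (use b_pos in auto)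
    also have "\<dots> = (1 / real b) ^ card (set (x # ys))"
      by (simp add: power_mult power_one_over del: set_simps)
    finally show "(1 / sqrt (real b)) ^ k \<le> (1 / real b) ^ card (set (x # ys))" .
  qed
  also have "\<dots> \<le> (\<Sum>ys\<in>walks k x. (1 / real b) ^ card (set (x # ys)))"
    by (rule sum_mono2) (use x in \<open>auto simp: bad_walks_def even_walks_def closed_walks_def\<close>)
  also note sum_walks_inverse_power_le[OF x]
  finally show ?thesis .
qed

text \<open>The contribution of the root \<open>x\<close> at \<open>t = 0\<close>, where
  \<open>tanh t\<close> vanishes and only even walks survive.\<close>

definition even_density :: "nat \<Rightarrow> nat \<Rightarrow> real" where
  "even_density k x = real (card (even_walks k x)) / sqrt (real b) ^ k"

lemma even_density_recursion:
  assumes x: "x \<in> V"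
  shows "\<bar>even_density (k + 2) x - (\<Sum>j\<le>k. (\<Sum>y\<in>N x. even_density j y) / real b * even_density (k - j) x)\<bar>
    \<le> real (k + 1) * fact (k + 3) / real b"
proof -
  let ?q = "sqrt (real b)"
  have q: "?q > 0" "?q ^ 2 = real b" using b_pos by auto
  have "even_density (k + 2) x - (\<Sum>j\<le>k. (\<Sum>y\<in>N x. even_density j y) / real b * even_density (k - j) x)
    = (real (card (even_walks (k + 2) x)) -
      (\<Sum>j\<le>k. \<Sum>y\<in>N x. real (card (even_walks j y)) * real (card (even_walks (k - j) x)))) / ?q ^ (k + 2)"
  proof -
    have "(\<Sum>y\<in>N x. even_density j y) / real b * even_density (k - j) x =
      (\<Sum>y\<in>N x. real (card (even_walks j y)) * real (card (even_walks (k - j) x))) / ?q ^ (k + 2)"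
      if "j \<le> k" for j
    proof -
      have "?q ^ (k + 2) = ?q ^ j * real b * ?q ^ (k - j)"
        using that q by (metis (no_types, lifting) le_add_diff_inverse mult.assoc mult.commute power_add)
      then show ?thesis
        by (simp only: even_density_def sum_distrib_right sum_divide_distrib)
          (simp add: field_simps)
    qed
    then show ?thesis
      by (simp add: even_density_def diff_divide_distrib sum_divide_distrib)
  qed
  then have "\<bar>even_density (k + 2) x - (\<Sum>j\<le>k. (\<Sum>y\<in>N x. even_density j y) / real b * even_density (k - j) x)\<bar>
      \<le> real (k + 1) * real (card (bad_walks (k + 2) x)) / ?q ^ (k + 2)"
    using card_even_walks_recursion[OF x, of k] q by (simp add: abs_divide divide_right_mono)
  also have "\<dots> \<le> real (k + 1) * (fact (k + 3) / real b)"
    using mult_left_mono[OF card_bad_walks_le[OF x, of "k + 2"], of "real (k + 1)"] by (simp add: eval_nat_numeral)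
  finally show ?thesis by simp
qed

end

subsection \<open>Moments of the semicircle distribution\<close>

text \<open>Kept without the indicator, hence continuous on the whole line; beyond 2 in absolute
  value it is negative, because \<open>sqrt\<close> is odd.\<close>

definition sc_density :: "real \<Rightarrow> real" where
  "sc_density x = 1 / (2 * pi) * sqrt (4 - x\<^sup>2)"

lemma continuous_on_sc_density [continuous_intros]: "continuous_on A sc_density"
  unfolding sc_density_def by (intro continuous_intros)

lemma borel_measurable_sc_density [measurable]: "sc_density \<in> borel_measurable borel"
  by (intro borel_measurable_continuous_onI continuous_intros)

lemma sc_density_nonneg: "x \<in> {-2..2} \<Longrightarrow> 0 \<le> sc_density x"
proof -
  assume "x \<in> {-2..2}"
  then have "x\<^sup>2 \<le> 2\<^sup>2" by (intro abs_le_square_iff[THEN iffD1]) auto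
  then show ?thesis by (simp add: sc_density_def)
qed

lemma semicircle_eq: "semicircle = density lborel (\<lambda>x. ennreal (indicator {-2..2} x * sc_density x))"
  by (simp add: semicircle_def sc_density_def mult_ac)

lemma semicircle_integrable_iff:
  assumes "f \<in> borel_measurable borel"
  shows "integrable semicircle f \<longleftrightarrow> set_integrable lborel {-2..2} (\<lambda>x. sc_density x * f x)"
  unfolding semicircle_eq set_integrable_def
  by (subst integrable_density) (use assms in \<open>auto simp: mult_ac indicator_def sc_density_nonneg intro!: AE_I2\<close>)

lemma semicircle_integral_eq:
  assumes "f \<in> borel_measurable borel"
  shows "(\<integral>x. f x \<partial>semicircle) = (LINT x:{-2..2}|lborel. sc_density x * f x)"
  unfolding semicircle_eq set_lebesgue_integral_def
  by (subst integral_density) (use assms in \<open>auto simp: mult_ac indicator_def sc_density_nonneg intro!: AE_I2\<close>)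

lemma semicircle_integrable_continuous:
  fixes f :: "real \<Rightarrow> real"
  assumes "continuous_on UNIV f"
  shows "integrable semicircle f"
proof -
  have "continuous_on {-2..2} (\<lambda>x. sc_density x * f x)"
    by (intro continuous_intros continuous_on_subset[OF assms]) auto
  then show ?thesis
    using assms by (subst semicircle_integrable_iff)
      (auto intro!: borel_integrable_atLeastAtMost' borel_measurable_continuous_onI)
qed

lemma semicircle_integral_continuous:
  fixes f :: "real \<Rightarrow> real"
  assumes "continuous_on UNIV f"
  shows "(\<integral>x. f x \<partial>semicircle) = integral {-2..2} (\<lambda>x. sc_density x * f x)"
proof -
  have "continuous_on {-2..2} (\<lambda>x. sc_density x * f x)"
    by (intro continuous_intros continuous_on_subset[OF assms]) auto
  then show ?thesis
    using assms by (subst semicircle_integral_eq)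
      (auto intro!: set_borel_integral_eq_integral borel_integrable_atLeastAtMost' borel_measurable_continuous_onI)
qed

definition sc_moment :: "nat \<Rightarrow> real" where
  "sc_moment k = (\<integral>x. x ^ k \<partial>semicircle)"

lemma sc_moment_eq: "((\<lambda>x. sc_density x * x ^ k) has_integral sc_moment k) {-2..2}"
proof -
  have "(\<lambda>x. sc_density x * x ^ k) integrable_on {-2..2}"
    by (intro integrable_continuous_real continuous_intros)
  then show ?thesis
    unfolding sc_moment_def
    by (subst semicircle_integral_continuous) (auto intro!: continuous_intros simp: integrable_integral)
qed

lemma power2_less_4: "x \<in> {-2<..<2} \<Longrightarrow> x\<^sup>2 < (4::real)"
  using abs_square_less_1[of "x / 2"] by (auto simp: power_divide)

lemma DERIV_sqrt_4_minus:
  assumes "x \<in> {-2<..<2}"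
  shows "((\<lambda>x. sqrt (4 - x\<^sup>2)) has_real_derivative - x / sqrt (4 - x\<^sup>2)) (at x)"
proof -
  have "((\<lambda>x. sqrt (4 - x\<^sup>2)) has_real_derivative inverse (sqrt (4 - x\<^sup>2)) / 2 * (- 2 * x)) (at x)"
    by (rule DERIV_chain2[OF DERIV_real_sqrt])
      (use power2_less_4[OF assms] in \<open>auto intro!: derivative_eq_intros\<close>)
  then show ?thesis by (simp add: inverse_eq_divide)
qed

lemma DERIV_arcsin_half:
  assumes "x \<in> {-2<..<2}"
  shows "((\<lambda>x. arcsin (x / 2)) has_real_derivative 1 / sqrt (4 - x\<^sup>2)) (at x)"
proof -
  have s: "sqrt (1 - (x / 2)\<^sup>2) = sqrt (4 - x\<^sup>2) / 2"
    by (rule real_sqrt_unique) (use power2_less_4[OF assms] in \<open>auto simp: power_divide field_simps\<close>)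
  have "((\<lambda>x. arcsin (x / 2)) has_real_derivative inverse (sqrt (1 - (x / 2)\<^sup>2)) * (1 / 2)) (at x)"
    by (rule DERIV_chain2[OF DERIV_arcsin]) (use assms in \<open>auto intro!: derivative_eq_intros\<close>)
  then show ?thesis unfolding s by (simp add: inverse_eq_divide)
qed

lemma sc_moment_0: "sc_moment 0 = 1"
proof -
  define F where "F x = 1 / (2 * pi) * (x / 2 * sqrt (4 - x\<^sup>2) + 2 * arcsin (x / 2))" for x :: real
  have "((\<lambda>x. sc_density x * x ^ 0) has_integral F 2 - F (- 2)) {-2..2}"
  proof (rule fundamental_theorem_of_calculus_interior)
    show "continuous_on {-2..2} F"
      unfolding F_def by (intro continuous_intros) auto
    fix x :: real assume x: "x \<in> {-2<..<2}"
    define s where "s = sqrt (4 - x\<^sup>2)"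
    have s: "s > 0" "s * s = 4 - x * x"
      using power2_less_4[OF x] by (auto simp: s_def power2_eq_square)
    have "((\<lambda>x. x / 2 * sqrt (4 - x\<^sup>2) + 2 * arcsin (x / 2)) has_real_derivative
        1 / 2 * s + (- x / s) * (x / 2) + 2 * (1 / s)) (at x)"
      unfolding s_def
      by (intro DERIV_add DERIV_mult DERIV_cmult DERIV_cdivide DERIV_ident
          DERIV_sqrt_4_minus DERIV_arcsin_half x)
    then have "(F has_real_derivative 1 / (2 * pi) * (1 / 2 * s + (- x / s) * (x / 2) + 2 * (1 / s))) (at x)"
      unfolding F_def by (rule DERIV_cmult)
    also have "1 / 2 * s + (- x / s) * (x / 2) + 2 * (1 / s) = s"
      using s(1) s(2)[symmetric] by (simp add: field_simps)
    finally show "(F has_vector_derivative sc_density x * x ^ 0) (at x)"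
      by (simp add: has_real_derivative_iff_has_vector_derivative sc_density_def s_def)
  qed simp
  moreover have "F 2 - F (- 2) = 1" by (simp add: F_def arcsin_minus)
  ultimately show ?thesis using has_integral_unique[OF sc_moment_eq, of 0] by simp
qed

text \<open>Integration of the derivative of \<open>x ^ k * (4 - x\<^sup>2) powr (3 / 2)\<close>; the truncated
  \<open>k - 1\<close> is harmless because of the factor \<open>k\<close>.\<close>

lemma sc_moment_step: "real (k + 3) * sc_moment (k + 1) = 4 * real k * sc_moment (k - 1)"
proof -
  define F where "F x = 1 / (2 * pi) * (x ^ k * ((4 - x\<^sup>2) * sqrt (4 - x\<^sup>2)))" for x :: real
  let ?f = "\<lambda>x. 4 * real k * (sc_density x * x ^ (k - 1)) - real (k + 3) * (sc_density x * x ^ (k + 1))"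
  have I: "(?f has_integral F 2 - F (- 2)) {-2..2}"
  proof (rule fundamental_theorem_of_calculus_interior)
    show "continuous_on {-2..2} F"
      unfolding F_def by (intro continuous_intros)
    fix x :: real assume x: "x \<in> {-2<..<2}"
    define s where "s = sqrt (4 - x\<^sup>2)"
    have s: "s > 0" "s * s = 4 - x\<^sup>2"
      using power2_less_4[OF x] by (auto simp: s_def)
    have d: "((\<lambda>x. 4 - x\<^sup>2) has_real_derivative - (2 * x)) (at x)"
      by (auto intro!: derivative_eq_intros)
    have "((\<lambda>x. x ^ k * ((4 - x\<^sup>2) * sqrt (4 - x\<^sup>2))) has_real_derivative
        real k * x ^ (k - 1) * ((4 - x\<^sup>2) * s) +
        (- (2 * x) * s + (- x / s) * (4 - x\<^sup>2)) * x ^ k) (at x)"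
      unfolding s_def
      by (rule DERIV_mult'[OF DERIV_pow, THEN DERIV_cong], rule DERIV_mult'[OF d DERIV_sqrt_4_minus[OF x]])
        (simp add: mult_ac add_ac)
    then have "(F has_real_derivative 1 / (2 * pi) * (real k * x ^ (k - 1) * ((4 - x\<^sup>2) * s) +
        (- (2 * x) * s + (- x / s) * (4 - x\<^sup>2)) * x ^ k)) (at x)"
      unfolding F_def by (rule DERIV_cmult)
    also have "(- x / s) * (4 - x\<^sup>2) = - x * s"
      unfolding s(2)[symmetric] using s(1) by simp
    also have "1 / (2 * pi) * (real k * x ^ (k - 1) * ((4 - x\<^sup>2) * s) + (- (2 * x) * s + - x * s) * x ^ k) = ?f x"
    proof -
      have "real k * x ^ (k - 1) * ((4 - x\<^sup>2) * s) + (- (2 * x) * s + - x * s) * x ^ k =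
          4 * real k * (s * x ^ (k - 1)) - real (k + 3) * (s * x ^ (k + 1))"
        by (cases k) (simp_all add: algebra_simps power2_eq_square)
      then show ?thesis by (simp add: sc_density_def s_def right_diff_distrib mult_ac)
    qed
    finally show "(F has_vector_derivative ?f x) (at x)"
      by (simp add: has_real_derivative_iff_has_vector_derivative)
  qed simp
  have "(?f has_integral 4 * real k * sc_moment (k - 1) - real (k + 3) * sc_moment (k + 1)) {-2..2}"
    by (intro has_integral_diff has_integral_mult_right sc_moment_eq)
  then have "4 * real k * sc_moment (k - 1) - real (k + 3) * sc_moment (k + 1) = F 2 - F (- 2)"
    by (rule has_integral_unique) (rule I)
  also have "\<dots> = 0" by (simp add: F_def)
  finally show ?thesis by simp
qed

lemma sc_moment_1: "sc_moment (Suc 0) = 0"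
  using sc_moment_step[of 0] by simp

text \<open>With \<open>F\<close> the generating function of the moments, \<open>D = 1 - 2 X\<^sup>2 F\<close> satisfies
  \<open>(1 - 4 X\<^sup>2) D' = - 4 X D\<close> by the previous recursion, hence \<open>D\<^sup>2 = 1 - 4 X\<^sup>2\<close>, which is
  \<open>F = 1 + X\<^sup>2 F\<^sup>2\<close>.\<close>

lemma sc_moment_convolution:
  "sc_moment (k + 2) = (\<Sum>j\<le>k. sc_moment j * sc_moment (k - j))"
proof -
  define F where "F = Abs_fps sc_moment"
  define D where "D = 1 - 2 * fps_X ^ 2 * F"
  define H :: "real fps" where "H = 1 - 4 * fps_X ^ 2"
  have D_nth: "fps_nth D j = (if j = 0 then 1 else if j = 1 then 0 else - 2 * sc_moment (j - 2))" for j :: nat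
  proof -
    have "2 * fps_X ^ 2 * F = fps_const 2 * (fps_X ^ 2 * F)" by (simp add: numeral_fps_const mult.assoc)
    then show ?thesis unfolding D_def F_def by (simp only:) (auto simp: fps_X_power_mult_nth)
  qed
  have HD: "H * fps_deriv D = - 4 * fps_X * D"
  proof (rule fps_ext)
    fix j :: nat
    have e1: "H * fps_deriv D = fps_deriv D - fps_const 4 * (fps_X ^ 2 * fps_deriv D)"
      by (simp add: H_def numeral_fps_const algebra_simps)
    have e2: "- 4 * fps_X * D = fps_const (- 4) * (fps_X * D)"
      by (simp add: numeral_fps_const algebra_simps flip: fps_const_neg)
    have "j = 0 \<or> j = 1 \<or> j = 2 \<or> (\<exists>i. j = i + 3)" by presburger
    then consider "j = 0" | "j = 1" | "j = 2" | i where "j = i + 3"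
      by blast
    then have "fps_nth (fps_deriv D - fps_const 4 * (fps_X ^ 2 * fps_deriv D)) j
      = fps_nth (fps_const (- 4) * (fps_X * D)) j"
    proof cases
      case 4
      have e: "real (i + 1 + 3) * sc_moment (i + 1 + 1) = 4 * real (i + 1) * sc_moment (i + 1 - 1)"
        by (rule sc_moment_step)
      have "fps_nth (fps_deriv D - fps_const 4 * (fps_X ^ 2 * fps_deriv D)) j =
          - 2 * (real (i + 1 + 3) * sc_moment (i + 1 + 1) - 4 * real (i + 2) * sc_moment i)"
        using 4 by (simp add: fps_X_power_mult_nth D_nth)
      moreover have "fps_nth (fps_const (- 4) * (fps_X * D)) j = 8 * sc_moment i"
        using 4 by (simp only: fps_mult_left_const_nth fps_X_mult_nth D_nth) simp
      ultimately show ?thesis unfolding e by (simp add: algebra_simps)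
    qed (simp_all add: fps_X_power_mult_nth D_nth sc_moment_0 sc_moment_1)
    then show "fps_nth (H * fps_deriv D) j = fps_nth (- 4 * fps_X * D) j" by (simp only: e1 e2)
  qed
  have H0: "fps_nth H 0 \<noteq> 0" by (simp add: H_def)
  have H': "fps_deriv H = - 8 * fps_X"
    by (simp add: H_def fps_deriv_power numeral_fps_const)
  \<comment> \<open>The differential equation makes the quotient of \<open>D ^ 2\<close> by
    \<open>H\<close> constant, and its constant coefficient is 1.\<close>
  define K where "K = D ^ 2 * inverse H"
  have KH: "K * H = D ^ 2"
    using H0 by (simp add: K_def mult.assoc inverse_mult_eq_1)
  have "fps_deriv K * H + K * fps_deriv H = 2 * D * fps_deriv D"
    using arg_cong[OF KH, of fps_deriv] by (simp add: fps_deriv_power algebra_simps power2_eq_square)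
  then have "(fps_deriv K * H + K * fps_deriv H) * H = 2 * D * (H * fps_deriv D)"
    by (simp add: algebra_simps)
  then have "fps_deriv K * H * H = 2 * D * (- 4 * fps_X * D) - (K * H) * fps_deriv H"
    unfolding HD by (simp add: algebra_simps)
  also have "\<dots> = 0" unfolding KH H' by (simp add: algebra_simps power2_eq_square)
  finally have "fps_deriv K = 0" using H0 by auto
  moreover have "fps_nth K 0 = 1"
    by (simp add: K_def H_def D_nth power2_eq_square)
  ultimately have "K = 1" by (metis fps_const_1_eq_1 fps_deriv_eq_0_iff)
  then have "D ^ 2 = H" using KH by simp
  then have "4 * fps_X ^ 2 * (fps_X ^ 2 * F ^ 2 + 1 - F) = 0"
    by (simp add: D_def H_def power2_eq_square algebra_simps)
  then have "fps_X ^ 2 * F ^ 2 + 1 - F = 0"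
    by (simp only: mult_eq_0_iff power_eq_0_iff) simp
  then have "F = 1 + fps_X ^ 2 * F ^ 2" by (simp add: add.commute)
  then have "fps_nth F (k + 2) = fps_nth (1 + fps_X ^ 2 * F ^ 2) (k + 2)" by simp
  also have "\<dots> = fps_nth (F * F) k" by (simp add: fps_X_power_mult_nth power2_eq_square[of F])
  also have "\<dots> = (\<Sum>j\<le>k. sc_moment j * sc_moment (k - j))"
    by (simp add: fps_mult_nth F_def atLeast0AtMost)
  finally show ?thesis by (simp add: F_def)
qed

lemma sc_moment_even_le: "sc_moment (2 * k) \<le> 4 ^ k"
proof -
  have "sc_moment (2 * k) \<le> 4 ^ k * sc_moment 0"
  proof (rule has_integral_le[OF sc_moment_eq has_integral_mult_right[OF sc_moment_eq]])
    fix x :: real assume x: "x \<in> {-2..2}"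
    have "x\<^sup>2 \<le> 2\<^sup>2" using x by (intro abs_le_square_iff[THEN iffD1]) auto
    then have "x ^ (2 * k) \<le> 4 ^ k" by (simp add: power_mult power_mono)
    then show "sc_density x * x ^ (2 * k) \<le> 4 ^ k * (sc_density x * x ^ 0)"
      using mult_right_mono[OF _ sc_density_nonneg[OF x], of "x ^ (2 * k)" "4 ^ k"] by (simp add: mult.commute)
  qed
  then show ?thesis by (simp add: sc_moment_0)
qed

subsection \<open>From moments to weak convergence\<close>

text \<open>Outside \<open>[-3, 3]\<close> the error of a polynomial approximation is dominated by a small multiple
  of a high even power, whose semicircle moment grows only like a power of \<open>4 < 9\<close>.\<close>

lemma polynomial_approximation_with_tail:
  fixes f :: "real \<Rightarrow> real"
  assumes cont: "continuous_on UNIV f" and bdd: "bounded (range f)" and e: "0 < e"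
  obtains a d m c where "\<And>x. \<bar>f x - (\<Sum>i\<le>d. a i * x ^ i)\<bar> \<le> e + c * x ^ (2 * m)"
    "0 \<le> c" "c * 4 ^ m \<le> e"
proof -
  obtain B where B: "0 < B" "\<And>x. \<bar>f x\<bar> \<le> B"
    using bdd unfolding bounded_pos by auto
  obtain p where p: "real_polynomial_function p" "\<And>x. x \<in> {-3..3} \<Longrightarrow> \<bar>f x - p x\<bar> < e"
    using Stone_Weierstrass_real_polynomial_function[of "{-3..3::real}" f e]
      continuous_on_subset[OF cont] e by auto
  then obtain a d where ad: "p = (\<lambda>x. \<Sum>i\<le>d. a i * x ^ i)"
    unfolding real_polynomial_function_iff_sum by blast
  define A where "A = (\<Sum>i\<le>d. \<bar>a i\<bar>)"
  have A: "0 \<le> A" by (auto simp: A_def intro: sum_nonneg)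
  \<comment> \<open>The exponent will be \<open>m = d + l\<close>: passing from \<open>9 ^ l\<close>
    to \<open>4 ^ (d + l)\<close> costs the fixed factor \<open>4 ^ d\<close>, which the geometric
    decay in \<open>l\<close> absorbs.\<close>
  have "(\<lambda>l. ((A + B) * 4 ^ d) * (4 / 9) ^ l) \<longlonglongrightarrow> ((A + B) * 4 ^ d) * 0"
    by (intro tendsto_mult tendsto_const LIMSEQ_realpow_zero) auto
  then have "eventually (\<lambda>l. ((A + B) * 4 ^ d) * (4 / 9) ^ l < e) sequentially"
    using e by (auto dest: order_tendstoD(2))
  then obtain l where l: "((A + B) * 4 ^ d) * (4 / 9) ^ l < e"
    by (auto simp: eventually_sequentially)
  have bound: "\<bar>f x - p x\<bar> \<le> e + (A + B) / 9 ^ l * x ^ (2 * (d + l))" for x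
  proof (cases "x \<in> {-3..3}")
    case True
    have "0 \<le> (A + B) / 9 ^ l * (x ^ (d + l))\<^sup>2" using A B(1) by simp
    then show ?thesis using p(2)[OF True] by (simp add: power_mult[symmetric] mult.commute)
  next
    case False
    then have x: "3 \<le> \<bar>x\<bar>" by auto
    have "\<bar>p x\<bar> \<le> (\<Sum>i\<le>d. \<bar>a i\<bar> * \<bar>x\<bar> ^ i)"
      unfolding ad by (rule order_trans[OF sum_abs]) (simp add: abs_mult power_abs)
    also have "\<dots> \<le> (\<Sum>i\<le>d. \<bar>a i\<bar> * \<bar>x\<bar> ^ d)"
      using x by (intro sum_mono mult_left_mono power_increasing) auto
    also have "\<dots> = A * \<bar>x\<bar> ^ d" by (simp add: A_def sum_distrib_right)
    finally have "\<bar>f x - p x\<bar> \<le> B * 1 + A * \<bar>x\<bar> ^ d" using B(2)[of x] by linarith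
    also have "\<dots> \<le> B * \<bar>x\<bar> ^ d + A * \<bar>x\<bar> ^ d"
      using x B(1) by (intro add_right_mono mult_left_mono one_le_power) auto
    also have "\<dots> = (A + B) * \<bar>x\<bar> ^ d" by (simp add: algebra_simps)
    also have "\<dots> \<le> (A + B) * \<bar>x\<bar> ^ (2 * d)"
      using x A B(1) by (intro mult_left_mono power_increasing) auto
    also have "\<dots> \<le> (A + B) * \<bar>x\<bar> ^ (2 * d) * (\<bar>x\<bar> ^ (2 * l) / 9 ^ l)"
    proof -
      have "(3::real) ^ (2 * l) \<le> \<bar>x\<bar> ^ (2 * l)" using x by (intro power_mono) auto
      then have "1 \<le> \<bar>x\<bar> ^ (2 * l) / 9 ^ l" by (simp add: power_mult)
      moreover have "0 \<le> (A + B) * \<bar>x\<bar> ^ (2 * d)" using A B(1) by simp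
      ultimately show ?thesis by (metis mult.right_neutral mult_left_mono)
    qed
    also have "\<dots> = (A + B) / 9 ^ l * x ^ (2 * (d + l))"
      by (simp add: power_add power_mult distrib_left)
    finally show ?thesis using e by simp
  qed
  show thesis
  proof (rule that)
    show "\<bar>f x - (\<Sum>i\<le>d. a i * x ^ i)\<bar> \<le> e + (A + B) / 9 ^ l * x ^ (2 * (d + l))" for x
      using bound[of x] by (simp add: ad)
    show "0 \<le> (A + B) / 9 ^ l" using A B(1) by simp
    show "(A + B) / 9 ^ l * 4 ^ (d + l) \<le> e"
      using l by (simp add: power_add power_divide mult.assoc)
  qed
qed

text \<open>Here \<open>K\<close> and \<delta> depend on \<open>f\<close> and \<open>e\<close> but
  not on \<open>n\<close> or the points, so probability bounds for finitely many moments pass to the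
  integral with their rate.\<close>

lemma moments_close_imp_integral_close:
  fixes f :: "real \<Rightarrow> real"
  assumes cont: "continuous_on UNIV f" and bdd: "bounded (range f)" and e: "0 < e"
  obtains K \<delta> where "0 < \<delta>"
    "\<And>n (x :: nat \<Rightarrow> real). 0 < n \<Longrightarrow>
      (\<And>k. k \<le> K \<Longrightarrow> \<bar>(\<Sum>i<n. x i ^ k) / real n - sc_moment k\<bar> \<le> \<delta>) \<Longrightarrow>
      \<bar>(\<Sum>i<n. f (x i)) / real n - (\<integral>x. f x \<partial>semicircle)\<bar> \<le> e"
proof -
  have e8: "0 < e / 8" using e by simp
  obtain a d c m where ap: "\<And>x. \<bar>f x - (\<Sum>i\<le>d. a i * x ^ i)\<bar> \<le> e / 8 + c * x ^ (2 * m)"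
    and c: "0 \<le> c" "c * 4 ^ m \<le> e / 8"
  proof -
    show ?thesis
      by (rule polynomial_approximation_with_tail[OF cont bdd e8]) (rule that)
  qed
  let ?p = "\<lambda>x. \<Sum>i\<le>d. a i * x ^ i"
  let ?s = "\<Sum>i\<le>d. a i * sc_moment i"
  define A where "A = (\<Sum>i\<le>d. \<bar>a i\<bar>)"
  have A: "0 \<le> A" by (auto simp: A_def intro: sum_nonneg)
  \<comment> \<open>The bound 1 caps the empirical moment of order \<open>2 * m\<close> by
    \<open>4 ^ m + 1\<close>; the other bound keeps the error of the polynomial part below
    \<open>e / 8\<close>.\<close>
  define \<delta> where "\<delta> = min 1 (e / (8 * (A + 1)))"
  have \<delta>: "0 < \<delta>" "\<delta> \<le> 1" "A * \<delta> \<le> e / 8"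
  proof -
    show "0 < \<delta>" "\<delta> \<le> 1" using A e by (auto simp: \<delta>_def)
    have "A * \<delta> \<le> (A + 1) * (e / (8 * (A + 1)))"
      using A e by (intro mult_mono) (auto simp: \<delta>_def)
    also have "\<dots> = e / 8" using A by (simp add: field_simps)
    finally show "A * \<delta> \<le> e / 8" .
  qed
  have int [simp]: "integrable semicircle g" if "continuous_on UNIV g" for g :: "real \<Rightarrow> real"
    by (rule semicircle_integrable_continuous[OF that])
  have mass: "(\<integral>x. 1 \<partial>semicircle) = (1::real)" using sc_moment_0 by (simp add: sc_moment_def)
  then have mass': "measure semicircle (space semicircle) = 1" by simp
  have intp: "(\<integral>x. ?p x \<partial>semicircle) = ?s"
    by (subst Bochner_Integration.integral_sum) (auto simp: sc_moment_def intro!: int continuous_intros)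
  have Jerr: "\<bar>(\<integral>x. f x \<partial>semicircle) - ?s\<bar> \<le> e / 4"
  proof -
    have "\<bar>(\<integral>x. f x \<partial>semicircle) - ?s\<bar> =
        \<bar>\<integral>x. f x - ?p x \<partial>semicircle\<bar>"
      unfolding intp[symmetric]
      by (subst Bochner_Integration.integral_diff) (auto intro!: int continuous_intros cont)
    also have "\<dots> \<le> (\<integral>x. \<bar>f x - ?p x\<bar> \<partial>semicircle)"
      by (rule integral_abs_bound)
    also have "\<dots> \<le> (\<integral>x. e / 8 * 1 + c * x ^ (2 * m) \<partial>semicircle)"
      using ap by (intro integral_mono int continuous_intros cont) simp
    also have "\<dots> = e / 8 + c * sc_moment (2 * m)"
      by (subst Bochner_Integration.integral_add)
        (auto intro!: int continuous_intros simp: mass' sc_moment_def)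
    also have "\<dots> \<le> e / 8 + c * 4 ^ m"
      using sc_moment_even_le c(1) by (intro add_left_mono mult_left_mono) auto
    finally show ?thesis using c(2) by simp
  qed
  show thesis
  proof (rule that[OF \<delta>(1)])
    fix n and x :: "nat \<Rightarrow> real"
    assume n: "0 < n"
      and close: "\<And>k. k \<le> max d (2 * m) \<Longrightarrow> \<bar>(\<Sum>i<n. x i ^ k) / real n - sc_moment k\<bar> \<le> \<delta>"
    let ?mean = "\<lambda>g. (\<Sum>i<n. g (x i)) / real n"
    have meanp: "?mean ?p = (\<Sum>i\<le>d. a i * ?mean (\<lambda>x. x ^ i))"
      by (subst sum.swap) (simp add: sum_distrib_left sum_divide_distrib)
    have "\<bar>?mean f - ?mean ?p\<bar> =
        \<bar>\<Sum>j<n. f (x j) - (\<Sum>i\<le>d. a i * x j ^ i)\<bar> / real n"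
      by (simp add: sum_subtractf diff_divide_distrib[symmetric])
    also have "\<dots> \<le> (\<Sum>j<n. e / 8 + c * x j ^ (2 * m)) / real n"
      by (intro divide_right_mono order_trans[OF sum_abs] sum_mono ap) auto
    also have "\<dots> = e / 8 + c * ?mean (\<lambda>x. x ^ (2 * m))"
      using n by (simp add: sum.distrib add_divide_distrib sum_distrib_left)
    also have "\<dots> \<le> e / 8 + c * (4 ^ m + 1)"
      using close[of "2 * m"] sc_moment_even_le[of m] \<delta>(2) c(1)
      by (intro add_left_mono mult_left_mono) auto
    also have "\<dots> \<le> 3 * e / 8"
    proof -
      have "c * 1 \<le> c * 4 ^ m" using c(1) by (intro mult_left_mono) auto
      then show ?thesis using c(2) by (simp add: distrib_left)
    qed
    finally have 1: "\<bar>?mean f - ?mean ?p\<bar> \<le> 3 * e / 8" .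
    have "\<bar>?mean ?p - ?s\<bar>
        = \<bar>\<Sum>i\<le>d. a i * (?mean (\<lambda>x. x ^ i) - sc_moment i)\<bar>"
      unfolding meanp by (simp add: sum_subtractf right_diff_distrib)
    also have "\<dots> \<le> (\<Sum>i\<le>d. \<bar>a i\<bar> * \<delta>)"
      by (rule order_trans[OF sum_abs]) (auto intro!: sum_mono mult_left_mono close simp: abs_mult)
    also have "\<dots> \<le> e / 8" using \<delta>(3) by (simp add: A_def sum_distrib_right)
    finally have 2: "\<bar>?mean ?p - ?s\<bar> \<le> e / 8" .
    show "\<bar>?mean f - (\<integral>x. f x \<partial>semicircle)\<bar> \<le> e"
      using 1 2 Jerr e by linarith
  qed
qed

subsection \<open>Traces and eigenvalues of symmetric matrices\<close>

lemma map_poly_of_real_inj: "inj (map_poly complex_of_real)"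
  by (rule injI) (auto simp: poly_eq_iff coeff_map_poly)

text \<open>Complex eigenvalues are real because the Hermitian form \<open>S\<close> of an
  eigenvector equals its own conjugate and is the eigenvalue times a positive number; the
  factorization descends along the injective \<open>map_poly complex_of_real\<close>.\<close>

lemma char_poly_real_symmetric_splits:
  fixes A :: "real mat"
  assumes A: "A \<in> carrier_mat n n" and sym: "\<And>i j. i < n \<Longrightarrow> j < n \<Longrightarrow> A $$ (i, j) = A $$ (j, i)"
  obtains rs where "char_poly A = (\<Prod>r\<leftarrow>rs. [:- r, 1:])" "length rs = n"
proof -
  define C where "C = map_mat complex_of_real A"
  have C: "C \<in> carrier_mat n n" using A by (simp add: C_def)
  obtain as where as: "char_poly C = (\<Prod>a\<leftarrow>as. [:- a, 1:])" "length as = n"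
    using char_poly_factorized[OF C] by blast
  have real: "a \<in> \<real>" if a: "a \<in> set as" for a
  proof -
    have "poly (char_poly C) a = 0"
      unfolding as(1) using a by (induction as) auto
    then obtain v where v: "v \<in> carrier_vec n" "v \<noteq> 0\<^sub>v n" "C *\<^sub>v v = a \<cdot>\<^sub>v v"
      using eigenvalue_root_char_poly[OF C] C by (auto simp: eigenvalue_def eigenvector_def)
    have ev: "(\<Sum>j<n. of_real (A $$ (i, j)) * v $ j) = a * v $ i" if i: "i < n" for i
    proof -
      have "(C *\<^sub>v v) $ i = a * v $ i" using v i by simp
      moreover have "(C *\<^sub>v v) $ i = (\<Sum>j<n. of_real (A $$ (i, j)) * v $ j)"
        using i C A v(1) by (auto simp: C_def scalar_prod_def atLeast0LessThan intro!: sum.cong)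
      ultimately show ?thesis by simp
    qed
    define S where "S = (\<Sum>i<n. \<Sum>j<n. cnj (v $ i) * of_real (A $$ (i, j)) * v $ j)"
    have S: "S = a * of_real (\<Sum>i<n. (cmod (v $ i))\<^sup>2)"
    proof -
      have "S = (\<Sum>i<n. cnj (v $ i) * (\<Sum>j<n. of_real (A $$ (i, j)) * v $ j))"
        by (simp add: S_def sum_distrib_left mult.assoc)
      also have "\<dots> = (\<Sum>i<n. a * of_real ((cmod (v $ i))\<^sup>2))"
        by (intro sum.cong refl) (simp only: lessThan_iff ev, simp add: complex_norm_square mult_ac del: of_real_power)
      finally show ?thesis by (simp add: sum_distrib_left)
    qed
    have "cnj S = (\<Sum>i<n. \<Sum>j<n. v $ i * of_real (A $$ (i, j)) * cnj (v $ j))"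
      by (simp add: S_def)
    also have "\<dots> = (\<Sum>j<n. \<Sum>i<n. v $ i * of_real (A $$ (i, j)) * cnj (v $ j))"
      by (rule sum.swap)
    also have "\<dots> = S" unfolding S_def
      by (intro sum.cong refl) (use sym in \<open>auto simp: mult_ac\<close>)
    finally have "cnj S = S" .
    moreover have pos: "(\<Sum>i<n. (cmod (v $ i))\<^sup>2) \<noteq> 0"
    proof
      assume "(\<Sum>i<n. (cmod (v $ i))\<^sup>2) = 0"
      then have "\<forall>i<n. v $ i = 0" by (subst (asm) sum_nonneg_eq_0_iff) auto
      then show False using v by (auto intro!: eq_vecI)
    qed
    ultimately have "cnj a = a"
      unfolding S by (metis complex_cnj_complex_of_real complex_cnj_mult mult_right_cancel of_real_eq_0_iff)
    then show ?thesis by (simp add: Reals_cnj_iff)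
  qed
  interpret H: map_poly_comm_ring_hom complex_of_real ..
  have "map_poly complex_of_real (char_poly A) = char_poly C"
    unfolding C_def by (rule of_real_hom.char_poly_hom[OF A, symmetric])
  also have "\<dots> = map_poly complex_of_real (\<Prod>r\<leftarrow>map Re as. [:- r, 1:])"
    unfolding as(1) using real
  proof (induction as)
    case (Cons a as)
    then have "of_real (Re a) = a" by simp
    then have "[:- a, 1:] = map_poly complex_of_real [:- Re a, 1:]" by simp
    then show ?case using Cons
      by (simp add: H.hom_mult del: mult_pCons_left)
  qed auto
  finally have "char_poly A = (\<Prod>r\<leftarrow>map Re as. [:- r, 1:])"
    by (rule injD[OF map_poly_of_real_inj])
  then show thesis by (rule that) (simp add: as(2))
qed

lemma proots_prod_list: "proots (\<Prod>r\<leftarrow>rs. [:- r, 1 :: real:]) = mset rs"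
proof (induction rs)
  case (Cons r rs)
  have "(\<Prod>r\<leftarrow>rs. [:- r, 1 :: real:]) \<noteq> 0" by (auto simp: prod_list_zero_iff)
  then show ?case using Cons
    by (simp add: proots_mult proots_linear_factor del: mult_pCons_left)
qed auto

definition mat_trace :: "real mat \<Rightarrow> real" where
  "mat_trace A = (\<Sum>i<dim_row A. A $$ (i, i))"

lemma mat_trace_mult_commute:
  assumes "A \<in> carrier_mat n n" "B \<in> carrier_mat n n"
  shows "mat_trace (A * B) = mat_trace (B * A)"
proof -
  have "mat_trace (A * B) = (\<Sum>i<n. \<Sum>j<n. A $$ (i, j) * B $$ (j, i))"
    using assms by (auto simp: mat_trace_def scalar_prod_def atLeast0LessThan intro!: sum.cong)
  also have "\<dots> = (\<Sum>j<n. \<Sum>i<n. B $$ (j, i) * A $$ (i, j))"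
    by (subst sum.swap) (simp add: mult.commute)
  also have "\<dots> = mat_trace (B * A)"
    using assms by (auto simp: mat_trace_def scalar_prod_def atLeast0LessThan intro!: sum.cong)
  finally show ?thesis .
qed

lemma upper_triangular_pow:
  fixes B :: "real mat"
  assumes B: "B \<in> carrier_mat n n" "upper_triangular B"
  shows "upper_triangular (B ^\<^sub>m k) \<and> (\<forall>i<n. (B ^\<^sub>m k) $$ (i, i) = (B $$ (i, i)) ^ k)"
proof (induction k)
  case 0
  then show ?case using B by auto
next
  case (Suc k)
  have Bk: "B ^\<^sub>m k \<in> carrier_mat n n" using B by simp
  have ent: "(B ^\<^sub>m Suc k) $$ (i, j) = (\<Sum>l<n. (B ^\<^sub>m k) $$ (i, l) * B $$ (l, j))" if "i < n" "j < n" for i j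
    using that B Bk by (auto simp: scalar_prod_def atLeast0LessThan intro!: sum.cong)
  have z: "(B ^\<^sub>m k) $$ (i, l) * B $$ (l, j) = 0" if "i < n" "j < n" "l < n" "l < i \<or> j < l" for i j l
    using that Suc B Bk upper_triangularD[of "B ^\<^sub>m k" l i] upper_triangularD[of B j l] by auto
  have "(B ^\<^sub>m Suc k) $$ (i, j) = 0" if "j < i" "i < n" for i j
    unfolding ent[OF that(2) less_trans[OF that]]
  proof (rule sum.neutral, rule ballI)
    fix l assume "l \<in> {..<n}"
    then show "(B ^\<^sub>m k) $$ (i, l) * B $$ (l, j) = 0"
      using z[of i j l] that by (cases "l < i") auto
  qed
  moreover have "(B ^\<^sub>m Suc k) $$ (i, i) = (B $$ (i, i)) ^ Suc k" if i: "i < n" for i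
  proof -
    have "(B ^\<^sub>m Suc k) $$ (i, i) = (\<Sum>l\<in>{i}. (B ^\<^sub>m k) $$ (i, l) * B $$ (l, i))"
      unfolding ent[OF i i] by (rule sum.mono_neutral_right) (use z i in force)+
    then show ?thesis using Suc i by simp
  qed
  moreover have "dim_row (B ^\<^sub>m Suc k) = n" using B by simp
  ultimately show ?case by (auto simp del: pow_mat.simps)
qed

text \<open>As the characteristic polynomial splits, the Schur decomposition is available over the
  reals, and cyclicity of the trace reduces the power of \<open>A\<close> to the diagonal of a
  triangular matrix.\<close>

theorem real_symmetric_eigenvalues:
  fixes A :: "real mat"
  assumes A: "A \<in> carrier_mat n n" and sym: "\<And>i j. i < n \<Longrightarrow> j < n \<Longrightarrow> A $$ (i, j) = A $$ (j, i)"
  shows "length (real_eigenvalues A) = n"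
    and "(\<Sum>i<n. real_eigenvalues A ! i ^ k) = mat_trace (A ^\<^sub>m k)"
proof -
  obtain rs where rs: "char_poly A = (\<Prod>r\<leftarrow>rs. [:- r, 1:])" "length rs = n"
    using char_poly_real_symmetric_splits[OF A sym] by blast
  have ev: "real_eigenvalues A = sort rs"
    unfolding real_eigenvalues_def rs(1) proots_prod_list by simp
  then show len: "length (real_eigenvalues A) = n" using rs(2) by simp
  obtain B P Q where BPQ: "schur_decomposition A rs = (B, P, Q)" by (cases "schur_decomposition A rs") auto
  have sch: "similar_mat_wit A B P Q" "upper_triangular B" "diag_mat B = rs"
    using schur_decomposition[OF A rs(1) BPQ] by auto
  have car: "B \<in> carrier_mat n n" "P \<in> carrier_mat n n" "Q \<in> carrier_mat n n" "Q * P = 1\<^sub>m n"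
    using similar_mat_witD2[OF A sch(1)] by auto
  have "mat_trace (A ^\<^sub>m k) = mat_trace (P * (B ^\<^sub>m k * Q))"
    using similar_mat_wit_pow_id[OF sch(1), of k] car by (simp add: assoc_mult_mat[of _ n n _ n _ n])
  also have "\<dots> = mat_trace ((B ^\<^sub>m k * Q) * P)"
    using car by (intro mat_trace_mult_commute[of _ n]) auto
  also have "(B ^\<^sub>m k * Q) * P = B ^\<^sub>m k"
    using car by (subst assoc_mult_mat[of _ n n _ n _ n]) auto
  also have "mat_trace (B ^\<^sub>m k) = (\<Sum>i<n. (B $$ (i, i)) ^ k)"
    using upper_triangular_pow[OF car(1) sch(2)] car(1) by (simp add: mat_trace_def)
  also have "\<dots> = (\<Sum>r\<leftarrow>rs. r ^ k)"
    unfolding sch(3)[symmetric] using car(1)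
    by (simp add: diag_mat_def interv_sum_list_conv_sum_set_nat atLeast0LessThan comp_def)
  also have "\<dots> = (\<Sum>r\<leftarrow>sort rs. r ^ k)"
    by (metis mset_map mset_sort sum_mset_sum_list)
  also have "\<dots> = (\<Sum>i<n. real_eigenvalues A ! i ^ k)"
    using len unfolding ev by (simp add: sum_list_sum_nth atLeast0LessThan)
  finally show "(\<Sum>i<n. real_eigenvalues A ! i ^ k) = mat_trace (A ^\<^sub>m k)" ..
qed

lemma integral_esd:
  fixes f :: "real \<Rightarrow> real"
  assumes n: "0 < dim_row A" and f: "f \<in> borel_measurable borel"
  shows "(\<integral>x. f x \<partial>esd A) = (\<Sum>i<dim_row A. f (real_eigenvalues A ! i)) / real (dim_row A)"
  unfolding esd_def
  by (subst integral_distr)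
    (use f n in \<open>auto simp: measurable_def uniform_count_measure_def lebesgue_integral_point_measure_finite sum_divide_distrib\<close>)

subsection \<open>The mixing density\<close>

text \<open>Behaves like \<open>x ^ 4 / 12\<close> at 0: at \<beta> = 1 the quadratic parts of the
  Gaussian factor and of \<open>ln (cosh x)\<close> cancel, so the critical field spreads more
  widely.\<close>

definition lncosh_gap :: "real \<Rightarrow> real" where
  "lncosh_gap x = x\<^sup>2 / 2 - ln (cosh x)"

lemma DERIV_lncosh_gap: "(lncosh_gap has_real_derivative x - tanh x) (at x)"
proof -
  have "((\<lambda>x. x\<^sup>2 / 2 - ln (cosh x)) has_real_derivative x - tanh x) (at x)"
    by (auto intro!: derivative_eq_intros simp: cosh_real_pos tanh_def)
  then show ?thesis by (simp add: lncosh_gap_def[abs_def])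
qed

lemma lncosh_gap_0 [simp]: "lncosh_gap 0 = 0"
  by (simp add: lncosh_gap_def)

lemma lncosh_gap_minus [simp]: "lncosh_gap (- x) = lncosh_gap x"
  by (simp add: lncosh_gap_def)

lemma lncosh_gap_abs: "lncosh_gap \<bar>x\<bar> = lncosh_gap x"
  by (cases "0 \<le> x") auto

lemma nonneg_if_DERIV_nonneg:
  fixes f :: "real \<Rightarrow> real"
  assumes "a \<le> x" "0 \<le> f a" and d: "\<And>y. a \<le> y \<Longrightarrow> (f has_real_derivative f' y) (at y)"
    and "\<And>y. a \<le> y \<Longrightarrow> 0 \<le> f' y"
  shows "0 \<le> f x"
proof -
  have "f a \<le> f x" using assms(1) d assms(4)
    by (intro DERIV_nonneg_imp_nondecreasing[of a x f]) auto
  then show ?thesis using assms(2) by simp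
qed

lemma tanh_le_self:
  fixes x :: real assumes "0 \<le> x" shows "tanh x \<le> x"
proof -
  have "0 \<le> x - tanh x"
    by (rule nonneg_if_DERIV_nonneg[of 0 x "\<lambda>x. x - tanh x" "\<lambda>x. tanh x ^ 2"])
      (use assms in \<open>auto intro!: derivative_eq_intros\<close>)
  then show ?thesis by simp
qed

lemma abs_tanh_le: "\<bar>tanh x\<bar> \<le> \<bar>x :: real\<bar>"
  using tanh_le_self[of x] tanh_le_self[of "- x"] by (cases "0 \<le> x") auto

text \<open>In terms of \<open>z = exp (- 2 * a)\<close> the claim is linear in \<open>z\<close> and
  follows from \<open>1 + 2 * a \<le> exp (2 * a)\<close>.\<close>

lemma half_le_tanh:
  fixes a :: real assumes "0 \<le> a" "a \<le> 1" shows "a / 2 \<le> tanh a"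
proof -
  define z where "z = exp (- 2 * a)"
  have z: "0 < z" "z * (1 + 2 * a) \<le> 1"
  proof -
    have "z * (1 + 2 * a) \<le> z * exp (2 * a)"
      by (intro mult_left_mono) (auto simp: z_def)
    also have "\<dots> = 1" by (simp add: z_def flip: exp_add)
    finally show "z * (1 + 2 * a) \<le> 1" .
  qed (simp add: z_def)
  have "(1 + 2 * a) * ((a / 2 + 1) * z + a / 2) = (a / 2 + 1) * (z * (1 + 2 * a)) + a / 2 * (1 + 2 * a)"
    by (simp add: field_simps)
  also have "\<dots> \<le> (a / 2 + 1) * 1 + a / 2 * (1 + 2 * a)"
    using z(2) assms by (intro add_right_mono mult_left_mono) auto
  also have "\<dots> = 1 + a + a * a" by (simp add: algebra_simps)
  also have "\<dots> \<le> 1 + a + a" using mult_left_le[of a a] assms by simp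
  finally have "(1 + 2 * a) * ((a / 2 + 1) * z + a / 2) \<le> (1 + 2 * a) * 1" by simp
  then have "(a / 2 + 1) * z + a / 2 \<le> 1"
    by (rule mult_left_le_imp_le) (use assms in simp)
  then have "a / 2 * (1 + z) \<le> 1 - z" by (simp add: field_simps)
  then have "a / 2 \<le> (1 - z) / (1 + z)" using z(1) by (simp add: pos_le_divide_eq)
  then show ?thesis by (simp add: tanh_real_altdef z_def)
qed

lemma lncosh_gap_nonneg: "0 \<le> lncosh_gap x"
proof -
  have "0 \<le> lncosh_gap \<bar>x\<bar>"
    by (rule nonneg_if_DERIV_nonneg[of 0 _ lncosh_gap "\<lambda>x. x - tanh x"])
      (auto intro: DERIV_lncosh_gap tanh_le_self)
  then show ?thesis by (simp add: lncosh_gap_abs)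
qed

lemma lncosh_gap_le: "lncosh_gap x \<le> x ^ 4 / 4"
proof -
  have *: "0 \<le> y ^ 3 - (y - tanh y)" if "0 \<le> y" for y :: real
  proof (rule nonneg_if_DERIV_nonneg[of 0 y "\<lambda>y. y ^ 3 - (y - tanh y)" "\<lambda>x. 3 * x ^ 2 - tanh x ^ 2"])
    fix z :: real assume "0 \<le> z"
    then have "tanh z ^ 2 \<le> z ^ 2" by (intro power_mono tanh_le_self) auto
    then show "0 \<le> 3 * z ^ 2 - tanh z ^ 2" by (smt (verit) zero_le_power2)
  qed (use that in \<open>auto intro!: derivative_eq_intros\<close>)
  have "0 \<le> \<bar>x\<bar> ^ 4 / 4 - lncosh_gap \<bar>x\<bar>"
  proof (rule nonneg_if_DERIV_nonneg[of 0 _ "\<lambda>x. x ^ 4 / 4 - lncosh_gap x" "\<lambda>x. x ^ 3 - (x - tanh x)"])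
    show "((\<lambda>x. x ^ 4 / 4 - lncosh_gap x) has_real_derivative y ^ 3 - (y - tanh y)) (at y)" for y
      by (rule DERIV_diff[OF _ DERIV_lncosh_gap]) (auto intro!: derivative_eq_intros)
  qed (use * in auto)
  then show ?thesis by (simp add: lncosh_gap_abs)
qed

text \<open>The second derivative is \<open>tanh x ^ 2\<close>, at least \<open>(a / 2) ^ 2\<close>
  beyond \<open>a\<close>. With \<open>a\<close> of the size \<open>n powr (-1/2)\<close> the
  quartic well thus gets a Gaussian tail, so the critical case fits the same estimate as \<beta> <
  1.\<close>

lemma lncosh_gap_ge:
  assumes a: "0 < a" "a \<le> 1" and x: "a \<le> x"
  shows "a\<^sup>2 / 8 * (x - a)\<^sup>2 \<le> lncosh_gap x"
proof -
  have *: "0 \<le> y - tanh y - a\<^sup>2 / 4 * (y - a)" if "a \<le> y" for y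
  proof (rule nonneg_if_DERIV_nonneg[of a y "\<lambda>y. y - tanh y - a\<^sup>2 / 4 * (y - a)" "\<lambda>x. tanh x ^ 2 - a\<^sup>2 / 4"])
    fix z assume z: "a \<le> z"
    have "a / 2 \<le> tanh z" using half_le_tanh[of a] a z by (smt (verit) tanh_real_le_iff)
    then have "(a / 2)\<^sup>2 \<le> tanh z ^ 2" using a by (intro power_mono) auto
    then show "0 \<le> tanh z ^ 2 - a\<^sup>2 / 4" by (simp add: power_divide)
  qed (use that tanh_le_self[of a] a in \<open>auto intro!: derivative_eq_intros\<close>)
  have "0 \<le> lncosh_gap x - a\<^sup>2 / 8 * (x - a)\<^sup>2"
  proof (rule nonneg_if_DERIV_nonneg[of a x "\<lambda>x. lncosh_gap x - a\<^sup>2 / 8 * (x - a)\<^sup>2" "\<lambda>y. y - tanh y - a\<^sup>2 / 4 * (y - a)"])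
    show "((\<lambda>x. lncosh_gap x - a\<^sup>2 / 8 * (x - a)\<^sup>2) has_real_derivative
        y - tanh y - a\<^sup>2 / 4 * (y - a)) (at y)" for y
      by (rule DERIV_diff[OF DERIV_lncosh_gap]) (auto intro!: derivative_eq_intros)
  qed (use x * lncosh_gap_nonneg in auto)
  then show ?thesis by simp
qed

definition mix_density :: "real \<Rightarrow> nat \<Rightarrow> real \<Rightarrow> real" where
  "mix_density \<beta> m t = exp (- (real m * t\<^sup>2) / (2 * \<beta>)) * cosh t ^ m"

lemma mix_density_pos: "0 < mix_density \<beta> m t"
  by (simp add: mix_density_def cosh_real_pos)

lemma mix_density_measurable [measurable]: "mix_density \<beta> m \<in> borel_measurable borel"
proof -
  have [measurable]: "(cosh :: real \<Rightarrow> real) \<in> borel_measurable borel"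
    by (intro borel_measurable_continuous_onI continuous_intros)
  show ?thesis unfolding mix_density_def by measurable
qed

lemma mix_density_eq:
  assumes "0 < \<beta>"
  shows "mix_density \<beta> m t = exp (- real m * (lncosh_gap t + (1 / \<beta> - 1) * t\<^sup>2 / 2))"
proof -
  have "cosh t ^ m = exp (real m * ln (cosh t))"
    by (simp add: exp_of_nat_mult cosh_real_pos)
  then show ?thesis using assms
    by (simp add: mix_density_def lncosh_gap_def field_simps flip: exp_add)
qed

text \<open>The factor \<open>sqrt n\<close> is the inverse scale of the field at \<beta> = 1 and
  also dominates \<open>sqrt b\<close>. The summand 1 makes the powers increase with
  \<open>p\<close>, so bounds of lower order can be merged.\<close>

definition field_bound :: "nat \<Rightarrow> nat \<Rightarrow> real \<Rightarrow> real" where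
  "field_bound n p t = (1 + sqrt (real n) * \<bar>tanh t\<bar>) ^ p"

lemma field_bound_measurable [measurable]: "field_bound n p \<in> borel_measurable borel"
  unfolding field_bound_def
  by (intro borel_measurable_continuous_onI continuous_intros)
    (simp add: less_imp_neq[OF cosh_real_pos, symmetric])

lemma integrable_gaussian:
  assumes "0 < c"
  shows "integrable lborel (\<lambda>u::real. exp (- c * u\<^sup>2))"
proof -
  have "integrable lborel (\<lambda>u. sqrt (2 * pi * (sqrt (1 / (2 * c)))\<^sup>2) * normal_density 0 (sqrt (1 / (2 * c))) u)"
    by (intro integrable_mult_right integrable_normal_density) (use assms in auto)
  also have "(\<lambda>u. sqrt (2 * pi * (sqrt (1 / (2 * c)))\<^sup>2) * normal_density 0 (sqrt (1 / (2 * c))) u) =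
      (\<lambda>u. exp (- c * u\<^sup>2))"
    using assms by (simp add: normal_density_def fun_eq_iff mult.commute)
  finally show ?thesis .
qed

text \<open>One term of the exponential series bounds the power by
  \<open>exp (1 + \<bar>u\<bar>)\<close>, and half of the Gaussian exponent absorbs
  \<open>\<bar>u\<bar>\<close> by completing a square.\<close>

lemma polynomial_gaussian_bound:
  fixes u :: real
  assumes "0 < c"
  shows "(1 + \<bar>u\<bar>) ^ p * exp (- c * u\<^sup>2) \<le> fact p * exp (1 + 1 / (2 * c)) * exp (- (c / 2) * u\<^sup>2)"
proof -
  have "(1 + \<bar>u\<bar>) ^ p / fact p \<le> exp (1 + \<bar>u\<bar>)"
  proof -
    have "(1 + \<bar>u\<bar>) ^ p / fact p = (\<Sum>i\<in>{p}. (1 + \<bar>u\<bar>) ^ i / fact i)" by simp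
    also have "\<dots> \<le> (\<Sum>i. (1 + \<bar>u\<bar>) ^ i / fact i)"
      using summable_exp[of "1 + \<bar>u\<bar>"] by (intro sum_le_suminf) (auto simp: divide_inverse mult.commute)
    also have "\<dots> = exp (1 + \<bar>u\<bar>)" by (simp add: exp_def divide_inverse mult.commute)
    finally show ?thesis .
  qed
  then have 1: "(1 + \<bar>u\<bar>) ^ p \<le> fact p * exp (1 + \<bar>u\<bar>)" by (simp add: field_simps)
  have "0 \<le> (c * \<bar>u\<bar> - 1)\<^sup>2 / (2 * c)" using assms by simp
  also have "(c * \<bar>u\<bar> - 1)\<^sup>2 / (2 * c) = c / 2 * u\<^sup>2 - \<bar>u\<bar> + 1 / (2 * c)"
    using assms by (simp add: power2_eq_square field_simps)
  finally have "1 + \<bar>u\<bar> + - c * u\<^sup>2 \<le> 1 + 1 / (2 * c) + - (c / 2) * u\<^sup>2" by simp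
  then have 2: "exp (1 + \<bar>u\<bar>) * exp (- c * u\<^sup>2) \<le> exp (1 + 1 / (2 * c)) * exp (- (c / 2) * u\<^sup>2)"
    by (simp only: exp_add[symmetric] exp_le_cancel_iff)
  have "(1 + \<bar>u\<bar>) ^ p * exp (- c * u\<^sup>2) \<le> fact p * exp (1 + \<bar>u\<bar>) * exp (- c * u\<^sup>2)"
    by (intro mult_right_mono 1) simp
  also have "\<dots> \<le> fact p * (exp (1 + 1 / (2 * c)) * exp (- (c / 2) * u\<^sup>2))"
    using 2 by (simp only: mult.assoc) (intro mult_left_mono, auto)
  finally show ?thesis by (simp add: mult.assoc)
qed

definition scaled_gaussian_const :: "real \<Rightarrow> nat \<Rightarrow> real" where
  "scaled_gaussian_const c p =
     (\<integral>u. fact p * exp (1 + 1 / (2 * c)) * exp (- (c / 2) * u\<^sup>2) \<partial>lborel)"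

text \<open>Laplace-type estimate: under \<open>g\<close> the variable lives on scale \<open>r\<close>.\<close>

lemma moment_ratio_le:
  fixes g \<phi> :: "real \<Rightarrow> real"
  assumes [measurable]: "g \<in> borel_measurable borel" "\<phi> \<in> borel_measurable borel"
    and r: "0 < r" and c: "0 < c" and C: "0 < C0" "0 \<le> C1"
    and g: "\<And>t. 0 \<le> g t" "\<And>u. g (r * u) \<le> C1 * exp (- c * u\<^sup>2)"
    and g0: "\<And>u. u \<in> {0..1} \<Longrightarrow> C0 \<le> g (r * u)"
    and \<phi>: "\<And>t. 0 \<le> \<phi> t" "\<And>u. \<phi> (r * u) \<le> (1 + \<bar>u\<bar>) ^ p"
  shows "integrable lborel g" "integrable lborel (\<lambda>t. g t * \<phi> t)"
    and "(\<integral>t. g t * \<phi> t \<partial>lborel) \<le> C1 * scaled_gaussian_const c p / C0 * (\<integral>t. g t \<partial>lborel)"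
proof -
  let ?G = "\<lambda>q u. C1 * (fact q * exp (1 + 1 / (2 * c)) * exp (- (c / 2) * u\<^sup>2))"
  have intG: "integrable lborel (?G q)" for q
    using integrable_gaussian[of "c / 2"] c by (intro integrable_mult_right) auto
  have bound: "g (r * u) * \<psi> \<le> ?G q u" if "0 \<le> \<psi>" "\<psi> \<le> (1 + \<bar>u\<bar>) ^ q" for \<psi> u q
  proof -
    have "g (r * u) * \<psi> \<le> (C1 * exp (- c * u\<^sup>2)) * (1 + \<bar>u\<bar>) ^ q"
      using that g C by (intro mult_mono) auto
    also have "\<dots> = C1 * ((1 + \<bar>u\<bar>) ^ q * exp (- c * u\<^sup>2))" by simp
    also have "\<dots> \<le> ?G q u" by (intro mult_left_mono polynomial_gaussian_bound c C)
    finally show ?thesis .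
  qed
  have int1: "integrable lborel (\<lambda>u. g (0 + r * u) * \<phi> (0 + r * u))"
    by (rule Bochner_Integration.integrable_bound[OF intG[of p]])
      (use bound g(1) \<phi> C in \<open>auto intro!: AE_I2 simp: abs_mult\<close>)
  have int0: "integrable lborel (\<lambda>u. g (0 + r * u))"
    by (rule Bochner_Integration.integrable_bound[OF intG[of 0]])
      (use bound[of 1 _ 0] g(1) C in \<open>auto intro!: AE_I2 simp: abs_mult\<close>)
  show ig: "integrable lborel g"
    using lborel_integrable_real_affine_iff[of r g 0] int0 r by simp
  show "integrable lborel (\<lambda>t. g t * \<phi> t)"
    using lborel_integrable_real_affine_iff[of r "\<lambda>t. g t * \<phi> t" 0] int1 r by simp
  have "(\<integral>t. g t * \<phi> t \<partial>lborel) = r * (\<integral>u. g (0 + r * u) * \<phi> (0 + r * u) \<partial>lborel)"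
    using lborel_integral_real_affine[of r "\<lambda>t. g t * \<phi> t" 0] r by simp
  also have "\<dots> \<le> r * (\<integral>u. ?G p u \<partial>lborel)"
    using r by (intro mult_left_mono integral_mono int1 intG) (use bound \<phi> in auto)
  also have "(\<integral>u. ?G p u \<partial>lborel) = C1 * scaled_gaussian_const c p"
    by (simp add: scaled_gaussian_const_def)
  finally have num: "(\<integral>t. g t * \<phi> t \<partial>lborel) \<le> r * (C1 * scaled_gaussian_const c p)" .
  have K: "0 \<le> scaled_gaussian_const c p"
    unfolding scaled_gaussian_const_def by (rule integral_nonneg_AE) auto
  \<comment> \<open>In the rescaled variable the interval \<open>{0..1}\<close> alone contributes
    \<open>C0\<close>; the Jacobian \<open>r\<close> cancels against that of the numerator.\<close>
  have "r * C0 = r * integral\<^sup>L lborel (\<lambda>u::real. C0 * indicator {0..1} u)" by (simp add: content_real)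
  also have "\<dots> \<le> r * (\<integral>u. g (0 + r * u) \<partial>lborel)"
  proof (intro mult_left_mono integral_mono int0)
    show "integrable lborel (\<lambda>u::real. C0 * indicator {0..1} u)"
      by (intro integrable_mult_right integrable_real_indicator) auto
  qed (use r g0 g(1) in \<open>auto split: split_indicator\<close>)
  also have "\<dots> = (\<integral>t. g t \<partial>lborel)"
    using lborel_integral_real_affine[of r g 0] r by simp
  finally have den: "r * C0 \<le> (\<integral>t. g t \<partial>lborel)" .
  have "r * (C1 * scaled_gaussian_const c p) = C1 * scaled_gaussian_const c p / C0 * (r * C0)"
    using C by simp
  also have "\<dots> \<le> C1 * scaled_gaussian_const c p / C0 * (\<integral>t. g t \<partial>lborel)"
    using C K by (intro mult_left_mono den) auto
  finally show "(\<integral>t. g t * \<phi> t \<partial>lborel) \<le> C1 * scaled_gaussian_const c p / C0 * (\<integral>t. g t \<partial>lborel)"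
    using num by linarith
qed

text \<open>At the critical value \<open>\<beta> = 1\<close> the natural scale of \<open>t\<close> is \<open>n powr (-1/2)\<close>, for
  \<open>\<beta> < 1\<close> it is \<open>1 / n\<close>.\<close>

lemma mix_density_moment:
  assumes \<beta>: "0 < \<beta>" "\<beta> \<le> 1"
  obtains C where "0 \<le> C"
    "\<And>n. 1 \<le> n \<Longrightarrow> integrable lborel (mix_density \<beta> (n\<^sup>2))"
    "\<And>n. 1 \<le> n \<Longrightarrow> integrable lborel (\<lambda>t. mix_density \<beta> (n\<^sup>2) t * field_bound n p t)"
    "\<And>n. 1 \<le> n \<Longrightarrow> (\<integral>t. mix_density \<beta> (n\<^sup>2) t * field_bound n p t \<partial>lborel)
        \<le> C * (\<integral>t. mix_density \<beta> (n\<^sup>2) t \<partial>lborel)"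
proof -
  \<comment> \<open>For \<beta> < 1 the decay comes from the quadratic term with
    \<open>1 / \<beta> - 1\<close>. At \<beta> = 1 it comes from
    \<open>(\<bar>u\<bar> - 1)\<^sup>2 / 8 \<ge> u\<^sup>2 / 16 - 1 / 8\<close>, whence
    \<open>c\<close> and \<open>C1\<close>; the \<open>1 / 4\<close> in \<open>C0\<close> stems from
    \<open>lncosh_gap_le\<close>.\<close>
  define c where "c = (if \<beta> < 1 then (1 / \<beta> - 1) / 2 else 1 / 16)"
  define C0 where "C0 = (if \<beta> < 1 then exp (- 1 / 4 - (1 / \<beta> - 1) / 2) else exp (- 1 / 4))"
  define C1 :: real where "C1 = (if \<beta> < 1 then 1 else exp (1 / 8))"
  have cpos: "0 < c" "0 < C0" "0 \<le> C1" using \<beta> by (auto simp: c_def C0_def C1_def)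
  have *: "integrable lborel (mix_density \<beta> (n\<^sup>2)) \<and>
      integrable lborel (\<lambda>t. mix_density \<beta> (n\<^sup>2) t * field_bound n p t) \<and>
      (\<integral>t. mix_density \<beta> (n\<^sup>2) t * field_bound n p t \<partial>lborel)
        \<le> C1 * scaled_gaussian_const c p / C0 * (\<integral>t. mix_density \<beta> (n\<^sup>2) t \<partial>lborel)"
    if n: "1 \<le> n" for n :: nat
  proof -
    define r where "r = (if \<beta> < 1 then 1 / real n else 1 / sqrt (real n))"
    have r: "0 < r" using n by (auto simp: r_def)
    have s: "sqrt (real n) * r \<le> 1"
    proof -
      have "sqrt (real n) \<le> real n" using n
        by (intro real_le_lsqrt) (auto simp: power2_eq_square)
      then show ?thesis using n by (auto simp: r_def field_simps)
    qed
    have \<phi>: "field_bound n p (r * u) \<le> (1 + \<bar>u\<bar>) ^ p" for u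
    proof -
      have "sqrt (real n) * \<bar>tanh (r * u)\<bar> \<le> sqrt (real n) * \<bar>r * u\<bar>"
        by (intro mult_left_mono abs_tanh_le) auto
      also have "\<dots> = (sqrt (real n) * r) * \<bar>u\<bar>" using r by (simp add: abs_mult)
      also have "\<dots> \<le> 1 * \<bar>u\<bar>" by (intro mult_right_mono s) auto
      finally show ?thesis unfolding field_bound_def by (intro power_mono) auto
    qed
    have up: "mix_density \<beta> (n\<^sup>2) (r * u) \<le> C1 * exp (- c * u\<^sup>2)" for u
    proof (cases "\<beta> < 1")
      case True
      then have e: "real (n\<^sup>2) * (r * u)\<^sup>2 = u\<^sup>2" using n by (simp add: r_def power_divide)
      have "- real (n\<^sup>2) * (lncosh_gap (r * u) + (1 / \<beta> - 1) * (r * u)\<^sup>2 / 2)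
          = - (real (n\<^sup>2) * lncosh_gap (r * u)) - (1 / \<beta> - 1) / 2 * (real (n\<^sup>2) * (r * u)\<^sup>2)"
        by (simp add: field_simps)
      also have "\<dots> \<le> - c * u\<^sup>2"
        unfolding e using lncosh_gap_nonneg[of "r * u"] True by (simp add: c_def)
      finally show ?thesis using True by (simp add: mix_density_eq[OF \<beta>(1)] C1_def)
    next
      case False
      then have \<beta>1: "\<beta> = 1" using \<beta> by simp
      have "u\<^sup>2 / 16 - 1 / 8 \<le> real (n\<^sup>2) * lncosh_gap (r * u)"
      proof (cases "1 \<le> \<bar>u\<bar>")
        case True
        have rn: "r\<^sup>2 = 1 / real n" "r \<le> 1" using \<beta>1 n by (auto simp: r_def power_divide)
        have "r\<^sup>2 / 8 * (r * \<bar>u\<bar> - r)\<^sup>2 \<le> lncosh_gap (r * \<bar>u\<bar>)"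
          by (rule lncosh_gap_ge) (use r rn True in auto)
        also have "lncosh_gap (r * \<bar>u\<bar>) = lncosh_gap (r * u)"
          using lncosh_gap_abs[of "r * u"] r by (simp add: abs_mult)
        finally have "r\<^sup>2 / 8 * (r * (\<bar>u\<bar> - 1))\<^sup>2 \<le> lncosh_gap (r * u)"
          by (simp add: right_diff_distrib)
        then have "real (n\<^sup>2) * (r\<^sup>2 / 8 * (r * (\<bar>u\<bar> - 1))\<^sup>2) \<le> real (n\<^sup>2) * lncosh_gap (r * u)"
          by (rule mult_left_mono) simp
        moreover have "real (n\<^sup>2) * (r\<^sup>2 / 8 * (r * (\<bar>u\<bar> - 1))\<^sup>2) = (\<bar>u\<bar> - 1)\<^sup>2 / 8"
          using n by (simp add: power_mult_distrib rn power2_eq_square[of "real n"])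
        moreover have "u\<^sup>2 / 2 - 1 \<le> (\<bar>u\<bar> - 1)\<^sup>2"
          using zero_le_power2[of "\<bar>u\<bar> - 2"] by (simp add: power2_diff)
        ultimately show ?thesis by linarith
      next
        case False
        then have "u\<^sup>2 \<le> 1" by (simp add: abs_square_le_1)
        moreover have "0 \<le> real (n\<^sup>2) * lncosh_gap (r * u)"
          by (intro mult_nonneg_nonneg lncosh_gap_nonneg) simp
        ultimately show ?thesis by linarith
      qed
      then have "exp (- (real (n\<^sup>2) * lncosh_gap (r * u))) \<le> exp (1 / 8 + - (1 / 16) * u\<^sup>2)" by simp
      moreover have "mix_density \<beta> (n\<^sup>2) (r * u) = exp (- (real (n\<^sup>2) * lncosh_gap (r * u)))"
        using \<beta>1 by (simp add: mix_density_eq)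
      ultimately show ?thesis using False by (simp add: C1_def c_def flip: exp_add)
    qed
    have low: "C0 \<le> mix_density \<beta> (n\<^sup>2) (r * u)" if u: "u \<in> {0..1}" for u
    proof -
      have u1: "u ^ 4 \<le> 1" "u\<^sup>2 \<le> 1" using u by (auto intro: power_le_one)
      have "real (n\<^sup>2) * lncosh_gap (r * u) \<le> real (n\<^sup>2) * ((r * u) ^ 4 / 4)"
        by (intro mult_left_mono lncosh_gap_le) auto
      also have "\<dots> = (sqrt (real n) * r) ^ 4 * u ^ 4 / 4"
      proof -
        have "sqrt (real n) ^ 4 = real (n\<^sup>2)"
          using power_mult[of "sqrt (real n)" 2 2] by simp
        then show ?thesis by (simp add: power_mult_distrib)
      qed
      also have "\<dots> \<le> 1 * 1 / 4"
        using s r u1 u by (intro divide_right_mono mult_mono power_le_one) auto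
      finally have 1: "real (n\<^sup>2) * lncosh_gap (r * u) \<le> 1 / 4" by simp
      show ?thesis
      proof (cases "\<beta> < 1")
        case True
        then have e: "real (n\<^sup>2) * (r * u)\<^sup>2 = u\<^sup>2" using n by (simp add: r_def power_divide)
        have "- 1 / 4 - (1 / \<beta> - 1) / 2 \<le> - (real (n\<^sup>2) * lncosh_gap (r * u)) - (1 / \<beta> - 1) / 2 * u\<^sup>2"
        proof -
          have "(1 / \<beta> - 1) / 2 * u\<^sup>2 \<le> (1 / \<beta> - 1) / 2 * 1"
            using \<beta> by (intro mult_left_mono u1(2)) auto
          then show ?thesis using 1 by linarith
        qed
        also have "\<dots> = - real (n\<^sup>2) * (lncosh_gap (r * u) + (1 / \<beta> - 1) * (r * u)\<^sup>2 / 2)"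
          unfolding e[symmetric] by (simp add: field_simps)
        finally show ?thesis using True by (simp add: mix_density_eq[OF \<beta>(1)] C0_def)
      next
        case False
        then show ?thesis unfolding mix_density_eq[OF \<beta>(1)] using 1 \<beta> by (simp add: C0_def)
      qed
    qed
    have "0 \<le> field_bound n p t" for t by (simp add: field_bound_def)
    note mr = moment_ratio_le[of "mix_density \<beta> (n\<^sup>2)" "field_bound n p",
        OF mix_density_measurable field_bound_measurable r cpos less_imp_le[OF mix_density_pos] up low this \<phi>]
    show ?thesis by (intro conjI mr)
  qed
  have "0 \<le> scaled_gaussian_const c p"
    unfolding scaled_gaussian_const_def by (rule integral_nonneg_AE) auto
  then have "0 \<le> C1 * scaled_gaussian_const c p / C0" using cpos by simp
  then show thesis by (rule that) (use * in blast)+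
qed

subsection \<open>The Curie--Weiss distribution as a mixture\<close>

definition spin_prob :: "real \<Rightarrow> real \<Rightarrow> real" where
  "spin_prob t v = exp (t * v) / (2 * cosh t)"

lemma spin_prob_nonneg: "0 \<le> spin_prob t v"
  by (simp add: spin_prob_def cosh_real_nonneg)

lemma sum_spin_prob: "(\<Sum>v\<in>{-1, 1}. spin_prob t v) = 1"
proof -
  have "2 * cosh t = exp (- t) + exp t" by (simp add: cosh_def)
  moreover have "0 < exp (- t) + exp t" by (intro add_pos_pos) auto
  ultimately show ?thesis by (simp add: spin_prob_def add_divide_distrib[symmetric])
qed

lemma sum_spin_prob_times: "(\<Sum>v\<in>{-1, 1}. spin_prob t v * v) = tanh t"
  by (simp add: spin_prob_def tanh_def sinh_def diff_divide_distrib)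

text \<open>Expectation given the field, as a finite sum instead of a product measure: it makes
  sense for every function, so the walk estimates need no measurability.\<close>

definition spin_mean :: "'i set \<Rightarrow> real \<Rightarrow> (('i \<Rightarrow> real) \<Rightarrow> real) \<Rightarrow> real" where
  "spin_mean I t F = (\<Sum>y\<in>I \<rightarrow>\<^sub>E {-1, 1}. (\<Prod>i\<in>I. spin_prob t (y i)) * F y)"

lemma spin_mean_prod:
  assumes I: "finite I" "J \<subseteq> I"
  shows "spin_mean I t (\<lambda>y. \<Prod>j\<in>J. y j) = tanh t ^ card J"
proof -
  have "spin_mean I t (\<lambda>y. \<Prod>j\<in>J. y j) =
      (\<Sum>y\<in>I \<rightarrow>\<^sub>E {-1, 1}. \<Prod>i\<in>I. spin_prob t (y i) * (if i \<in> J then y i else 1))"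
    unfolding spin_mean_def
    by (intro sum.cong refl) (use I in \<open>simp add: prod.distrib prod.If_cases Int_absorb1\<close>)
  also have "\<dots> = (\<Prod>i\<in>I. \<Sum>v\<in>{-1, 1}. spin_prob t v * (if i \<in> J then v else 1))"
    by (rule prod_sum_PiE[symmetric]) (use I in auto)
  also have "\<dots> = (\<Prod>i\<in>I. if i \<in> J then tanh t else 1)"
    by (rule prod.cong) (use sum_spin_prob sum_spin_prob_times in auto)
  also have "\<dots> = tanh t ^ card J"
    using I by (simp add: prod.If_cases Int_absorb1)
  finally show ?thesis .
qed

lemma spin_mean_1: "finite I \<Longrightarrow> spin_mean I t (\<lambda>_. 1) = 1"
  using spin_mean_prod[of I "{}" t] by simp

lemma spin_mean_add: "spin_mean I t (\<lambda>y. F y + G y) = spin_mean I t F + spin_mean I t G"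
  by (simp add: spin_mean_def sum.distrib distrib_left)

lemma spin_mean_diff: "spin_mean I t (\<lambda>y. F y - G y) = spin_mean I t F - spin_mean I t G"
  by (simp add: spin_mean_def sum_subtractf right_diff_distrib)

lemma spin_mean_cmult: "spin_mean I t (\<lambda>y. c * F y) = c * spin_mean I t F"
  by (simp add: spin_mean_def sum_distrib_left mult_ac)

lemma spin_mean_sum: "spin_mean I t (\<lambda>y. \<Sum>k\<in>K. F k y) = (\<Sum>k\<in>K. spin_mean I t (F k))"
  unfolding spin_mean_def sum_distrib_left by (rule sum.swap)

lemma spin_mean_const: "finite I \<Longrightarrow> spin_mean I t (\<lambda>_. c) = c"
  using spin_mean_cmult[of I t c "\<lambda>_. 1"] by (simp add: spin_mean_1)

lemma spin_mean_mono:
  assumes "\<And>y. y \<in> I \<rightarrow>\<^sub>E {-1, 1} \<Longrightarrow> F y \<le> G y"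
  shows "spin_mean I t F \<le> spin_mean I t G"
  unfolding spin_mean_def
  by (intro sum_mono mult_left_mono assms prod_nonneg) (auto simp: spin_prob_nonneg)

lemma spin_mean_cong:
  assumes "\<And>y. y \<in> I \<rightarrow>\<^sub>E {-1, 1} \<Longrightarrow> F y = G y"
  shows "spin_mean I t F = spin_mean I t G"
  unfolding spin_mean_def by (intro sum.cong) (use assms in auto)

lemma gaussian_mgf:
  fixes s :: real
  assumes "0 < \<beta>" "0 < m"
  shows "integrable lborel (\<lambda>t. exp (- (real m * t\<^sup>2) / (2 * \<beta>) + t * s))"
    and "(\<integral>t. exp (- (real m * t\<^sup>2) / (2 * \<beta>) + t * s) \<partial>lborel) =
      sqrt (2 * pi * (\<beta> / real m)) * exp (\<beta> / (2 * real m) * s\<^sup>2)"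
proof -
  let ?\<mu> = "\<beta> * s / real m" and ?\<sigma> = "sqrt (\<beta> / real m)"
  let ?k = "sqrt (2 * pi * (\<beta> / real m)) * exp (\<beta> / (2 * real m) * s\<^sup>2)"
  have \<sigma>: "0 < ?\<sigma>" "?\<sigma>\<^sup>2 = \<beta> / real m" using assms by auto
  have eq: "exp (- (real m * t\<^sup>2) / (2 * \<beta>) + t * s) = ?k * normal_density ?\<mu> ?\<sigma> t" for t
  proof -
    have "- (real m * t\<^sup>2) / (2 * \<beta>) + t * s =
        \<beta> / (2 * real m) * s\<^sup>2 + - (t - ?\<mu>)\<^sup>2 / (2 * (\<beta> / real m))"
      using assms by (simp add: field_simps power2_eq_square)
    then have e: "exp (- (real m * t\<^sup>2) / (2 * \<beta>) + t * s) =
        exp (\<beta> / (2 * real m) * s\<^sup>2) * exp (- (t - ?\<mu>)\<^sup>2 / (2 * (\<beta> / real m)))"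
      by (simp only: exp_add)
    have nz: "sqrt (2 * pi * (\<beta> / real m)) \<noteq> 0" using assms by simp
    have cancel: "a * c = (k * a) * (1 / k * c)" if "k \<noteq> 0" for a c k :: real
      using that by simp
    show ?thesis
      unfolding normal_density_def \<sigma>(2) e by (rule cancel[OF nz])
  qed
  show "integrable lborel (\<lambda>t. exp (- (real m * t\<^sup>2) / (2 * \<beta>) + t * s))"
    unfolding eq by (intro integrable_mult_right integrable_normal_density \<sigma>)
  show "(\<integral>t. exp (- (real m * t\<^sup>2) / (2 * \<beta>) + t * s) \<partial>lborel) = ?k"
    unfolding eq using integral_normal_density[OF \<sigma>(1)] by simp
qed

text \<open>The factor \<open>cosh t ^ m\<close> of the density cancels the normalisations of the
  spins, leaving a Gaussian tilted by the sum of the spins.\<close>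

lemma mix_density_times_spin_prob:
  assumes "finite I"
  shows "mix_density \<beta> (card I) t * (\<Prod>i\<in>I. spin_prob t (y i)) =
    (1 / 2 ^ card I) * exp (- (real (card I) * t\<^sup>2) / (2 * \<beta>) + t * (\<Sum>i\<in>I. y i))"
proof -
  have "(\<Prod>i\<in>I. spin_prob t (y i)) = exp (t * (\<Sum>i\<in>I. y i)) / (2 * cosh t) ^ card I"
    unfolding spin_prob_def prod_dividef using assms by (simp add: exp_sum[symmetric] sum_distrib_left)
  then show ?thesis
    using cosh_real_pos[of t] by (simp add: mix_density_def mult_exp_exp power_mult_distrib)
qed

definition cw_mean :: "real \<Rightarrow> 'i set \<Rightarrow> (('i \<Rightarrow> real) \<Rightarrow> real) \<Rightarrow> real" where
  "cw_mean \<beta> I F = (\<Sum>y\<in>I \<rightarrow>\<^sub>E {-1, 1}. 1 / cw_norm \<beta> I * cw_weight \<beta> I y * F y)"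

lemma cw_norm_pos: "finite I \<Longrightarrow> 0 < cw_norm \<beta> I"
  unfolding cw_norm_def
  by (rule sum_pos) (auto simp: cw_weight_def PiE_eq_empty_iff intro: finite_PiE)

text \<open>Hubbard--Stratonovich transformation: the square in the exponent is linearized by a Gaussian
  integral over \<open>t\<close>.\<close>

lemma cw_mean_mixture:
  fixes I :: "'i set"
  assumes \<beta>: "0 < \<beta>" and I: "finite I" "I \<noteq> {}"
  shows "integrable lborel (\<lambda>t. mix_density \<beta> (card I) t * spin_mean I t F)"
    and "(\<integral>t. mix_density \<beta> (card I) t * spin_mean I t F \<partial>lborel) =
      cw_mean \<beta> I F * (\<integral>t. mix_density \<beta> (card I) t \<partial>lborel)"
    and "0 < (\<integral>t. mix_density \<beta> (card I) t \<partial>lborel)"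
proof -
  define m where "m = card I"
  have m: "0 < m" using I by (simp add: m_def card_gt_0_iff)
  \<comment> \<open>Every configuration receives its weight up to this common factor, which cancels
    against the total mass.\<close>
  let ?\<kappa> = "1 / 2 ^ m * sqrt (2 * pi * (\<beta> / real m))"
  have int: "integrable lborel (\<lambda>t. mix_density \<beta> m t * (\<Prod>i\<in>I. spin_prob t (y i)))" for y :: "'i \<Rightarrow> real"
    using gaussian_mgf(1)[OF \<beta> m]
    by (simp only: m_def mix_density_times_spin_prob[OF I(1)] integrable_mult_right)
  have val: "(\<integral>t. mix_density \<beta> m t * (\<Prod>i\<in>I. spin_prob t (y i)) \<partial>lborel) = ?\<kappa> * cw_weight \<beta> I y"
    for y :: "'i \<Rightarrow> real"
    using gaussian_mgf(2)[OF \<beta> m, of "\<Sum>i\<in>I. y i"]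
    by (simp add: m_def mix_density_times_spin_prob[OF I(1)] cw_weight_def)
  have expand: "mix_density \<beta> m t * spin_mean I t F =
      (\<Sum>y\<in>I \<rightarrow>\<^sub>E {-1, 1}. F y * (mix_density \<beta> m t * (\<Prod>i\<in>I. spin_prob t (y i))))" for F t
    by (simp add: spin_mean_def sum_distrib_left mult_ac)
  show "integrable lborel (\<lambda>t. mix_density \<beta> (card I) t * spin_mean I t F)"
    unfolding m_def[symmetric] expand by (intro Bochner_Integration.integrable_sum integrable_mult_right int)
  have tot: "(\<integral>t. mix_density \<beta> m t * spin_mean I t F \<partial>lborel) =
      ?\<kappa> * (\<Sum>y\<in>I \<rightarrow>\<^sub>E {-1, 1}. cw_weight \<beta> I y * F y)" for F
  proof -
    have "(\<integral>t. mix_density \<beta> m t * spin_mean I t F \<partial>lborel) =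
        (\<Sum>y\<in>I \<rightarrow>\<^sub>E {-1, 1}. F y * (?\<kappa> * cw_weight \<beta> I y))"
      unfolding expand
      by (subst Bochner_Integration.integral_sum)
        (use int in \<open>simp_all only: integrable_mult_right integral_mult_right_zero val\<close>)
    then show ?thesis by (simp only: sum_distrib_left mult_ac)
  qed
  have W: "(\<integral>t. mix_density \<beta> m t \<partial>lborel) = ?\<kappa> * cw_norm \<beta> I"
    using tot[of "\<lambda>_. 1"] by (simp add: spin_mean_1[OF I(1)] cw_norm_def)
  then show "0 < (\<integral>t. mix_density \<beta> (card I) t \<partial>lborel)"
    using cw_norm_pos[OF I(1), of \<beta>] \<beta> m by (simp add: m_def)
  have "cw_mean \<beta> I F = (\<Sum>y\<in>I \<rightarrow>\<^sub>E {-1, 1}. cw_weight \<beta> I y * F y) / cw_norm \<beta> I"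
    by (simp add: cw_mean_def sum_divide_distrib)
  with W have "cw_mean \<beta> I F * (\<integral>t. mix_density \<beta> m t \<partial>lborel) =
      ?\<kappa> * (\<Sum>y\<in>I \<rightarrow>\<^sub>E {-1, 1}. cw_weight \<beta> I y * F y)"
    using cw_norm_pos[OF I(1), of \<beta>] by simp
  then show "(\<integral>t. mix_density \<beta> (card I) t * spin_mean I t F \<partial>lborel) =
      cw_mean \<beta> I F * (\<integral>t. mix_density \<beta> (card I) t \<partial>lborel)"
    unfolding m_def[symmetric] tot by simp
qed

text \<open>The total mass of the mixing density cancels, so a bound valid at every field value
  passes to the Curie-Weiss mean. \<open>C\<close> depends only on \<beta> and \<open>p\<close>; the
  rate in \<open>n\<close> is carried by \<open>A\<close>.\<close>

lemma cw_mean_bound: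
  assumes \<beta>: "0 < \<beta>" "\<beta> \<le> 1"
  obtains C where "0 \<le> C"
    "\<And>n (I :: 'i set) F A. 1 \<le> n \<Longrightarrow> finite I \<Longrightarrow> card I = n\<^sup>2 \<Longrightarrow> 0 \<le> A \<Longrightarrow>
      (\<And>t. spin_mean I t F \<le> A * field_bound n p t) \<Longrightarrow> cw_mean \<beta> I F \<le> A * C"
proof -
  obtain C where C: "0 \<le> C"
    "\<And>n. 1 \<le> n \<Longrightarrow> integrable lborel (mix_density \<beta> (n\<^sup>2))"
    "\<And>n. 1 \<le> n \<Longrightarrow> integrable lborel (\<lambda>t. mix_density \<beta> (n\<^sup>2) t * field_bound n p t)"
    "\<And>n. 1 \<le> n \<Longrightarrow> (\<integral>t. mix_density \<beta> (n\<^sup>2) t * field_bound n p t \<partial>lborel)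
        \<le> C * (\<integral>t. mix_density \<beta> (n\<^sup>2) t \<partial>lborel)"
    using mix_density_moment[OF \<beta>, of p] by blast
  show thesis
  proof (rule that[OF C(1)])
    fix n and I :: "'i set" and F and A :: real
    assume n: "1 \<le> n" and I: "finite I" "card I = n\<^sup>2" and A: "0 \<le> A"
      and F: "\<And>t. spin_mean I t F \<le> A * field_bound n p t"
    have I': "I \<noteq> {}" using I n by (metis card.empty not_one_le_zero power_eq_0_iff)
    note mixture = cw_mean_mixture(1,2)[OF \<beta>(1) I(1) I', of F, unfolded I(2)]
    let ?W = "\<integral>t. mix_density \<beta> (n\<^sup>2) t \<partial>lborel"
    note W = cw_mean_mixture(3)[OF \<beta>(1) I(1) I', unfolded I(2)]
    have "cw_mean \<beta> I F * ?W \<le> (\<integral>t. A * (mix_density \<beta> (n\<^sup>2) t * field_bound n p t) \<partial>lborel)"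
      unfolding mixture(2)[symmetric]
    proof (intro integral_mono mixture(1) integrable_mult_right C(3) n)
      fix t
      have "mix_density \<beta> (n\<^sup>2) t * spin_mean I t F \<le> mix_density \<beta> (n\<^sup>2) t * (A * field_bound n p t)"
        by (intro mult_left_mono F less_imp_le mix_density_pos)
      then show "mix_density \<beta> (n\<^sup>2) t * spin_mean I t F \<le> A * (mix_density \<beta> (n\<^sup>2) t * field_bound n p t)"
        by (simp add: mult_ac)
    qed
    also have "\<dots> \<le> A * (C * ?W)"
      unfolding integral_mult_right_zero by (intro mult_left_mono C(4) n A)
    finally show "cw_mean \<beta> I F \<le> A * C"
      using W by (simp add: mult.assoc[symmetric])
  qed
qed

text \<open>The configurations in \<open>{-1, 1}\<close> exhaust the probability space up to a null set, because their
  probabilities add up to \<open>1\<close>.\<close>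

lemma
  assumes M: "prob_space M" and cw: "curie_weiss M \<beta> I Y" and I: "finite I"
  shows curie_weiss_AE: "AE \<omega> in M. \<exists>y\<in>I \<rightarrow>\<^sub>E {-1, 1}. \<forall>i\<in>I. Y i \<omega> = y i"
    and curie_weiss_expectation: "\<And>(G :: 'w \<Rightarrow> real) g. G \<in> borel_measurable M \<Longrightarrow>
      (\<And>\<omega> y. \<omega> \<in> space M \<Longrightarrow> y \<in> I \<rightarrow>\<^sub>E {-1, 1} \<Longrightarrow> (\<And>i. i \<in> I \<Longrightarrow> Y i \<omega> = y i) \<Longrightarrow> G \<omega> = g y) \<Longrightarrow>
      (\<integral>\<omega>. G \<omega> \<partial>M) = cw_mean \<beta> I g"
proof -
  interpret prob_space M by (rule M)
  define S where "S = I \<rightarrow>\<^sub>E {-1, 1::real}"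
  have fin: "finite S" unfolding S_def by (rule finite_PiE) (use I in auto)
  define B where "B y = {\<omega> \<in> space M. \<forall>i\<in>I. Y i \<omega> = y i}" for y
  have [measurable]: "Y i \<in> borel_measurable M" if "i \<in> I" for i
    using cw that by (auto simp: curie_weiss_def)
  have B [measurable]: "B y \<in> events" for y
    unfolding B_def using I by measurable
  have pB: "prob (B y) = 1 / cw_norm \<beta> I * cw_weight \<beta> I y" if "y \<in> S" for y
    using cw that by (auto simp: curie_weiss_def S_def B_def)
  have inj: "y = y'" if "y \<in> S" "y' \<in> S" "\<omega> \<in> B y" "\<omega> \<in> B y'" for y y' \<omega>
    using that unfolding S_def B_def by (intro PiE_ext[of y I _ y']) auto
  have "prob (\<Union>y\<in>S. B y) = (\<Sum>y\<in>S. prob (B y))"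
    using B inj by (intro finite_measure_finite_Union fin) (auto simp: disjoint_family_on_def)
  also have "\<dots> = (\<Sum>y\<in>S. cw_weight \<beta> I y) / cw_norm \<beta> I"
    by (simp add: pB sum_divide_distrib)
  also have "\<dots> = 1" using cw_norm_pos[OF I, of \<beta>] by (simp add: cw_norm_def S_def)
  finally have AE_B: "AE \<omega> in M. \<omega> \<in> (\<Union>y\<in>S. B y)"
    using fin B by (intro AE_prob_1) auto
  then show "AE \<omega> in M. \<exists>y\<in>I \<rightarrow>\<^sub>E {-1, 1}. \<forall>i\<in>I. Y i \<omega> = y i"
    by eventually_elim (auto simp: S_def B_def)
  fix G :: "'w \<Rightarrow> real" and g
  assume G [measurable]: "G \<in> borel_measurable M"
    and g: "\<And>\<omega> y. \<omega> \<in> space M \<Longrightarrow> y \<in> I \<rightarrow>\<^sub>E {-1, 1} \<Longrightarrow> (\<And>i. i \<in> I \<Longrightarrow> Y i \<omega> = y i) \<Longrightarrow> G \<omega> = g y"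
  have "AE \<omega> in M. G \<omega> = (\<Sum>y\<in>S. g y * indicator (B y) \<omega>)"
    using AE_B
  proof eventually_elim
    case (elim \<omega>)
    then obtain y where y: "y \<in> S" "\<omega> \<in> B y" by blast
    have "(\<Sum>y\<in>S. g y * indicator (B y) \<omega>) = (\<Sum>z\<in>{y}. g z * indicator (B z) \<omega>)"
      by (rule sum.mono_neutral_right) (use fin y inj in \<open>auto simp: indicator_def\<close>)
    also have "\<dots> = g y" using y by simp
    also have "\<dots> = G \<omega>" using g[of \<omega> y] y by (auto simp: S_def B_def)
    finally show ?case ..
  qed
  then have "(\<integral>\<omega>. G \<omega> \<partial>M) = (\<integral>\<omega>. (\<Sum>y\<in>S. g y * indicator (B y) \<omega>) \<partial>M)"
    by (intro integral_cong_AE) auto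
  also have "\<dots> = (\<Sum>y\<in>S. g y * prob (B y))"
    by (subst Bochner_Integration.integral_sum) (auto simp: less_top[symmetric] intro!: integrable_mult_right)
  also have "\<dots> = cw_mean \<beta> I g"
    unfolding cw_mean_def S_def[symmetric] by (intro sum.cong) (simp_all add: pB)
  finally show "(\<integral>\<omega>. G \<omega> \<partial>M) = cw_mean \<beta> I g" .
qed

subsection \<open>Conditional mean and variance of the spectral moments\<close>

text \<open>Densities and moments satisfy the same convolution recursion, the former up to
  \<open>O (1 / b)\<close>, and agree at orders 0 and 1. The constant precedes the graph because it
  must serve all \<open>n\<close> and all vertices.\<close>

lemma even_density_close:
  "\<exists>D\<ge>0. \<forall>V N b. band_graph V N b \<longrightarrow>
     (\<forall>x\<in>V. \<bar>band_graph.even_density N b k x - sc_moment k\<bar> \<le> D / real b)"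
proof (induction k rule: less_induct)
  case (less k)
  consider "k = 0" | "k = 1" | l where "k = l + 2"
    by (metis One_nat_def add_2_eq_Suc' not0_implies_Suc)
  then show ?case
  proof cases
    case 1
    have "band_graph.even_density N b k x = 1" if g: "band_graph V N b" for V N b x
      using band_graph.even_walks_0[OF g] 1 by (simp add: band_graph.even_density_def[OF g])
    then show ?thesis using 1 by (intro exI[of _ 0]) (auto simp: sc_moment_0)
  next
    case 2
    have "band_graph.even_density N b k x = 0" if g: "band_graph V N b" for V N b x
      using band_graph.even_walks_odd[OF g, of k x] 2 by (simp add: band_graph.even_density_def[OF g])
    then show ?thesis using 2 by (intro exI[of _ 0]) (auto simp: sc_moment_1)
  next
    case (3 l)
    have "\<forall>j. \<exists>D. j \<le> l \<longrightarrow> 0 \<le> D \<and> (\<forall>V N b. band_graph V N b \<longrightarrow>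
        (\<forall>x\<in>V. \<bar>band_graph.even_density N b j x - sc_moment j\<bar> \<le> D / real b))"
      using less 3 by auto
    then obtain D where D0: "\<And>j. j \<le> l \<Longrightarrow> 0 \<le> D j"
      and D: "\<And>j V N b x. j \<le> l \<Longrightarrow> band_graph V N b \<Longrightarrow> x \<in> V \<Longrightarrow>
        \<bar>band_graph.even_density N b j x - sc_moment j\<bar> \<le> D j / real b"
      by metis
    let ?R = "\<lambda>j. D j * (\<bar>sc_moment (l - j)\<bar> + D (l - j)) + \<bar>sc_moment j\<bar> * D (l - j)"
    define K where "K = real (l + 1) * fact (l + 3) +
      (\<Sum>j\<le>l. ?R j)"
    have K0: "0 \<le> K" unfolding K_def using D0
      by (intro add_nonneg_nonneg sum_nonneg mult_nonneg_nonneg) auto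
    have "\<bar>band_graph.even_density N b k x - sc_moment k\<bar> \<le> K / real b"
      if g: "band_graph V N b" and x: "x \<in> V" for V N b x
    proof -
      interpret band_graph V N b by (rule g)
      let ?U = "\<lambda>j. (\<Sum>y\<in>N x. even_density j y) / real b * even_density (l - j) x"
      have b1: "1 \<le> real b" using b_pos by simp
      have term_le: "\<bar>?U j - sc_moment j * sc_moment (l - j)\<bar>
          \<le> ?R j / real b"
        if j: "j \<le> l" for j
      proof -
        let ?A = "(\<Sum>y\<in>N x. even_density j y) / real b" and ?B = "even_density (l - j) x"
        have "?A - sc_moment j = (\<Sum>y\<in>N x. even_density j y - sc_moment j) / real b"
          using card_N[OF x] b_pos by (simp add: sum_subtractf diff_divide_distrib)
        also have "\<bar>\<dots>\<bar> \<le> (\<Sum>y\<in>N x. D j / real b) / real b"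
          unfolding abs_divide abs_of_nat
          by (intro divide_right_mono order_trans[OF sum_abs] sum_mono D[OF j g])
            (use N_subset[OF x] in auto)
        also have "\<dots> = D j / real b" using card_N[OF x] b_pos by simp
        finally have A: "\<bar>?A - sc_moment j\<bar> \<le> D j / real b" .
        have B: "\<bar>?B - sc_moment (l - j)\<bar> \<le> D (l - j) / real b" using D[OF _ g x] by simp
        have "D (l - j) / real b \<le> D (l - j)"
          using divide_left_mono[of 1 "real b" "D (l - j)"] D0[of "l - j"] b1 by simp
        then have B': "\<bar>?B\<bar> \<le> \<bar>sc_moment (l - j)\<bar> + D (l - j)" using B by linarith
        have "?A * ?B - sc_moment j * sc_moment (l - j) =
            (?A - sc_moment j) * ?B + sc_moment j * (?B - sc_moment (l - j))"
          by (simp add: algebra_simps)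
        then have "\<bar>?A * ?B - sc_moment j * sc_moment (l - j)\<bar> \<le>
            \<bar>?A - sc_moment j\<bar> * \<bar>?B\<bar> + \<bar>sc_moment j\<bar> * \<bar>?B - sc_moment (l - j)\<bar>"
          by (metis abs_mult abs_triangle_ineq)
        also have "\<dots> \<le> D j / real b * (\<bar>sc_moment (l - j)\<bar> + D (l - j)) + \<bar>sc_moment j\<bar> * (D (l - j) / real b)"
          using A B B' D0[OF j] by (intro add_mono mult_mono mult_left_mono) auto
        finally show ?thesis by (simp add: add_divide_distrib)
      qed
      have "\<bar>(\<Sum>j\<le>l. ?U j) - sc_moment k\<bar>
        = \<bar>\<Sum>j\<le>l. ?U j - sc_moment j * sc_moment (l - j)\<bar>"
        unfolding 3 sc_moment_convolution by (simp add: sum_subtractf)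
      also have "\<dots> \<le> (\<Sum>j\<le>l. ?R j / real b)"
        by (rule order_trans[OF sum_abs]) (intro sum_mono term_le, simp)
      also have "\<dots> = (\<Sum>j\<le>l. ?R j) / real b"
        by (rule sum_divide_distrib[symmetric])
      finally show ?thesis
        using even_density_recursion[OF x, of l] unfolding K_def add_divide_distrib 3 by linarith
    qed
    then show ?thesis using K0 by blast
  qed
qed

section \<open>Parity of multiplicities and products of spins\<close>

lemma odd_edges_Cons:
  "odd_edges (e # es) = (if e \<in> odd_edges es then odd_edges es - {e} else insert e (odd_edges es))"
  by (auto simp: odd_edges_def)

lemma odd_edges_Nil [simp]: "odd_edges [] = {}"
  by (simp add: odd_edges_def)

lemma prod_list_spins:
  assumes "\<And>e. e \<in> set es \<Longrightarrow> y e \<in> {-1, 1 :: real}"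
  shows "prod_list (map y es) = (\<Prod>e\<in>odd_edges es. y e)"
  using assms
proof (induction es)
  case (Cons e es)
  have ye: "y e * y e = 1" using Cons.prems[of e] by auto
  have IH: "prod_list (map y es) = (\<Prod>e\<in>odd_edges es. y e)" using Cons by auto
  show ?case
  proof (cases "e \<in> odd_edges es")
    case True
    then have "(\<Prod>e\<in>odd_edges es. y e) = y e * (\<Prod>e\<in>odd_edges es - {e}. y e)"
      by (simp add: prod.remove)
    then show ?thesis using True ye IH by (simp add: odd_edges_Cons mult.assoc[symmetric])
  qed (use IH in \<open>simp add: odd_edges_Cons\<close>)
qed simp

lemma odd_edges_append_subset: "odd_edges (es @ fs) \<subseteq> odd_edges es \<union> odd_edges fs"
  by (auto simp: odd_edges_def)

text \<open>For edge-disjoint walks the numbers of odd edges add up; this is what makes their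
  conditional covariance vanish.\<close>

lemma odd_edges_append_disjoint:
  assumes "set es \<inter> set fs = {}"
  shows "odd_edges (es @ fs) = odd_edges es \<union> odd_edges fs" "odd_edges es \<inter> odd_edges fs = {}"
proof -
  have "e \<in> odd_edges (es @ fs)" if "e \<in> odd_edges es \<union> odd_edges fs" for e
  proof -
    have "e \<notin> set es \<or> e \<notin> set fs" using assms by blast
    then have "count_list es e = 0 \<or> count_list fs e = 0" by (auto simp: count_list_0_iff)
    then show ?thesis using that by (auto simp: odd_edges_def)
  qed
  then show "odd_edges (es @ fs) = odd_edges es \<union> odd_edges fs"
    using odd_edges_append_subset[of es fs] by blast
  show "odd_edges es \<inter> odd_edges fs = {}"
    using assms odd_edges_subset[of es] odd_edges_subset[of fs] by blast
qed

lemma card_odd_edges_le_length: "card (odd_edges es) \<le> length es"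
proof -
  have "card (odd_edges es) \<le> card (set es)" by (rule card_mono) (auto intro: subsetD[OF odd_edges_subset])
  also have "\<dots> \<le> length es" by (rule card_length)
  finally show ?thesis .
qed

lemma endpoints_in_walk: "ed u v \<in> set (edges x ys) \<Longrightarrow> u \<in> set (x # ys)"
  by (induction ys arbitrary: x) (auto simp: ed_eq_iff)

lemma walk_split_at:
  assumes "u \<in> set (x # ys)"
  obtains p r where "ys = p @ r" "last (x # p) = u"
proof (cases "u = x")
  case True
  then show ?thesis using that[of "[]" ys] by simp
next
  case False
  then obtain p r where "ys = p @ u # r" using assms by (auto dest: split_list)
  then show ?thesis using that[of "p @ [u]" r] by simp
qed

text \<open>The powers of \<open>q = sqrt b\<close> produced by the vertices are paid for by \<open>q * \<bar>\<mu>\<bar>\<close>, one factor per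
  odd edge.\<close>

lemma odd_power_le:
  fixes \<mu> :: real
  assumes "2 * v \<le> k + s" "s \<le> k" and b: "0 < b"
  shows "\<bar>\<mu>\<bar> ^ s \<le> (1 + sqrt (real b) * \<bar>\<mu>\<bar>) ^ k * sqrt (real b) ^ k * (1 / real b) ^ v"
proof -
  let ?q = "sqrt (real b)"
  have q: "1 \<le> ?q" using b by simp
  have "\<bar>\<mu>\<bar> ^ s * real b ^ v = \<bar>\<mu>\<bar> ^ s * ?q ^ (2 * v)"
    by (simp add: power_mult)
  also have "\<dots> \<le> \<bar>\<mu>\<bar> ^ s * ?q ^ (k + s)"
    using q assms by (intro mult_left_mono power_increasing) auto
  also have "\<dots> = (?q * \<bar>\<mu>\<bar>) ^ s * ?q ^ k" by (simp add: power_add power_mult_distrib)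
  also have "\<dots> \<le> (1 + ?q * \<bar>\<mu>\<bar>) ^ s * ?q ^ k"
    by (intro mult_right_mono power_mono) auto
  also have "\<dots> \<le> (1 + ?q * \<bar>\<mu>\<bar>) ^ k * ?q ^ k"
    using assms by (intro mult_right_mono power_increasing) auto
  finally have "\<bar>\<mu>\<bar> ^ s * real b ^ v \<le> (1 + ?q * \<bar>\<mu>\<bar>) ^ k * ?q ^ k" .
  then show ?thesis using b by (simp add: power_one_over field_simps)
qed

context band_graph
begin

definition walk_weight :: "(nat \<times> nat \<Rightarrow> real) \<Rightarrow> nat \<Rightarrow> nat list \<Rightarrow> real" where
  "walk_weight y x ys = prod_list (map y (edges x ys))"

definition trace_moment :: "nat \<Rightarrow> (nat \<times> nat \<Rightarrow> real) \<Rightarrow> real" where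
  "trace_moment k y = (\<Sum>x\<in>V. \<Sum>ys\<in>closed_walks k x. walk_weight y x ys) / (real (card V) * sqrt (real b) ^ k)"

definition even_mean :: "nat \<Rightarrow> real" where
  "even_mean k = (\<Sum>x\<in>V. even_density k x) / real (card V)"

definition odd_number :: "nat \<Rightarrow> nat list \<Rightarrow> nat" where
  "odd_number x ys = card (odd_edges (edges x ys))"

lemma edges_in_V: "x \<in> V \<Longrightarrow> walk x ys \<Longrightarrow> set (edges x ys) \<subseteq> {ed u v |u v. u \<in> V \<and> v \<in> V}"
proof (induction ys arbitrary: x)
  case (Cons z zs)
  then have z: "z \<in> V" using N_subset[of x] by auto
  have "ed x z \<in> {ed u v |u v. u \<in> V \<and> v \<in> V}" using z Cons.prems(1) by blast
  then show ?case using Cons.IH[OF z] Cons.prems(2) by simp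
qed auto

end

text \<open>\<open>I\<close> may exceed the set of edges: Curie-Weiss configurations live on the
  full square, edges are sorted pairs, and spins that no walk uses contribute a factor 1.\<close>

locale spin_band_graph = band_graph +
  fixes I :: "(nat \<times> nat) set" and t :: real
  assumes finite_I: "finite I" and ed_I: "x \<in> V \<Longrightarrow> y \<in> V \<Longrightarrow> ed x y \<in> I"
    and V_ne: "V \<noteq> {}"
begin

abbreviation "\<mu> \<equiv> tanh t"

lemma card_V_pos: "0 < card V"
  using V_ne by (simp add: card_gt_0_iff)

lemma walk_edges_I: "x \<in> V \<Longrightarrow> walk x ys \<Longrightarrow> set (edges x ys) \<subseteq> I"
  using edges_in_V ed_I by blast

lemma spin_mean_prod_list:
  assumes "set es \<subseteq> I"
  shows "spin_mean I t (\<lambda>y. prod_list (map y es)) = \<mu> ^ card (odd_edges es)"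
proof -
  have "spin_mean I t (\<lambda>y. prod_list (map y es)) = spin_mean I t (\<lambda>y. \<Prod>e\<in>odd_edges es. y e)"
    by (rule spin_mean_cong, rule prod_list_spins) (use assms in \<open>auto simp: PiE_iff\<close>)
  also have "\<dots> = \<mu> ^ card (odd_edges es)"
    by (rule spin_mean_prod[OF finite_I subset_trans[OF odd_edges_subset assms]])
  finally show ?thesis .
qed

lemma spin_mean_trace_moment:
  "spin_mean I t (trace_moment k) =
    (\<Sum>x\<in>V. \<Sum>ys\<in>closed_walks k x. \<mu> ^ odd_number x ys) / (real (card V) * sqrt (real b) ^ k)"
proof -
  have "spin_mean I t (trace_moment k) =
      1 / (real (card V) * sqrt (real b) ^ k) * (\<Sum>x\<in>V. \<Sum>ys\<in>closed_walks k x. spin_mean I t (\<lambda>y. walk_weight y x ys))"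
    unfolding trace_moment_def spin_mean_sum[symmetric] spin_mean_cmult[symmetric] by simp
  also have "(\<Sum>x\<in>V. \<Sum>ys\<in>closed_walks k x. spin_mean I t (\<lambda>y. walk_weight y x ys)) =
      (\<Sum>x\<in>V. \<Sum>ys\<in>closed_walks k x. \<mu> ^ odd_number x ys)"
    unfolding walk_weight_def odd_number_def
    by (intro sum.cong refl spin_mean_prod_list walk_edges_I) (auto simp: closed_walks_def walks_def)
  finally show ?thesis by simp
qed

text \<open>Only walks with an odd edge enter the difference. The bound is left growing with
  \<open>sqrt b * \<bar>\<mu>\<bar>\<close>, to be controlled later by the moments of the
  field.\<close>

lemma spin_mean_trace_moment_close:
  "\<bar>spin_mean I t (trace_moment k) - even_mean k\<bar> \<le> fact (k + 1) / real b * (1 + sqrt (real b) * \<bar>\<mu>\<bar>) ^ k"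
proof -
  let ?q = "sqrt (real b)" and ?M = "(1 + sqrt (real b) * \<bar>\<mu>\<bar>) ^ k"
  let ?n = "real (card V)"
  have pos: "0 < ?n" "0 < ?q" using card_V_pos b_pos by auto
  have each: "\<bar>(\<Sum>ys\<in>closed_walks k x. \<mu> ^ odd_number x ys) - real (card (even_walks k x))\<bar>
      \<le> ?M * ?q ^ k * (fact (k + 1) / real b)" if x: "x \<in> V" for x
  proof -
    have ev: "even_walks k x = closed_walks k x \<inter> {ys. odd_number x ys = 0}"
      by (auto simp: even_walks_def odd_number_def)
    have "real (card (even_walks k x)) = (\<Sum>ys\<in>closed_walks k x. if odd_number x ys = 0 then 1 else 0)"
      using x unfolding ev by (simp add: sum.If_cases)
    then have "\<bar>(\<Sum>ys\<in>closed_walks k x. \<mu> ^ odd_number x ys) - real (card (even_walks k x))\<bar> =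
        \<bar>\<Sum>ys\<in>closed_walks k x. \<mu> ^ odd_number x ys - (if odd_number x ys = 0 then 1 else 0)\<bar>"
      by (simp add: sum_subtractf)
    also have "\<dots> \<le> (\<Sum>ys\<in>closed_walks k x. ?M * ?q ^ k * (1 / real b) ^ card (set (x # ys)))"
    proof (rule order_trans[OF sum_abs], rule sum_mono)
      fix ys assume ys: "ys \<in> closed_walks k x"
      have len: "length ys = k" and cl: "last (x # ys) = x" using ys by (auto simp: closed_walks_def walks_def)
      show "\<bar>\<mu> ^ odd_number x ys - (if odd_number x ys = 0 then 1 else 0)\<bar> \<le> ?M * ?q ^ k * (1 / real b) ^ card (set (x # ys))"
      proof (cases "odd_number x ys = 0")
        case False
        then have "odd_edges (edges x ys) \<noteq> {}" by (auto simp: odd_number_def)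
        then have "2 * card (set (x # ys)) \<le> k + odd_number x ys"
          using two_card_vertices_le_if_odd_subwalk[OF cl _ order_refl] len unfolding odd_number_def by blast
        moreover have "odd_number x ys \<le> k"
          using card_odd_edges_le_length[of "edges x ys"] len by (simp add: odd_number_def)
        ultimately have "\<bar>\<mu>\<bar> ^ odd_number x ys \<le> ?M * ?q ^ k * (1 / real b) ^ card (set (x # ys))"
          by (rule odd_power_le[OF _ _ b_pos])
        then show ?thesis using False by (simp add: power_abs)
      qed simp
    qed
    also have "\<dots> = ?M * ?q ^ k * (\<Sum>ys\<in>closed_walks k x. (1 / real b) ^ card (set (x # ys)))"
      by (simp only: sum_distrib_left)
    also have "\<dots> \<le> ?M * ?q ^ k * (\<Sum>ys\<in>walks k x. (1 / real b) ^ card (set (x # ys)))"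
      using x by (intro mult_left_mono sum_mono2) (auto simp: closed_walks_def)
    also have "\<dots> \<le> ?M * ?q ^ k * (fact (k + 1) / real b)"
      by (intro mult_left_mono sum_walks_inverse_power_le x) auto
    finally show ?thesis .
  qed
  have em: "even_mean k = (\<Sum>x\<in>V. real (card (even_walks k x))) / (?n * ?q ^ k)"
    by (simp add: even_mean_def even_density_def sum_divide_distrib mult.commute)
  have "\<bar>spin_mean I t (trace_moment k) - even_mean k\<bar> =
      \<bar>\<Sum>x\<in>V. (\<Sum>ys\<in>closed_walks k x. \<mu> ^ odd_number x ys) - real (card (even_walks k x))\<bar> / (?n * ?q ^ k)"
    using pos unfolding spin_mean_trace_moment em
    by (simp add: sum_subtractf diff_divide_distrib[symmetric] abs_divide)
  also have "\<dots> \<le> (\<Sum>x\<in>V. ?M * ?q ^ k * (fact (k + 1) / real b)) / (?n * ?q ^ k)"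
    using pos by (intro divide_right_mono order_trans[OF sum_abs] sum_mono each) auto
  also have "\<dots> = fact (k + 1) / real b * ?M"
    using pos V_ne by simp
  finally show ?thesis .
qed

section \<open>Pairs of closed walks and the conditional variance\<close>

definition rooted :: "nat \<Rightarrow> (nat \<times> nat list) set" where
  "rooted k = Sigma V (closed_walks k)"

lemma finite_rooted [simp]: "finite (rooted k)"
  unfolding rooted_def by (rule finite_SigmaI) auto

definition pair_edges :: "(nat \<times> nat list) \<times> (nat \<times> nat list) \<Rightarrow> (nat \<times> nat) list" where
  "pair_edges p = edges (fst (fst p)) (snd (fst p)) @ edges (fst (snd p)) (snd (snd p))"

text \<open>Decodes \<open>us = r @ p @ r' @ p'\<close>, both walks being rotated to
  \<open>u\<close>; \<open>i\<close> and \<open>j\<close> are the lengths of \<open>p\<close> and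
  \<open>p'\<close>. The roots reappear as the ends of \<open>r\<close> and \<open>r'\<close>, so a
  glued walk stands for at most \<open>(k + 1)\<^sup>2\<close> pairs.\<close>

definition unglue :: "nat \<Rightarrow> nat \<times> nat \<times> nat \<times> nat list \<Rightarrow> (nat \<times> nat list) \<times> (nat \<times> nat list)" where
  "unglue k = (\<lambda>(i, j, u, us).
     let r = take (k - i) us; p = take i (drop (k - i) us);
         r' = take (k - j) (drop k us); p' = drop (k - j) (drop k us)
     in ((last (u # r), p @ r), (last (u # r'), p' @ r')))"

text \<open>Two closed walks with a common edge are rotated to a common base point and concatenated
  to a closed walk of length \<open>2 k\<close>, which then has at most \<open>k + s / 2\<close> vertices when \<open>s\<close> edges are
  odd.\<close>

lemma glue:
  assumes p: "(x, ys) \<in> rooted k" "(x', ys') \<in> rooted k"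
    and share: "set (edges x ys) \<inter> set (edges x' ys') \<noteq> {}"
  obtains i j u us where "i \<le> k" "j \<le> k" "u \<in> V" "us \<in> walks (2 * k) u"
    "unglue k (i, j, u, us) = ((x, ys), (x', ys'))"
    "2 * card (set (u # us)) \<le> 2 * k + card (odd_edges (edges x ys @ edges x' ys'))"
proof -
  obtain e where e: "e \<in> set (edges x ys)" "e \<in> set (edges x' ys')" using share by blast
  then obtain u v where uv: "e = ed u v" using edge_exists by blast
  have u: "u \<in> set (x # ys)" "u \<in> set (x' # ys')" using e uv endpoints_in_walk by blast+
  obtain p r where pr: "ys = p @ r" "last (x # p) = u" using walk_split_at[OF u(1)] by blast
  obtain p' r' where pr': "ys' = p' @ r'" "last (x' # p') = u" using walk_split_at[OF u(2)] by blast
  have w: "x \<in> V" "walk x ys" "length ys = k" "last (x # ys) = x"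
    and w': "x' \<in> V" "walk x' ys'" "length ys' = k" "last (x' # ys') = x'"
    using p by (auto simp: rooted_def closed_walks_def walks_def)
  have lr: "last (u # r) = x" using w(4) pr by (auto split: if_splits)
  have lr': "last (u # r') = x'" using w'(4) pr' by (auto split: if_splits)
  define us where "us = r @ p @ r' @ p'"
  have uV: "u \<in> V" using walk_subset[OF w(1,2)] u(1) by blast
  have seg: "walk x p" "walk u r" "walk x' p'" "walk u r'"
    using w(2) w'(2) pr pr' unfolding pr(1) pr'(1) walk_append pr(2) pr'(2) by auto
  have "walk u us"
    unfolding us_def walk_append lr pr(2) lr' using seg by simp
  moreover have len: "length p + length r = k" "length p' + length r' = k"
    using w(3) w'(3) pr(1) pr'(1) by auto
  ultimately have us: "us \<in> walks (2 * k) u"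
    by (simp add: walks_def us_def)
  have eu: "edges u us = edges u r @ edges x p @ edges u r' @ edges x' p'"
    unfolding us_def edges_append lr pr(2) lr' by simp
  have ey: "edges x ys = edges x p @ edges u r" "edges x' ys' = edges x' p' @ edges u r'"
    unfolding pr(1) pr'(1) edges_append pr(2) pr'(2) by auto
  have cnt: "count_list (edges u us) f = count_list (edges x ys) f + count_list (edges x' ys') f" for f
    unfolding eu ey by simp
  have odd_eq: "odd_edges (edges u us) = odd_edges (edges x ys @ edges x' ys')"
    unfolding odd_edges_def cnt count_list_append ..
  have sub: "set (edges x ys) \<subseteq> set (edges u us)" unfolding eu ey by auto
  have "2 * card (set (u # us)) \<le> length us + card (odd_edges (edges u us))"
  proof (cases "odd_edges (edges x ys) = {}")
    case False
    then show ?thesis using two_card_vertices_le_if_odd_subwalk[OF w(4) _ sub] by blast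
  next
    case True
    \<comment> \<open>The first walk, being even, uses the common edge at least twice, and the
      second walk uses it once more.\<close>
    have "even (count_list (edges x ys) e)" by (rule even_count_if_odd_edges_empty[OF True])
    moreover have "count_list (edges x ys) e \<noteq> 0" "count_list (edges x' ys') e \<noteq> 0"
      using e by (auto simp: count_list_0_iff)
    ultimately have "3 \<le> count_list (edges u us) e" unfolding cnt by presburger
    then show ?thesis by (rule two_card_vertices_le_if_triple)
  qed
  moreover have "length us = 2 * k" using len by (simp add: us_def)
  ultimately have "2 * card (set (u # us)) \<le> 2 * k + card (odd_edges (edges x ys @ edges x' ys'))"
    by (simp only: odd_eq)
  moreover have "unglue k (length p, length p', u, us) = ((x, ys), (x', ys'))"
  proof -
    have "k - length p = length r" "k - length p' = length r'" "drop k us = r' @ p'"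
      using len by (auto simp: us_def)
    moreover from this have "take (k - length p) us = r" "take (length p) (drop (k - length p) us) = p"
      by (simp_all add: us_def)
    ultimately show ?thesis
      by (simp add: unglue_def lr lr' pr(1) pr'(1) del: last.simps drop_drop)
  qed
  ultimately show thesis
    using that[of "length p" "length p'" u us] len uV us by simp
qed

text \<open>Pairs without a common edge have covariance zero. For the others, with \<open>s\<close>
  odd edges in the pair, both terms of the covariance are at most
  \<open>\<bar>\<mu>\<bar> ^ s\<close> in absolute value, whence the 2; choosing the cut positions
  costs \<open>(k + 1)\<^sup>2\<close>. One base point in place of two roots leaves
  \<open>1 / n\<close>, and the weighted walk count gives \<open>1 / b\<close>.\<close>

lemma spin_variance_trace_moment:
  "spin_mean I t (\<lambda>y. (trace_moment k y - spin_mean I t (trace_moment k))\<^sup>2) \<le>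
     2 * (real (k + 1))\<^sup>2 * fact (2 * k + 1) / (real (card V) * real b) * (1 + sqrt (real b) * \<bar>\<mu>\<bar>) ^ (2 * k)"
proof -
  let ?q = "sqrt (real b)" and ?M = "(1 + sqrt (real b) * \<bar>\<mu>\<bar>) ^ (2 * k)"
  let ?n = "real (card V)"
  let ?g = "spin_mean I t (trace_moment k)"
  let ?P = "rooted k \<times> rooted k"
  let ?h = "\<lambda>u us. 2 * (?M * ?q ^ (2 * k) * (1 / real b) ^ card (set (u # us)))"
  let ?Z = "{..k} \<times> {..k} \<times> Sigma V (walks (2 * k))"
  define \<epsilon> where "\<epsilon> p = \<mu> ^ card (odd_edges (pair_edges p)) -
    \<mu> ^ odd_number (fst (fst p)) (snd (fst p)) * \<mu> ^ odd_number (fst (snd p)) (snd (snd p))" for p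
  have pos: "0 < ?n" "0 < ?q" using card_V_pos b_pos by auto
  have mu1: "\<bar>\<mu>\<bar> \<le> 1" using tanh_real_bounds[of t] by auto
  let ?c = "1 / (?n * ?q ^ k)"
  have T: "trace_moment k y = ?c * (\<Sum>p\<in>rooted k. walk_weight y (fst p) (snd p))" for y
    unfolding trace_moment_def rooted_def by (subst sum.Sigma) (auto simp: case_prod_unfold)
  have g: "?g = ?c * (\<Sum>p\<in>rooted k. \<mu> ^ odd_number (fst p) (snd p))"
    unfolding spin_mean_trace_moment rooted_def by (subst sum.Sigma) (auto simp: case_prod_unfold)
  have "spin_mean I t (\<lambda>y. (trace_moment k y - ?g)\<^sup>2) = spin_mean I t (\<lambda>y. trace_moment k y * trace_moment k y) - ?g * ?g"
  proof -
    have "spin_mean I t (\<lambda>y. (trace_moment k y - ?g)\<^sup>2) =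
        spin_mean I t (\<lambda>y. (trace_moment k y * trace_moment k y - (2 * ?g) * trace_moment k y) + ?g * ?g)"
      by (simp add: power2_eq_square algebra_simps)
    also have "\<dots> = spin_mean I t (\<lambda>y. trace_moment k y * trace_moment k y) - 2 * ?g * ?g + ?g * ?g"
      by (simp only: spin_mean_add spin_mean_diff spin_mean_cmult spin_mean_const[OF finite_I])
    finally show ?thesis by simp
  qed
  also have "spin_mean I t (\<lambda>y. trace_moment k y * trace_moment k y) =
      ?c * ?c * (\<Sum>p\<in>?P. \<mu> ^ card (odd_edges (pair_edges p)))"
  proof -
    have "trace_moment k y * trace_moment k y = ?c * ?c * (\<Sum>p\<in>?P. prod_list (map y (pair_edges p)))" for y
      unfolding T by (simp add: sum_product sum.cartesian_product case_prod_unfold walk_weight_def pair_edges_def mult_ac)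
    moreover have "spin_mean I t (\<lambda>y. prod_list (map y (pair_edges p))) = \<mu> ^ card (odd_edges (pair_edges p))"
      if "p \<in> ?P" for p
    proof (rule spin_mean_prod_list)
      have "fst (fst p) \<in> V" "walk (fst (fst p)) (snd (fst p))" "fst (snd p) \<in> V" "walk (fst (snd p)) (snd (snd p))"
        using that by (auto simp: rooted_def closed_walks_def walks_def)
      then show "set (pair_edges p) \<subseteq> I"
        using walk_edges_I by (simp add: pair_edges_def)
    qed
    ultimately show ?thesis by (simp only: spin_mean_cmult spin_mean_sum) (simp cong: sum.cong)
  qed
  also have "?g * ?g = ?c * ?c * (\<Sum>p\<in>?P. \<mu> ^ odd_number (fst (fst p)) (snd (fst p)) * \<mu> ^ odd_number (fst (snd p)) (snd (snd p)))"
    unfolding g by (simp add: sum_product sum.cartesian_product case_prod_unfold mult_ac)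
  also have "?c * ?c * (\<Sum>p\<in>?P. \<mu> ^ card (odd_edges (pair_edges p))) - \<dots> = ?c * ?c * (\<Sum>p\<in>?P. \<epsilon> p)"
    by (simp only: \<epsilon>_def sum_subtractf right_diff_distrib)
  also have "(\<Sum>p\<in>?P. \<epsilon> p) \<le> (\<Sum>z\<in>?Z.
      case z of (i, j, u, us) \<Rightarrow> ?h u us)"
  proof -
    define S where "S = {p \<in> ?P. set (edges (fst (fst p)) (snd (fst p))) \<inter> set (edges (fst (snd p)) (snd (snd p))) \<noteq> {}}"
    have "(\<Sum>p\<in>?P. \<epsilon> p) = (\<Sum>p\<in>S. \<epsilon> p)"
    proof (rule sum.mono_neutral_right)
      show "\<forall>p\<in>?P - S. \<epsilon> p = 0"
        by (auto simp: S_def \<epsilon>_def pair_edges_def odd_number_def odd_edges_append_disjoint card_Un_disjoint power_add)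
    qed (auto simp: S_def)
    also have "\<dots> \<le> (\<Sum>z\<in>?Z.
      case z of (i, j, u, us) \<Rightarrow> ?h u us)"
    \<comment> \<open>Covering suffices: every pair is the image of some tuple whose term dominates
      its covariance, and the remaining terms are nonnegative.\<close>
    proof (rule sum_le_included[where i = "unglue k"])
      show "\<forall>p\<in>S. \<exists>z\<in>?Z. unglue k z = p \<and>
        \<epsilon> p \<le> (case z of (i, j, u, us) \<Rightarrow> ?h u us)"
      proof
        fix p assume pS: "p \<in> S"
        obtain x ys x' ys' where pp: "p = ((x, ys), (x', ys'))" by (metis surj_pair)
        obtain i j u us where gl: "i \<le> k" "j \<le> k" "u \<in> V" "us \<in> walks (2 * k) u"
          "unglue k (i, j, u, us) = ((x, ys), (x', ys'))"
          "2 * card (set (u # us)) \<le> 2 * k + card (odd_edges (edges x ys @ edges x' ys'))"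
          by (rule glue[of x ys k x' ys']) (use pS in \<open>auto simp: S_def pp\<close>)
        let ?s = "card (odd_edges (edges x ys @ edges x' ys'))"
        have len: "length ys = k" "length ys' = k"
          using pS by (auto simp: S_def pp rooted_def closed_walks_def walks_def)
        have s2k: "?s \<le> 2 * k" using card_odd_edges_le_length[of "edges x ys @ edges x' ys'"] len by simp
        have "?s \<le> card (odd_edges (edges x ys) \<union> odd_edges (edges x' ys'))"
          by (rule card_mono[OF _ odd_edges_append_subset]) simp
        also have "\<dots> \<le> odd_number x ys + odd_number x' ys'"
          unfolding odd_number_def by (rule card_Un_le)
        finally have "\<bar>\<mu>\<bar> ^ (odd_number x ys + odd_number x' ys') \<le> \<bar>\<mu>\<bar> ^ ?s"
          using mu1 by (intro power_decreasing) auto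
        then have "\<epsilon> p \<le> 2 * \<bar>\<mu>\<bar> ^ ?s"
          using abs_ge_self[of "\<mu> ^ ?s"] abs_ge_minus_self[of "\<mu> ^ (odd_number x ys + odd_number x' ys')"]
          unfolding power_abs by (simp add: \<epsilon>_def pp pair_edges_def power_add)
        also have "\<dots> \<le> 2 * (?M * ?q ^ (2 * k) * (1 / real b) ^ card (set (u # us)))"
          by (intro mult_left_mono odd_power_le[OF gl(6) s2k b_pos]) simp
        finally show "\<exists>z\<in>?Z. unglue k z = p \<and>
          \<epsilon> p \<le> (case z of (i, j, u, us) \<Rightarrow> ?h u us)"
          using gl by (intro bexI[of _ "(i, j, u, us)"]) (auto simp: pp)
      qed
    qed (auto simp: S_def intro!: finite_SigmaI)
    finally show ?thesis .
  qed
  also have "(\<Sum>z\<in>?Z.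
      case z of (i, j, u, us) \<Rightarrow> ?h u us) =
      real (k + 1) * (real (k + 1) * (\<Sum>u\<in>V. \<Sum>us\<in>walks (2 * k) u. ?h u us))"
  proof -
    have const: "(\<Sum>z\<in>{..k} \<times> S. H (snd z)) = real (k + 1) * (\<Sum>z\<in>S. H z)" for H :: "'s \<Rightarrow> real" and S
      using sum.cartesian_product[of "\<lambda>_. H" S "{..k}", symmetric] by (simp add: case_prod_unfold)
    have "(\<Sum>z\<in>{..k} \<times> {..k} \<times> Sigma V (walks (2 * k)). case z of (i, j, u, us) \<Rightarrow> ?h u us) =
        real (k + 1) * (real (k + 1) * (\<Sum>z\<in>Sigma V (walks (2 * k)). ?h (fst z) (snd z)))"
      using const[of "\<lambda>z. ?h (fst (snd z)) (snd (snd z))" "{..k} \<times> Sigma V (walks (2 * k))"]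
        const[of "\<lambda>z. ?h (fst z) (snd z)" "Sigma V (walks (2 * k))"]
      by (simp only: case_prod_unfold)
    also have "(\<Sum>z\<in>Sigma V (walks (2 * k)). ?h (fst z) (snd z)) = (\<Sum>u\<in>V. \<Sum>us\<in>walks (2 * k) u. ?h u us)"
      by (subst sum.Sigma) (auto simp: case_prod_unfold)
    finally show ?thesis .
  qed
  also have "\<dots> \<le> real (k + 1) * (real (k + 1) * (\<Sum>u\<in>V. 2 * (?M * ?q ^ (2 * k)) * (fact (2 * k + 1) / real b)))"
  proof (intro mult_left_mono sum_mono)
    fix u assume u: "u \<in> V"
    have "(\<Sum>us\<in>walks (2 * k) u. ?h u us) =
        2 * (?M * ?q ^ (2 * k)) * (\<Sum>us\<in>walks (2 * k) u. (1 / real b) ^ card (set (u # us)))"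
      by (simp only: sum_distrib_left mult.assoc)
    also have "\<dots> \<le> 2 * (?M * ?q ^ (2 * k)) * (fact (2 * k + 1) / real b)"
      by (intro mult_left_mono sum_walks_inverse_power_le u) simp
    finally show "(\<Sum>us\<in>walks (2 * k) u. ?h u us)
        \<le> 2 * (?M * ?q ^ (2 * k)) * (fact (2 * k + 1) / real b)" .
  qed auto
  also have "?c * ?c * (real (k + 1) * (real (k + 1) * (\<Sum>u\<in>V. 2 * (?M * ?q ^ (2 * k)) * (fact (2 * k + 1) / real b)))) =
      2 * (real (k + 1))\<^sup>2 * fact (2 * k + 1) / (?n * real b) * ?M"
  proof -
    have q: "?q ^ (2 * k) = ?q ^ k * ?q ^ k" by (simp add: mult_2 power_add)
    have Q: "0 < ?q ^ k" using pos(2) by simp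
    have "1 / (n * Q) * (1 / (n * Q)) * (a * (a * (n * (2 * (m * (Q * Q)) * (f / b'))))) = 2 * a\<^sup>2 * f / (n * b') * m"
      if "0 < n" "0 < Q" "0 < b'" for n Q a m f b' :: real
      using that by (simp add: field_simps power2_eq_square)
    from this[of ?n "?q ^ k" "real b" "real (k + 1)" ?M "fact (2 * k + 1)"] pos Q b_pos
    show ?thesis unfolding q by simp
  qed
  also
  note mean_sq = calculation
  \<comment> \<open>The inequalities were used below the factor \<open>?c * ?c\<close>; the
    calculation has kept monotonicity in that position as premises.\<close>
  show ?thesis by (rule mean_sq) (auto intro!: divide_right_mono)
qed

end

subsection \<open>Band matrices\<close>

lemma relevant_sym: "relevant n b i j \<longleftrightarrow> relevant n b j i"
  by (simp add: relevant_def abs_minus_commute)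

lemma relevant_odd_iff:
  assumes "2 * h + 1 < n"
  shows "relevant n (2 * h + 1) i j \<longleftrightarrow> (i \<le> j + h \<and> j \<le> i + h) \<or> n + j \<le> i + h \<or> n + i \<le> j + h"
proof -
  have "(real (2 * h + 1) - 1) / 2 = real h" by simp
  moreover have "\<bar>real i - real j\<bar> \<le> real h \<longleftrightarrow> i \<le> j + h \<and> j \<le> i + h"
    by (auto simp: abs_le_iff)
  moreover have "real n - real h \<le> \<bar>real i - real j\<bar> \<longleftrightarrow> n + j \<le> i + h \<or> n + i \<le> j + h"
    using assms by (cases "i \<le> j") auto
  ultimately show ?thesis using assms by (simp only: relevant_def) auto
qed

text \<open>The window of half-width \<open>h\<close> wraps below 1, stays inside, or wraps above
  \<open>n\<close>. As \<open>2 * h + 1 < n\<close>, the wrapped piece is disjoint from the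
  rest.\<close>

lemma card_relevant:
  assumes b: "bandwidth n b" and i: "i \<in> {1..n}"
  shows "card {j \<in> {1..n}. relevant n b i j} = b"
proof (cases "b = n")
  case True
  then have "{j \<in> {1..n}. relevant n b i j} = {1..n}" by (auto simp: relevant_def)
  then show ?thesis using True by simp
next
  case False
  then have "odd b" "b < n" using b by (auto simp: bandwidth_def)
  then obtain h where h: "b = 2 * h + 1" "2 * h + 1 < n" by (auto elim!: oddE)
  have eq: "{j \<in> {1..n}. relevant n b i j} =
      {j \<in> {1..n}. (i \<le> j + h \<and> j \<le> i + h) \<or> n + j \<le> i + h \<or> n + i \<le> j + h}"
    unfolding h(1) relevant_odd_iff[OF h(2)] ..
  consider "i \<le> h" | "h < i" "i + h \<le> n" | "n < i + h" by linarith
  then show ?thesis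
  proof cases
    case 1
    then have "{j \<in> {1..n}. relevant n b i j} = {1..i + h} \<union> {n + i - h..n}"
      unfolding eq using h i by auto
    also have "card \<dots> = card {1..i + h} + card {n + i - h..n}"
      using h by (intro card_Un_disjoint) auto
    finally show ?thesis using 1 h i by simp
  next
    case 2
    then have "{j \<in> {1..n}. relevant n b i j} = {i - h..i + h}"
      unfolding eq using h i by auto
    then show ?thesis using 2 h by simp
  next
    case 3
    then have "{j \<in> {1..n}. relevant n b i j} = {i - h..n} \<union> {1..i + h - n}"
      unfolding eq using h i by auto
    also have "card \<dots> = card {i - h..n} + card {1..i + h - n}"
      using h i 3 by (intro card_Un_disjoint) auto
    finally show ?thesis using 3 h i by simp
  qed
qed

lemma band_graph_relevant:
  assumes "1 \<le> n" "bandwidth n b"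
  shows "band_graph {1..n} (\<lambda>i. {j \<in> {1..n}. relevant n b i j}) b"
proof
  show "0 < b" using assms by (auto simp: bandwidth_def)
qed (use card_relevant[OF assms(2)] relevant_sym in auto)

text \<open>The recursion multiplies from the right, matching the extension of walks at the end; it
  needs all entries, while the trace will use the diagonal.\<close>

lemma mat_pow_walks:
  assumes g: "band_graph {1..n} N b" and i: "i < n" and j: "j < n"
    and A: "A = Matrix.mat n n (\<lambda>(i, j). if j + 1 \<in> N (i + 1) then c * y (ed (i + 1) (j + 1)) else 0)"
  shows "(A ^\<^sub>m k) $$ (i, j) = c ^ k *
    (\<Sum>ys\<in>band_graph.walks N k (i + 1). if last ((i + 1) # ys) = j + 1 then band_graph.walk_weight y (i + 1) ys else 0)"
  using j
proof (induction k arbitrary: j)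
  case 0
  interpret band_graph "{1..n}" N b by (rule g)
  show ?case using i 0 by (auto simp: A walk_weight_def)
next
  case (Suc k)
  interpret band_graph "{1..n}" N b by (rule g)
  have x: "i + 1 \<in> {1..n}" using i by simp
  have Ac: "A \<in> carrier_mat n n" by (simp add: A)
  let ?l = "\<lambda>ys. last ((i + 1) # ys)" and ?w = "walk_weight y (i + 1)"
  have last_in: "?l ys \<in> {1..n}" if "ys \<in> walks k (i + 1)" for ys
    using walk_last[OF x, of ys] that by (simp only: walks_def mem_Collect_eq)
  have ww: "?w (ys @ [v]) = ?w ys * y (ed (?l ys) v)" for ys v
    by (simp add: walk_weight_def edges_append)
  have "(A ^\<^sub>m Suc k) $$ (i, j) = (\<Sum>m<n. (A ^\<^sub>m k) $$ (i, m) * A $$ (m, j))"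
    using i Suc.prems Ac by (auto simp: scalar_prod_def atLeast0LessThan intro!: sum.cong)
  also have "\<dots> = (\<Sum>m<n. c ^ k * (\<Sum>ys\<in>walks k (i + 1). if ?l ys = m + 1 then ?w ys else 0) *
      (if j + 1 \<in> N (m + 1) then c * y (ed (m + 1) (j + 1)) else 0))"
    using Suc by (intro sum.cong refl) (auto simp: A)
  also have "\<dots> = (\<Sum>ys\<in>walks k (i + 1). \<Sum>m<n. if ?l ys = m + 1 then
      c ^ Suc k * (if j + 1 \<in> N (m + 1) then ?w ys * y (ed (m + 1) (j + 1)) else 0) else 0)"
    unfolding sum_distrib_left sum_distrib_right
    by (subst sum.swap) (intro sum.cong refl, auto)
  also have "\<dots> = (\<Sum>ys\<in>walks k (i + 1). c ^ Suc k * (if j + 1 \<in> N (?l ys) then ?w (ys @ [j + 1]) else 0))"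
  proof (rule sum.cong[OF refl])
    fix ys assume ys: "ys \<in> walks k (i + 1)"
    define m where "m = ?l ys - 1"
    have m: "?l ys = m + 1" "m < n" using last_in[OF ys] by (auto simp: m_def simp del: last.simps)
    have "(\<Sum>m'<n. if ?l ys = m' + 1 then
        c ^ Suc k * (if j + 1 \<in> N (m' + 1) then ?w ys * y (ed (m' + 1) (j + 1)) else 0) else 0) =
      (\<Sum>m'\<in>{m}. c ^ Suc k * (if j + 1 \<in> N (m' + 1) then ?w ys * y (ed (m' + 1) (j + 1)) else 0))"
      by (rule sum.mono_neutral_cong_right) (use m in auto)
    then show "(\<Sum>m'<n. if ?l ys = m' + 1 then
        c ^ Suc k * (if j + 1 \<in> N (m' + 1) then ?w ys * y (ed (m' + 1) (j + 1)) else 0) else 0) =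
      c ^ Suc k * (if j + 1 \<in> N (?l ys) then ?w (ys @ [j + 1]) else 0)"
      unfolding ww m(1) by simp
  qed
  also have "\<dots> = c ^ Suc k * (\<Sum>ys\<in>walks k (i + 1). \<Sum>v\<in>N (?l ys). if v = j + 1 then ?w (ys @ [v]) else 0)"
    unfolding sum_distrib_left[symmetric]
    by (intro arg_cong2[of _ _ _ _ "(*)"] refl sum.cong) (use finite_N last_in in \<open>simp add: sum.delta\<close>)
  also have "(\<Sum>ys\<in>walks k (i + 1). \<Sum>v\<in>N (?l ys). if v = j + 1 then ?w (ys @ [v]) else 0) =
      (\<Sum>ys\<in>walks (Suc k) (i + 1). if ?l ys = j + 1 then ?w ys else 0)"
    unfolding sum_walks_snoc[OF x] by (intro sum.cong refl) simp
  finally show ?case .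
qed

lemma mat_trace_pow_walks:
  assumes g: "band_graph {1..n} N b" and n: "1 \<le> n"
    and A: "A = Matrix.mat n n (\<lambda>(i, j). if j + 1 \<in> N (i + 1)
      then real b powr (- 1 / 2) * y (ed (i + 1) (j + 1)) else 0)"
  shows "mat_trace (A ^\<^sub>m k) / real n = band_graph.trace_moment {1..n} N b k y"
proof -
  interpret band_graph "{1..n}" N b by (rule g)
  let ?c = "real b powr (- 1 / 2)"
  have c: "?c = 1 / sqrt (real b)"
    using b_pos by (simp add: powr_minus_divide powr_half_sqrt[symmetric])
  have "mat_trace (A ^\<^sub>m k) = (\<Sum>i<n. ?c ^ k * (\<Sum>ys\<in>closed_walks k (i + 1). walk_weight y (i + 1) ys))"
    unfolding mat_trace_def
  proof (rule sum.cong)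
    fix i assume "i \<in> {..<n}"
    then have i: "i < n" by simp
    then have fin: "finite (walks k (i + 1))" by (intro finite_walks) simp
    have "(\<Sum>ys\<in>walks k (i + 1). if last ((i + 1) # ys) = i + 1 then walk_weight y (i + 1) ys else 0) =
        (\<Sum>ys\<in>closed_walks k (i + 1). walk_weight y (i + 1) ys)"
      unfolding closed_walks_def using fin by (rule sum.inter_filter[symmetric])
    then show "(A ^\<^sub>m k) $$ (i, i) = ?c ^ k * (\<Sum>ys\<in>closed_walks k (i + 1). walk_weight y (i + 1) ys)"
      using mat_pow_walks[OF g i i A, of k] by (simp only:)
  qed (simp add: A)
  also have "\<dots> = ?c ^ k * (\<Sum>i<n. \<Sum>ys\<in>closed_walks k (i + 1). walk_weight y (i + 1) ys)"
    by (simp add: sum_distrib_left)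
  also have "(\<Sum>i<n. \<Sum>ys\<in>closed_walks k (i + 1). walk_weight y (i + 1) ys) =
      (\<Sum>x\<in>{1..n}. \<Sum>ys\<in>closed_walks k x. walk_weight y x ys)"
    by (rule sum.reindex_bij_witness[of _ "\<lambda>x. x - 1" "\<lambda>i. i + 1"]) auto
  finally show ?thesis
    unfolding trace_moment_def c by (simp add: power_one_over)
qed

text \<open>A third of the tolerance each goes to the fluctuation \<open>T - g\<close>, the
  conditional mean \<open>g - g0\<close> and the bias \<open>g0 - c\<close>, the last being bounded
  by assumption. The powers differ because \<open>g - g0\<close> will be of order
  \<open>1 / b\<close>, while the conditional variance is already of order
  \<open>1 / (n * b)\<close>.\<close>

lemma indicator_deviation_le:
  fixes \<epsilon> :: real
  assumes "0 < \<epsilon>" "\<bar>g0 - c\<bar> \<le> \<epsilon>"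
  shows "(if \<bar>T - c\<bar> > 3 * \<epsilon> then 1 else 0) \<le> 1 / \<epsilon>\<^sup>2 * (T - g)\<^sup>2 + (\<bar>g - g0\<bar> / \<epsilon>) ^ 4"
proof (cases "\<bar>T - c\<bar> > 3 * \<epsilon>")
  case True
  then consider "\<epsilon> \<le> \<bar>T - g\<bar>" | "\<epsilon> \<le> \<bar>g - g0\<bar>" using assms by linarith
  then have "1 \<le> 1 / \<epsilon>\<^sup>2 * (T - g)\<^sup>2 + (\<bar>g - g0\<bar> / \<epsilon>) ^ 4"
  proof cases
    case 1
    then have "\<epsilon>\<^sup>2 \<le> \<bar>T - g\<bar>\<^sup>2" using assms by (intro power_mono) auto
    then have "1 \<le> 1 / \<epsilon>\<^sup>2 * (T - g)\<^sup>2" using assms by simp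
    moreover have "0 \<le> (\<bar>g - g0\<bar> / \<epsilon>) ^ 4" using assms by simp
    ultimately show ?thesis by linarith
  next
    case 2
    then have "1 \<le> (\<bar>g - g0\<bar> / \<epsilon>) ^ 4" using assms by (intro one_le_power) simp
    moreover have "0 \<le> 1 / \<epsilon>\<^sup>2 * (T - g)\<^sup>2" by simp
    ultimately show ?thesis by linarith
  qed
  then show ?thesis using True by simp
qed (use assms in simp)

text \<open>Here \<open>b \<le> card V\<close> replaces \<open>sqrt b\<close> by the
  \<open>sqrt n\<close> of \<open>field_bound\<close>. The order \<open>4 * k\<close> comes from the
  fourth power of the conditional mean's deviation; the variance needs only
  \<open>2 * k\<close>.\<close>

lemma spin_deviation_le:
  fixes \<epsilon> :: real
  assumes "spin_band_graph V N b I" and \<epsilon>: "0 < \<epsilon>" and bn: "b \<le> card V"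
    and g0: "\<bar>band_graph.even_mean V N b k - c\<bar> \<le> \<epsilon>"
  shows "spin_mean I t (\<lambda>y. if \<bar>band_graph.trace_moment V N b k y - c\<bar> > 3 * \<epsilon> then 1 else 0) \<le>
    (2 * (real (k + 1))\<^sup>2 * fact (2 * k + 1) / \<epsilon>\<^sup>2 + (fact (k + 1) / \<epsilon>) ^ 4) *
    (1 / (real (card V) * real b) + 1 / real b ^ 4) * field_bound (card V) (4 * k) t"
proof -
  interpret spin_band_graph V N b I t by fact
  let ?g = "spin_mean I t (trace_moment k)" and ?n = "real (card V)"
  define M where "M = field_bound (card V) (4 * k) t"
  have M: "(1 + sqrt (real b) * \<bar>\<mu>\<bar>) ^ l \<le> M" if "l \<le> 4 * k" for l
  proof -
    have "(1 + sqrt (real b) * \<bar>\<mu>\<bar>) ^ l \<le> (1 + sqrt ?n * \<bar>\<mu>\<bar>) ^ l"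
      using bn by (intro power_mono add_left_mono mult_right_mono) auto
    also have "\<dots> \<le> M" unfolding M_def field_bound_def using that by (intro power_increasing) auto
    finally show ?thesis .
  qed
  have "spin_mean I t (\<lambda>y. if \<bar>trace_moment k y - c\<bar> > 3 * \<epsilon> then 1 else 0) \<le>
      spin_mean I t (\<lambda>y. 1 / \<epsilon>\<^sup>2 * (trace_moment k y - ?g)\<^sup>2 + (\<bar>?g - even_mean k\<bar> / \<epsilon>) ^ 4)"
    by (intro spin_mean_mono indicator_deviation_le \<epsilon> g0)
  also have "\<dots> = 1 / \<epsilon>\<^sup>2 * spin_mean I t (\<lambda>y. (trace_moment k y - ?g)\<^sup>2) + (\<bar>?g - even_mean k\<bar> / \<epsilon>) ^ 4"
    by (simp only: spin_mean_add spin_mean_cmult spin_mean_const[OF finite_I])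
  also have "\<dots> \<le> 1 / \<epsilon>\<^sup>2 * (2 * (real (k + 1))\<^sup>2 * fact (2 * k + 1) / (?n * real b) * M) +
      (fact (k + 1) / real b * (1 + sqrt (real b) * \<bar>\<mu>\<bar>) ^ k / \<epsilon>) ^ 4"
  proof (intro add_mono mult_left_mono power_mono divide_right_mono spin_mean_trace_moment_close)
    show "spin_mean I t (\<lambda>y. (trace_moment k y - ?g)\<^sup>2) \<le> 2 * (real (k + 1))\<^sup>2 * fact (2 * k + 1) / (?n * real b) * M"
      by (rule order_trans[OF spin_variance_trace_moment]) (intro mult_left_mono M, auto)
  qed (use \<epsilon> in auto)
  also have "(fact (k + 1) / real b * (1 + sqrt (real b) * \<bar>\<mu>\<bar>) ^ k / \<epsilon>) ^ 4 =
      (fact (k + 1) / \<epsilon>) ^ 4 * (1 / real b ^ 4) * (1 + sqrt (real b) * \<bar>\<mu>\<bar>) ^ (4 * k)"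
    by (simp add: power_mult_distrib power_divide power_mult[symmetric] mult.commute)
  also have "\<dots> \<le> (fact (k + 1) / \<epsilon>) ^ 4 * (1 / real b ^ 4) * M"
    using \<epsilon> by (intro mult_left_mono M) auto
  also have "1 / \<epsilon>\<^sup>2 * (2 * (real (k + 1))\<^sup>2 * fact (2 * k + 1) / (?n * real b) * M) + \<dots> \<le>
      (2 * (real (k + 1))\<^sup>2 * fact (2 * k + 1) / \<epsilon>\<^sup>2 + (fact (k + 1) / \<epsilon>) ^ 4) *
      (1 / (?n * real b) + 1 / real b ^ 4) * M"
  proof -
    have "a * (x * M) + d * z * M \<le> (a + d) * (x + z) * M"
      if "0 \<le> a" "0 \<le> d" "0 \<le> x" "0 \<le> z" for a d x z :: real
    proof -
      have "a * x + d * z \<le> (a + d) * (x + z)" using that by (simp add: algebra_simps)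
      then have "(a * x + d * z) * M \<le> (a + d) * (x + z) * M"
        by (intro mult_right_mono) (auto simp: M_def field_bound_def)
      then show ?thesis by (simp add: algebra_simps)
    qed
    from this[of "2 * (real (k + 1))\<^sup>2 * fact (2 * k + 1) / \<epsilon>\<^sup>2" "(fact (k + 1) / \<epsilon>) ^ 4" "1 / (?n * real b)" "1 / real b ^ 4"]
    show ?thesis using \<epsilon> by (simp add: field_simps)
  qed
  also
  note total = calculation
  show ?thesis unfolding M_def[symmetric] by (rule total) simp
qed

subsection \<open>Decay of correlations\<close>

lemma spin_band_graph_square:
  assumes "1 \<le> n" "bandwidth n b"
  shows "spin_band_graph {1..n} (\<lambda>i. {j \<in> {1..n}. relevant n b i j}) b (square n)"
proof -
  interpret band_graph "{1..n}" "\<lambda>i. {j \<in> {1..n}. relevant n b i j}" b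
    by (rule band_graph_relevant[OF assms])
  show ?thesis
    by unfold_locales (use assms in \<open>auto simp: square_def ed_def\<close>)
qed

lemma even_mean_close:
  obtains D where "0 \<le> D" "\<And>V N b. band_graph V N b \<Longrightarrow> V \<noteq> {} \<Longrightarrow>
    \<bar>band_graph.even_mean V N b k - sc_moment k\<bar> \<le> D / real b"
proof -
  obtain D where D: "0 \<le> D" "\<forall>V N b. band_graph V N b \<longrightarrow>
     (\<forall>x\<in>V. \<bar>band_graph.even_density N b k x - sc_moment k\<bar> \<le> D / real b)"
    using even_density_close by blast
  have "\<bar>band_graph.even_mean V N b k - sc_moment k\<bar> \<le> D / real b" if g: "band_graph V N b" and V: "V \<noteq> {}" for V N b
  proof -
    interpret band_graph V N b by (rule g)
    have n: "0 < card V" using V by (simp add: card_gt_0_iff)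
    have "even_mean k - sc_moment k = (\<Sum>x\<in>V. even_density k x - sc_moment k) / real (card V)"
      using n V by (simp add: even_mean_def sum_subtractf diff_divide_distrib)
    also have "\<bar>\<dots>\<bar> \<le> (\<Sum>x\<in>V. D / real b) / real (card V)"
      unfolding abs_divide abs_of_nat
      by (intro divide_right_mono order_trans[OF sum_abs] sum_mono) (use D g in auto)
    also have "\<dots> = D / real b" using n V by simp
    finally show ?thesis .
  qed
  then show thesis using that D(1) by blast
qed

lemma borel_measurable_prod_list_map [measurable (raw)]:
  fixes Y :: "'e \<Rightarrow> 'w \<Rightarrow> real"
  assumes "\<And>e. e \<in> set es \<Longrightarrow> Y e \<in> borel_measurable M"
  shows "(\<lambda>\<omega>. prod_list (map (\<lambda>e. Y e \<omega>) es)) \<in> borel_measurable M"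
  using assms by (induction es) auto

lemma (in spin_band_graph) trace_moment_measurable:
  assumes "\<And>e. e \<in> I \<Longrightarrow> Y e \<in> borel_measurable M"
  shows "(\<lambda>\<omega>. trace_moment k (\<lambda>e. Y e \<omega>)) \<in> borel_measurable M"
  unfolding trace_moment_def walk_weight_def
  by (intro borel_measurable_divide borel_measurable_sum borel_measurable_prod_list_map borel_measurable_const assms)
    (use walk_edges_I in \<open>auto simp: closed_walks_def walks_def\<close>)

text \<open>Configurations are \<open>undefined\<close> outside \<open>I\<close> and the random
  spins arbitrary there, so the two can be compared on \<open>I\<close> only.\<close>

lemma (in spin_band_graph) trace_moment_cong:
  assumes "\<And>e. e \<in> I \<Longrightarrow> y e = z e"
  shows "trace_moment k y = trace_moment k z"
proof -
  have "map y (edges x ys) = map z (edges x ys)" if "x \<in> V" "ys \<in> closed_walks k x" for x ys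
    using walk_edges_I[of x ys] that assms by (auto simp: closed_walks_def walks_def)
  then show ?thesis
    unfolding trace_moment_def walk_weight_def
    by (intro arg_cong2[of _ _ _ _ "(/)"] sum.cong refl arg_cong[of _ _ prod_list])
qed

section \<open>The symmetrized Curie-Weiss scheme and its correlation bounds\<close>

locale curie_weiss_band = prob_space M for M :: "'w measure" +
  fixes \<beta> :: real and a' a :: "nat \<Rightarrow> nat \<Rightarrow> nat \<Rightarrow> 'w \<Rightarrow> real" and b :: "nat \<Rightarrow> nat"
  assumes \<beta>: "0 < \<beta>" "\<beta> \<le> 1"
    and cw: "1 \<le> n \<Longrightarrow> curie_weiss M \<beta> (square n) (\<lambda>(i, j). a' n i j)"
    and a: "1 \<le> n \<Longrightarrow> (i, j) \<in> square n \<Longrightarrow> a n i j = (if i \<le> j then a' n i j else a' n j i)"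
    and bw: "1 \<le> n \<Longrightarrow> bandwidth n (b n)"
begin

definition spins :: "nat \<Rightarrow> 'w \<Rightarrow> nat \<times> nat \<Rightarrow> real" where
  "spins n \<omega> = (\<lambda>(i, j). a' n i j \<omega>)"

lemma finite_square [simp]: "finite (square n)"
  by (simp add: square_def)

lemma card_square: "card (square n) = n\<^sup>2"
  by (simp add: square_def power2_eq_square)

lemma spins_measurable: "1 \<le> n \<Longrightarrow> e \<in> square n \<Longrightarrow> (\<lambda>\<omega>. spins n \<omega> e) \<in> borel_measurable M"
  using cw[of n] by (cases e) (auto simp: curie_weiss_def spins_def)

lemma spins_case: "(case e of (i, j) \<Rightarrow> a' n i j) \<omega> = spins n \<omega> e"
  by (cases e) (simp add: spins_def)

lemma a_eq_spins: "1 \<le> n \<Longrightarrow> (i, j) \<in> square n \<Longrightarrow> a n i j \<omega> = spins n \<omega> (ed i j)"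
  by (simp add: a spins_def ed_def min_def max_def)

lemma ed_square: "(i, j) \<in> square n \<Longrightarrow> ed i j \<in> square n"
  by (auto simp: square_def ed_def)

lemma a_sym: "1 \<le> n \<Longrightarrow> (i, j) \<in> square n \<Longrightarrow> a n i j \<omega> = a n j i \<omega>"
  using a_eq_spins[of n i j \<omega>] a_eq_spins[of n j i \<omega>] by (auto simp: square_def ed_commute)

lemma expectation_spins:
  assumes n: "1 \<le> n" and [measurable]: "G \<in> borel_measurable M"
    and g: "\<And>\<omega> y. \<omega> \<in> space M \<Longrightarrow> y \<in> square n \<rightarrow>\<^sub>E {-1, 1} \<Longrightarrow> (\<And>e. e \<in> square n \<Longrightarrow> spins n \<omega> e = y e) \<Longrightarrow> G \<omega> = g y"
  shows "expectation G = cw_mean \<beta> (square n) g"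
  by (rule curie_weiss_expectation[OF prob_space_axioms cw[OF n] finite_square])
    (use g in \<open>auto simp: spins_case\<close>)

lemma spins_AE:
  assumes n: "1 \<le> n"
  shows "AE \<omega> in M. \<forall>e\<in>square n. spins n \<omega> e \<in> {-1, 1}"
  using curie_weiss_AE[OF prob_space_axioms cw[OF n] finite_square]
proof eventually_elim
  case (elim \<omega>)
  then obtain y where y: "y \<in> square n \<rightarrow>\<^sub>E {-1, 1}" "\<And>e. e \<in> square n \<Longrightarrow> spins n \<omega> e = y e"
    unfolding spins_case by blast
  show ?case
  proof
    fix e assume "e \<in> square n"
    then show "spins n \<omega> e \<in> {-1, 1}" using y PiE_mem[OF y(1), of e] by auto
  qed
qed

text \<open>Agreement is demanded only where all spins are 1 or -1, since on a null set they may
  take other values.\<close>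

definition spin_product :: "nat \<Rightarrow> (nat \<times> nat) set \<Rightarrow> ('w \<Rightarrow> real) \<Rightarrow> bool" where
  "spin_product n J G \<longleftrightarrow> G \<in> borel_measurable M \<and>
     (\<forall>\<omega> y. \<omega> \<in> space M \<longrightarrow> y \<in> square n \<rightarrow>\<^sub>E {-1, 1} \<longrightarrow>
        (\<forall>e. e \<in> square n \<longrightarrow> spins n \<omega> e = y e) \<longrightarrow> G \<omega> = (\<Prod>e\<in>J. y e))"

text \<open>The field bound absorbs \<open>s\<close> factors \<open>tanh t\<close>, and the surplus
  ones are at most 1 in absolute value. Fixing \<open>p\<close> before \<open>s\<close> yields one
  constant for all \<open>s \<le> p\<close>; with \<open>p\<close> the sum of the exponents it is
  the constant required of the scheme.\<close>

lemma expectation_product_le: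
  "\<exists>C. \<forall>n J G s. 1 \<le> n \<longrightarrow> J \<subseteq> square n \<longrightarrow> s \<le> card J \<longrightarrow> s \<le> p \<longrightarrow> spin_product n J G \<longrightarrow>
      \<bar>expectation G\<bar> \<le> (1 / sqrt (real n)) ^ s * C"
proof -
  obtain C where C: "0 \<le> C"
    "\<And>n (I :: (nat \<times> nat) set) F A. 1 \<le> n \<Longrightarrow> finite I \<Longrightarrow> card I = n\<^sup>2 \<Longrightarrow> 0 \<le> A \<Longrightarrow>
      (\<And>t. spin_mean I t F \<le> A * field_bound n p t) \<Longrightarrow> cw_mean \<beta> I F \<le> A * C"
    using cw_mean_bound[OF \<beta>, of p] by blast
  show ?thesis
  proof (intro exI[of _ C] allI impI)
    fix n J G s
    assume n: "1 \<le> n" and J: "J \<subseteq> square n" and s: "s \<le> card J" "s \<le> p" and G: "spin_product n J G"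
    define F :: "(nat \<times> nat \<Rightarrow> real) \<Rightarrow> real" where "F y = (\<Prod>e\<in>J. y e)" for y
    define A where "A = (1 / sqrt (real n)) ^ s"
    have A: "0 \<le> A" by (simp add: A_def)
    have sn: "0 < sqrt (real n)" using n by simp
    have le: "\<bar>spin_mean (square n) t F\<bar> \<le> A * field_bound n p t" for t
    proof -
      have "\<bar>spin_mean (square n) t F\<bar> = \<bar>tanh t\<bar> ^ card J"
        unfolding F_def[abs_def] by (simp add: spin_mean_prod[OF finite_square J] power_abs)
      also have "\<dots> \<le> \<bar>tanh t\<bar> ^ s"
        using s(1) tanh_real_bounds[of t] by (intro power_decreasing) auto
      also have "\<dots> = A * (sqrt (real n) * \<bar>tanh t\<bar>) ^ s"
        using sn by (simp add: A_def power_mult_distrib power_divide)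
      also have "\<dots> \<le> A * (1 + sqrt (real n) * \<bar>tanh t\<bar>) ^ s"
        using A by (intro mult_left_mono power_mono) auto
      also have "\<dots> \<le> A * field_bound n p t"
        unfolding field_bound_def using A s(2) by (intro mult_left_mono power_increasing) auto
      finally show ?thesis .
    qed
    have "cw_mean \<beta> (square n) F \<le> A * C"
      by (rule C(2)[OF n finite_square card_square A]) (use le abs_le_D1 in blast)
    moreover have "cw_mean \<beta> (square n) (\<lambda>y. - F y) \<le> A * C"
    proof (rule C(2)[OF n finite_square card_square A])
      fix t
      have "spin_mean (square n) t (\<lambda>y. - F y) = - spin_mean (square n) t F"
        using spin_mean_cmult[of "square n" t "-1" F] by simp
      then show "spin_mean (square n) t (\<lambda>y. - F y) \<le> A * field_bound n p t"
        using le[of t] by linarith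
    qed
    moreover have "cw_mean \<beta> (square n) (\<lambda>y. - F y) = - cw_mean \<beta> (square n) F"
      by (simp add: cw_mean_def sum_negf)
    moreover have "expectation G = cw_mean \<beta> (square n) F"
      using G by (intro expectation_spins n) (auto simp: F_def spin_product_def)
    ultimately show "\<bar>expectation G\<bar> \<le> (1 / sqrt (real n)) ^ s * C"
      unfolding A_def by linarith
  qed
qed

lemma a_measurable: "1 \<le> n \<Longrightarrow> (p, q) \<in> square n \<Longrightarrow> a n p q \<in> borel_measurable M"
  using spins_measurable[of n "ed p q"] ed_square[of p q n] by (simp add: a_eq_spins[symmetric])

lemma fundamentally_different_iff: "fundamentally_different (p, q) (p', q') \<longleftrightarrow> ed p q \<noteq> ed p' q'"
  by (auto simp: fundamentally_different_def ed_eq_iff doubleton_eq_iff)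

theorem almost_uncorrelated_scheme: "almost_uncorrelated M (1 / 2) a"
  unfolding almost_uncorrelated_def
proof (intro conjI)
  show "triangular_scheme M a"
    unfolding triangular_scheme_def using a_measurable a_sym by auto
  show "\<forall>n\<ge>1. \<forall>(p, q)\<in>square n. \<forall>k::nat. integrable M (\<lambda>\<omega>. a n p q \<omega> ^ k)"
  proof (intro allI impI ballI, clarify)
    fix n p q and k :: nat assume n: "1 \<le> n" and pq: "(p, q) \<in> square n"
    show "integrable M (\<lambda>\<omega>. a n p q \<omega> ^ k)"
    proof (rule integrable_const_bound[where B = 1])
      show "AE \<omega> in M. norm (a n p q \<omega> ^ k) \<le> 1"
        using spins_AE[OF n]
      proof eventually_elim
        case (elim \<omega>)
        then have "a n p q \<omega> \<in> {-1, 1}" using a_eq_spins[OF n pq] ed_square[OF pq] by metis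
        then show ?case by (auto simp: norm_power)
      qed
    qed (use a_measurable[OF n pq] in measurable)
  qed
  obtain C where C: "\<And>p n J G s. 1 \<le> n \<Longrightarrow> J \<subseteq> square n \<Longrightarrow> s \<le> card J \<Longrightarrow> s \<le> p \<Longrightarrow> spin_product n J G \<Longrightarrow>
      \<bar>expectation G\<bar> \<le> (1 / sqrt (real n)) ^ s * C p"
    using expectation_product_le by metis
  show "\<exists>(C :: nat \<Rightarrow> real) (D :: nat \<Rightarrow> nat \<Rightarrow> real).
        (\<forall>m\<ge>1. D m \<longlonglongrightarrow> 0) \<and>
        (\<forall>N\<ge>1. \<forall>l\<ge>1. \<forall>p q :: nat \<Rightarrow> nat.
           (\<forall>i\<in>{1..l}. (p i, q i) \<in> square N) \<longrightarrow>
           (\<forall>i\<in>{1..l}. \<forall>j\<in>{1..l}. i \<noteq> j \<longrightarrow> fundamentally_different (p i, q i) (p j, q j)) \<longrightarrow>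
           (\<forall>\<delta> :: nat \<Rightarrow> nat. (\<forall>i\<in>{1..l}. \<delta> i \<ge> 1) \<longrightarrow>
              (\<forall>n\<ge>N. \<bar>\<integral>\<omega>. (\<Prod>i=1..l. a n (p i) (q i) \<omega> ^ \<delta> i) \<partial>M\<bar>
                 \<le> C (\<Sum>i=1..l. \<delta> i) * real n powr (- (1 / 2) * real (card {i\<in>{1..l}. \<delta> i = 1})))) \<and>
           (\<forall>n\<ge>N. \<bar>(\<integral>\<omega>. (\<Prod>i=1..l. (a n (p i) (q i) \<omega>)\<^sup>2) \<partial>M) - 1\<bar> \<le> D l n))"
  \<comment> \<open>The error in the second condition can be 0, as squares of spins are 1 almost
    surely.\<close>
  proof (rule exI[of _ C], rule exI[of _ "\<lambda>_ _. 0"], intro conjI allI impI)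
    fix N l :: nat and p q :: "nat \<Rightarrow> nat"
    assume N: "1 \<le> N" and l: "1 \<le> l" and sq: "\<forall>i\<in>{1..l}. (p i, q i) \<in> square N"
      and fd: "\<forall>i\<in>{1..l}. \<forall>j\<in>{1..l}. i \<noteq> j \<longrightarrow> fundamentally_different (p i, q i) (p j, q j)"
    define e where "e i = ed (p i) (q i)" for i
    have inj: "inj_on e {1..l}"
      using fd unfolding fundamentally_different_iff by (auto simp: inj_on_def e_def)
    have sqn: "(p i, q i) \<in> square n" if "i \<in> {1..l}" "N \<le> n" for i n
      using sq that by (fastforce simp: square_def)
    have ap: "a n (p i) (q i) \<omega> = spins n \<omega> (e i)" "e i \<in> square n" if "i \<in> {1..l}" "N \<le> n" for i n \<omega>
      using a_eq_spins[OF _ sqn[OF that]] ed_square[OF sqn[OF that]] N that by (auto simp: e_def)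
    have meas: "a n (p i) (q i) \<in> borel_measurable M" if "i \<in> {1..l}" "N \<le> n" for i n
      using a_measurable[OF _ sqn[OF that]] N that by auto
    {
      fix \<delta> :: "nat \<Rightarrow> nat" and n assume \<delta>: "\<forall>i\<in>{1..l}. \<delta> i \<ge> 1" and n: "N \<le> n"
      define s where "s = card {i \<in> {1..l}. \<delta> i = 1}"
      \<comment> \<open>Spins with odd exponent survive, those with exponent 1 among them;
        fundamentally different pairs have distinct edges, so \<open>J\<close> has at least
        \<open>s\<close> elements.\<close>
      define J where "J = e ` {i \<in> {1..l}. odd (\<delta> i)}"
      have n1: "1 \<le> n" using N n by simp
      have "card J = card {i \<in> {1..l}. odd (\<delta> i)}"
        unfolding J_def by (rule card_image) (rule inj_on_subset[OF inj], auto)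
      moreover have "s \<le> card {i \<in> {1..l}. odd (\<delta> i)}"
        unfolding s_def by (rule card_mono) auto
      ultimately have sJ: "s \<le> card J" by simp
      have "s = (\<Sum>i\<in>{i \<in> {1..l}. \<delta> i = 1}. \<delta> i)" by (simp add: s_def)
      also have "\<dots> \<le> (\<Sum>i=1..l. \<delta> i)" by (rule sum_mono2) auto
      finally have sp: "s \<le> (\<Sum>i=1..l. \<delta> i)" .
      have pow: "x ^ d = (if odd d then x else 1)" if "x \<in> {-1, 1}" for x :: real and d :: nat
        using that by auto
      have "\<bar>\<integral>\<omega>. (\<Prod>i=1..l. a n (p i) (q i) \<omega> ^ \<delta> i) \<partial>M\<bar> \<le> (1 / sqrt (real n)) ^ s * C (\<Sum>i=1..l. \<delta> i)"
      proof (rule C[OF n1 _ sJ sp])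
        show "J \<subseteq> square n" using ap(2)[OF _ n] by (auto simp: J_def)
        show "spin_product n J (\<lambda>\<omega>. \<Prod>i=1..l. a n (p i) (q i) \<omega> ^ \<delta> i)"
          unfolding spin_product_def
        proof (intro conjI allI impI)
          show "(\<lambda>\<omega>. \<Prod>i=1..l. a n (p i) (q i) \<omega> ^ \<delta> i) \<in> borel_measurable M"
            using meas[OF _ n] by (intro borel_measurable_prod borel_measurable_power) auto
          fix \<omega> y assume y: "y \<in> square n \<rightarrow>\<^sub>E {-1, 1}" and eq: "\<forall>e. e \<in> square n \<longrightarrow> spins n \<omega> e = y e"
          have "(\<Prod>i=1..l. a n (p i) (q i) \<omega> ^ \<delta> i) = (\<Prod>i=1..l. if odd (\<delta> i) then y (e i) else 1)"
          proof (rule prod.cong[OF refl])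
            fix i assume i: "i \<in> {1..l}"
            have "a n (p i) (q i) \<omega> = y (e i)" using ap(1)[OF i n] ap(2)[OF i n] eq by metis
            moreover have "y (e i) \<in> {-1, 1}" using ap(2)[OF i n] y by (auto simp: PiE_iff)
            ultimately show "a n (p i) (q i) \<omega> ^ \<delta> i = (if odd (\<delta> i) then y (e i) else 1)"
              by (simp only: pow)
          qed
          also have "\<dots> = (\<Prod>i\<in>{i \<in> {1..l}. odd (\<delta> i)}. y (e i))"
            by (rule prod.inter_filter[symmetric]) simp
          also have "\<dots> = (\<Prod>e\<in>J. y e)"
            unfolding J_def by (subst prod.reindex) (auto intro: inj_on_subset[OF inj])
          finally show "(\<Prod>i=1..l. a n (p i) (q i) \<omega> ^ \<delta> i) = (\<Prod>e\<in>J. y e)" .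
        qed
      qed
      also have "(1 / sqrt (real n)) ^ s = real n powr (- (1 / 2) * real s)"
      proof -
        have "1 / sqrt (real n) = real n powr (- (1 / 2))"
          using n1 by (simp add: powr_minus_divide powr_half_sqrt)
        then show ?thesis using n1 by (simp add: powr_power)
      qed
      finally show "\<bar>\<integral>\<omega>. (\<Prod>i=1..l. a n (p i) (q i) \<omega> ^ \<delta> i) \<partial>M\<bar>
         \<le> C (\<Sum>i=1..l. \<delta> i) * real n powr (- (1 / 2) * real (card {i\<in>{1..l}. \<delta> i = 1}))"
        by (simp add: s_def mult.commute)
    }
    fix n assume n: "N \<le> n"
    then have n1: "1 \<le> n" using N by simp
    have "AE \<omega> in M. (\<Prod>i=1..l. (a n (p i) (q i) \<omega>)\<^sup>2) = 1"
      using spins_AE[OF n1]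
    proof eventually_elim
      case (elim \<omega>)
      have "(a n (p i) (q i) \<omega>)\<^sup>2 = 1" if "i \<in> {1..l}" for i
        using elim ap(1)[OF that n, of \<omega>] ap(2)[OF that n] by auto
      then show ?case by simp
    qed
    then have "(\<integral>\<omega>. (\<Prod>i=1..l. (a n (p i) (q i) \<omega>)\<^sup>2) \<partial>M) = (\<integral>\<omega>. 1 \<partial>M)"
      by (intro integral_cong_AE) (use meas[OF _ n] in \<open>auto intro!: borel_measurable_prod\<close>)
    then show "\<bar>(\<integral>\<omega>. (\<Prod>i=1..l. (a n (p i) (q i) \<omega>)\<^sup>2) \<partial>M) - 1\<bar> \<le> 0"
      by (simp add: prob_space)
  qed simp
qed

end

subsection \<open>The semicircle law\<close>

context curie_weiss_band
begin

abbreviation nbrs :: "nat \<Rightarrow> nat \<Rightarrow> nat set" where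
  "nbrs n \<equiv> (\<lambda>i. {j \<in> {1..n}. relevant n (b n) i j})"

abbreviation X :: "nat \<Rightarrow> 'w \<Rightarrow> real mat" where
  "X \<equiv> band_matrix a b"

abbreviation rate :: "nat \<Rightarrow> real" where
  "rate n \<equiv> 1 / (real n * real (b n)) + 1 / real (b n) ^ 4"

abbreviation deviation :: "(real \<Rightarrow> real) \<Rightarrow> nat \<Rightarrow> 'w \<Rightarrow> real" where
  "deviation f n \<omega> \<equiv> \<bar>(\<integral>x. f x \<partial>esd (X n \<omega>)) - (\<integral>x. f x \<partial>semicircle)\<bar>"

abbreviation deviates :: "(real \<Rightarrow> real) \<Rightarrow> real \<Rightarrow> nat \<Rightarrow> 'w set" where
  "deviates f \<epsilon> n \<equiv> {\<omega> \<in> space M. deviation f n \<omega> > \<epsilon>}"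

section \<open>Spectral moments as functions of the spins, and measurability\<close>

definition moment :: "nat \<Rightarrow> nat \<Rightarrow> 'w \<Rightarrow> real" where
  "moment k n \<omega> = (\<Sum>i<n. real_eigenvalues (X n \<omega>) ! i ^ k) / real n"

lemma moment_eq:
  assumes n: "1 \<le> n"
  shows "moment k n \<omega> = band_graph.trace_moment {1..n} (nbrs n) (b n) k (spins n \<omega>)"
proof -
  have X: "X n \<omega> \<in> carrier_mat n n" by (simp add: band_matrix_def)
  have sym: "X n \<omega> $$ (i, j) = X n \<omega> $$ (j, i)" if "i < n" "j < n" for i j
    using that a_sym[OF n, of "i + 1" "j + 1" \<omega>] relevant_sym[of n "b n" "i + 1" "j + 1"]
    by (simp add: band_matrix_def square_def)
  have "X n \<omega> = Matrix.mat n n (\<lambda>(i, j). if j + 1 \<in> nbrs n (i + 1)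
      then real (b n) powr (- 1 / 2) * spins n \<omega> (ed (i + 1) (j + 1)) else 0)"
    unfolding band_matrix_def
    by (rule cong_mat) (use a_eq_spins[OF n] in \<open>auto simp: square_def\<close>)
  from mat_trace_pow_walks[OF band_graph_relevant[OF n bw[OF n]] n this]
  have "mat_trace (X n \<omega> ^\<^sub>m k) / real n = band_graph.trace_moment {1..n} (nbrs n) (b n) k (spins n \<omega>)" .
  moreover have "(\<Sum>i<n. real_eigenvalues (X n \<omega>) ! i ^ k) = mat_trace (X n \<omega> ^\<^sub>m k)"
    by (rule real_symmetric_eigenvalues(2)[OF X]) (rule sym)
  ultimately show ?thesis by (simp only: moment_def)
qed

lemma moment_measurable:
  assumes n: "1 \<le> n"
  shows "moment k n \<in> borel_measurable M"
proof -
  interpret spin_band_graph "{1..n}" "nbrs n" "b n" "square n"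
    by (rule spin_band_graph_square[OF n bw[OF n]])
  have "(\<lambda>\<omega>. trace_moment k (\<lambda>e. spins n \<omega> e)) \<in> borel_measurable M"
    by (rule trace_moment_measurable) (rule spins_measurable[OF n])
  then show ?thesis by (simp add: moment_eq[OF n, abs_def])
qed

lemma integral_esd_X:
  fixes f :: "real \<Rightarrow> real"
  assumes n: "1 \<le> n" and f: "continuous_on UNIV f"
  shows "(\<integral>x. f x \<partial>esd (X n \<omega>)) = (\<Sum>i<n. f (real_eigenvalues (X n \<omega>) ! i)) / real n"
  using integral_esd[of "X n \<omega>" f] n f by (simp add: band_matrix_def borel_measurable_continuous_onI)

text \<open>A continuous function is a pointwise limit of polynomials, and polynomial statistics are
  linear combinations of the moments.\<close>

lemma integral_esd_measurable:
  fixes f :: "real \<Rightarrow> real"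
  assumes n: "1 \<le> n" and f: "continuous_on UNIV f"
  shows "(\<lambda>\<omega>. \<integral>x. f x \<partial>esd (X n \<omega>)) \<in> borel_measurable M"
proof -
  have "\<forall>j::nat. \<exists>a d. \<forall>x\<in>{- real j..real j}. \<bar>f x - (\<Sum>i\<le>d. a i * x ^ i)\<bar> < 1 / real (Suc j)"
  proof
    fix j :: nat
    obtain p where p: "real_polynomial_function p" "\<And>x. x \<in> {- real j..real j} \<Longrightarrow> \<bar>f x - p x\<bar> < 1 / real (Suc j)"
      using Stone_Weierstrass_real_polynomial_function[of "{- real j..real j}" f "1 / real (Suc j)"]
        continuous_on_subset[OF f] by auto
    then show "\<exists>a d. \<forall>x\<in>{- real j..real j}. \<bar>f x - (\<Sum>i\<le>d. a i * x ^ i)\<bar> < 1 / real (Suc j)"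
      unfolding real_polynomial_function_iff_sum by blast
  qed
  then obtain c d where cd: "\<And>j x. x \<in> {- real j..real j} \<Longrightarrow> \<bar>f x - (\<Sum>i\<le>d j. c j i * x ^ i)\<bar> < 1 / real (Suc j)"
    by metis
  define P where "P j x = (\<Sum>i\<le>d j. c j i * x ^ i)" for j x
  have lim: "(\<lambda>j. P j x) \<longlonglongrightarrow> f x" for x
  proof (rule LIMSEQ_I)
    fix r :: real assume r: "0 < r"
    obtain j0 where j0: "max \<bar>x\<bar> (1 / r) < real j0" using reals_Archimedean2 by blast
    have "norm (P j x - f x) < r" if "j0 \<le> j" for j
    proof -
      have "\<bar>x\<bar> < real j" "1 / r < real (Suc j)" using j0 that by auto
      then have "\<bar>f x - P j x\<bar> < 1 / real (Suc j)" unfolding P_def by (intro cd) auto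
      also have "\<dots> < r" using \<open>1 / r < real (Suc j)\<close> r by (simp add: field_simps)
      finally show ?thesis by (simp add: abs_minus_commute)
    qed
    then show "\<exists>no. \<forall>j\<ge>no. norm (P j x - f x) < r" by blast
  qed
  have "(\<lambda>\<omega>. (\<Sum>i<n. f (real_eigenvalues (X n \<omega>) ! i)) / real n) \<in> borel_measurable M"
  proof (rule borel_measurable_LIMSEQ_real)
    fix \<omega>
    show "(\<lambda>j. (\<Sum>i<n. P j (real_eigenvalues (X n \<omega>) ! i)) / real n) \<longlonglongrightarrow>
        (\<Sum>i<n. f (real_eigenvalues (X n \<omega>) ! i)) / real n"
      using n by (intro tendsto_divide tendsto_sum lim tendsto_const) auto
  next
    fix j
    have "(\<Sum>i<n. P j (real_eigenvalues (X n \<omega>) ! i)) / real n = (\<Sum>k\<le>d j. c j k * moment k n \<omega>)" for \<omega>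
      unfolding P_def moment_def by (subst sum.swap) (simp add: sum_distrib_left sum_divide_distrib)
    then show "(\<lambda>\<omega>. (\<Sum>i<n. P j (real_eigenvalues (X n \<omega>) ! i)) / real n) \<in> borel_measurable M"
      using moment_measurable[OF n] by simp
  qed
  then show ?thesis by (simp add: integral_esd_X[OF n f])
qed

text \<open>The gap between \<open>even_mean\<close> and the semicircle moment is not random, so no
  probability can absorb it; from bandwidth \<open>B\<close> on it is at most a third of
  \<epsilon>.\<close>

lemma prob_moment_deviation:
  assumes \<epsilon>: "0 < \<epsilon>"
  obtains K B where "0 \<le> K" "\<And>n. 1 \<le> n \<Longrightarrow> B \<le> real (b n) \<Longrightarrow>
    prob {\<omega> \<in> space M. \<bar>moment k n \<omega> - sc_moment k\<bar> > \<epsilon>} \<le> K * rate n"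
proof -
  define \<eta> where "\<eta> = \<epsilon> / 3"
  have \<eta>: "0 < \<eta>" "3 * \<eta> = \<epsilon>" using \<epsilon> by (auto simp: \<eta>_def)
  obtain D where D: "0 \<le> D" "\<And>V N b. band_graph V N b \<Longrightarrow> V \<noteq> {} \<Longrightarrow>
    \<bar>band_graph.even_mean V N b k - sc_moment k\<bar> \<le> D / real b"
  proof -
    show ?thesis by (rule even_mean_close[of k]) (rule that)
  qed
  obtain C where C: "0 \<le> C"
    "\<And>n (I :: (nat \<times> nat) set) F A. 1 \<le> n \<Longrightarrow> finite I \<Longrightarrow> card I = n\<^sup>2 \<Longrightarrow> 0 \<le> A \<Longrightarrow>
      (\<And>t. spin_mean I t F \<le> A * field_bound n (4 * k) t) \<Longrightarrow> cw_mean \<beta> I F \<le> A * C"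
    using cw_mean_bound[OF \<beta>, of "4 * k"] by blast
  define K where "K = 2 * (real (k + 1))\<^sup>2 * fact (2 * k + 1) / \<eta>\<^sup>2 + (fact (k + 1) / \<eta>) ^ 4"
  have K: "0 \<le> K" using \<eta> by (simp add: K_def)
  have "prob {\<omega> \<in> space M. \<bar>moment k n \<omega> - sc_moment k\<bar> > \<epsilon>} \<le> K * C * rate n"
    if n: "1 \<le> n" and B: "D / \<eta> + 1 \<le> real (b n)" for n
  proof -
    note sbg = spin_band_graph_square[OF n bw[OF n]]
    interpret spin_band_graph "{1..n}" "nbrs n" "b n" "square n" by (rule sbg)
    define F where "F y = (if \<bar>trace_moment k y - sc_moment k\<bar> > 3 * \<eta> then 1 else 0 :: real)" for y
    have "D / real (b n) \<le> \<eta>"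
    proof -
      have "D / \<eta> \<le> real (b n)" using B by simp
      then show ?thesis using \<eta> b_pos by (simp add: field_simps)
    qed
    then have em: "\<bar>even_mean k - sc_moment k\<bar> \<le> \<eta>"
      using D(2)[OF band_graph_axioms V_ne] by linarith
    have bn: "b n \<le> card {1..n}" using bw[OF n] by (auto simp: bandwidth_def)
    let ?A = "K * rate n"
    have A: "0 \<le> ?A" using K by simp
    let ?E = "{\<omega> \<in> space M. \<bar>moment k n \<omega> - sc_moment k\<bar> > \<epsilon>}"
    have [measurable]: "moment k n \<in> borel_measurable M" by (rule moment_measurable[OF n])
    have E: "?E \<in> events" by measurable
    have "prob ?E = expectation (indicator ?E)" using E by simp
    also have "\<dots> = cw_mean \<beta> (square n) F"
    proof (rule expectation_spins[OF n])
      show "(indicator ?E :: 'w \<Rightarrow> real) \<in> borel_measurable M" using E by measurable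
      fix \<omega> y assume \<omega>: "\<omega> \<in> space M" and eq: "\<And>e. e \<in> square n \<Longrightarrow> spins n \<omega> e = y e"
      have "trace_moment k (spins n \<omega>) = trace_moment k y"
        by (rule trace_moment_cong) (rule eq)
      then show "indicator ?E \<omega> = F y"
        using \<omega> by (simp add: indicator_def F_def moment_eq[OF n] \<eta>(2))
    qed
    also have "\<dots> \<le> ?A * C"
    proof (rule C(2)[OF n finite_square card_square A])
      fix t
      show "spin_mean (square n) t F \<le> ?A * field_bound n (4 * k) t"
        using spin_deviation_le[OF sbg \<eta>(1) bn em, of t]
        unfolding F_def[abs_def] K_def by (simp only: card_atLeastAtMost diff_Suc_1)
    qed
    finally show ?thesis by (simp only: mult_ac)
  qed
  then show thesis using that[of "K * C" "D / \<eta> + 1"] K C(1) by simp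
qed

text \<open>A deviation of the integral forces one of finitely many moments to deviate, and a union
  bound preserves the rate.\<close>

lemma prob_integral_deviation:
  fixes f :: "real \<Rightarrow> real"
  assumes f: "continuous_on UNIV f" "bounded (range f)" and \<epsilon>: "0 < \<epsilon>"
  obtains K B where "0 \<le> K" "\<And>n. 1 \<le> n \<Longrightarrow> B \<le> real (b n) \<Longrightarrow>
    prob (deviates f \<epsilon> n) \<le>
      K * rate n"
proof -
  obtain L \<delta> where \<delta>: "0 < \<delta>" and close: "\<And>n (x :: nat \<Rightarrow> real). 0 < n \<Longrightarrow>
      (\<And>k. k \<le> L \<Longrightarrow> \<bar>(\<Sum>i<n. x i ^ k) / real n - sc_moment k\<bar> \<le> \<delta>) \<Longrightarrow>
      \<bar>(\<Sum>i<n. f (x i)) / real n - (\<integral>x. f x \<partial>semicircle)\<bar> \<le> \<epsilon>"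
    by (rule moments_close_imp_integral_close[OF f \<epsilon>]) blast
  define Q where "Q k K B \<longleftrightarrow> 0 \<le> K \<and> (\<forall>n. 1 \<le> n \<longrightarrow> B \<le> real (b n) \<longrightarrow>
    prob {\<omega> \<in> space M. \<bar>moment k n \<omega> - sc_moment k\<bar> > \<delta>} \<le> K * rate n)"
    for k K B
  have "\<forall>k. \<exists>K B. Q k K B"
  proof
    fix k
    show "\<exists>K B. Q k K B"
      unfolding Q_def by (rule prob_moment_deviation[OF \<delta>, of k]) blast
  qed
  then obtain K B where Q: "\<And>k. Q k (K k) (B k)"
    by metis
  have K: "\<And>k. 0 \<le> K k" and KB: "\<And>k n. 1 \<le> n \<Longrightarrow> B k \<le> real (b n) \<Longrightarrow>
    prob {\<omega> \<in> space M. \<bar>moment k n \<omega> - sc_moment k\<bar> > \<delta>} \<le> K k * rate n"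
    using Q unfolding Q_def by blast+
  show thesis
  proof (rule that)
    show "0 \<le> (\<Sum>k\<le>L. K k)" using K by (simp add: sum_nonneg)
    fix n assume n: "1 \<le> n" and Bn: "Max (B ` {..L}) \<le> real (b n)"
    let ?E = "\<lambda>k. {\<omega> \<in> space M. \<bar>moment k n \<omega> - sc_moment k\<bar> > \<delta>}"
    have [measurable]: "moment k n \<in> borel_measurable M" for k by (rule moment_measurable[OF n])
    have E: "?E k \<in> events" for k by measurable
    have "deviates f \<epsilon> n \<subseteq> (\<Union>k\<le>L. ?E k)"
    proof
      fix \<omega> assume \<omega>: "\<omega> \<in> deviates f \<epsilon> n"
      have "\<exists>k\<le>L. \<bar>moment k n \<omega> - sc_moment k\<bar> > \<delta>"
      proof (rule ccontr)
        assume "\<not> ?thesis"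
        then have "deviation f n \<omega> \<le> \<epsilon>"
          unfolding integral_esd_X[OF n f(1)] using n
          by (intro close) (auto simp: moment_def not_less)
        then show False using \<omega> by simp
      qed
      then show "\<omega> \<in> (\<Union>k\<le>L. ?E k)" using \<omega> by auto
    qed
    then have "prob (deviates f \<epsilon> n) \<le> prob (\<Union>k\<le>L. ?E k)"
      using E by (intro finite_measure_mono) auto
    also have "\<dots> \<le> (\<Sum>k\<le>L. prob (?E k))"
      using E by (intro finite_measure_subadditive_finite) auto
    also have "\<dots> \<le> (\<Sum>k\<le>L. K k * rate n)"
    proof (rule sum_mono)
      fix k assume "k \<in> {..L}"
      then have "B k \<le> Max (B ` {..L})" by (intro Max_ge) auto
      then show "prob (?E k) \<le> K k * rate n" using Bn by (intro KB n) linarith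
    qed
    finally show "prob (deviates f \<epsilon> n) \<le> (\<Sum>k\<le>L. K k) * rate n"
      by (simp only: sum_distrib_right)
  qed
qed

section \<open>Convergence in probability and almost surely\<close>

lemma b_ge_1: "1 \<le> n \<Longrightarrow> 1 \<le> b n"
  using bw[of n] by (auto simp: bandwidth_def)

theorem semicircle_law_prob:
  assumes b: "filterlim b at_top sequentially"
  shows "semicircle_law_in_prob M X"
  unfolding semicircle_law_in_prob_def tendsto_in_prob_def
proof (intro allI impI conjI)
  fix f :: "real \<Rightarrow> real" assume f: "continuous_on UNIV f" "bounded (range f)"
  show "(\<lambda>\<omega>. \<integral>x. f x \<partial>esd (X n \<omega>)) \<in> borel_measurable M" if "1 \<le> n" for n
    by (rule integral_esd_measurable[OF that f(1)])
  fix \<epsilon> :: real assume \<epsilon>: "0 < \<epsilon>"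
  obtain K B where K: "0 \<le> K" and KB: "\<And>n. 1 \<le> n \<Longrightarrow> B \<le> real (b n) \<Longrightarrow>
    prob (deviates f \<epsilon> n) \<le>
      K * rate n"
    by (rule prob_integral_deviation[OF f \<epsilon>]) blast
  have rb: "filterlim (\<lambda>n. real (b n)) at_top sequentially"
    by (rule filterlim_compose[OF filterlim_real_sequentially b])
  have lim: "(\<lambda>n. K * (2 / real (b n))) \<longlonglongrightarrow> K * 0"
    by (intro tendsto_mult tendsto_const tendsto_divide_0[OF tendsto_const] filterlim_at_top_imp_at_infinity rb)
  show "(\<lambda>n. prob (deviates f \<epsilon> n)) \<longlonglongrightarrow> 0"
  proof (rule tendsto_sandwich[OF _ _ tendsto_const])
    show "(\<lambda>n. K * (2 / real (b n))) \<longlonglongrightarrow> 0" using lim by simp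
    have "eventually (\<lambda>n. B \<le> real (b n)) sequentially"
      using rb by (auto simp: filterlim_at_top)
    with eventually_ge_at_top[of 1]
    show "eventually (\<lambda>n. prob (deviates f \<epsilon> n) \<le>
        K * (2 / real (b n))) sequentially"
    proof eventually_elim
      case (elim n)
      have b1: "1 \<le> real (b n)" using b_ge_1[OF elim(1)] by simp
      have "1 / (real n * real (b n)) \<le> 1 / (1 * real (b n))"
        using b1 elim(1) by (intro divide_left_mono mult_right_mono) auto
      moreover have "1 / real (b n) ^ 4 \<le> 1 / real (b n) ^ 1"
        using b1 by (intro divide_left_mono power_increasing) auto
      ultimately have "rate n \<le> 2 / real (b n)" by simp
      then show ?case using KB[OF elim] K by (meson mult_left_mono order_trans)
    qed
  qed simp
qed

theorem semicircle_law_as: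
  assumes summ: "summable (\<lambda>n. 1 / real (b n) ^ 3)"
  shows "semicircle_law_almost_surely M X"
  unfolding semicircle_law_almost_surely_def
proof (intro allI impI)
  fix f :: "real \<Rightarrow> real" assume f: "continuous_on UNIV f" "bounded (range f)"
  define Y where "Y n \<omega> = (\<integral>x. f x \<partial>esd (X n \<omega>))" for n \<omega>
  define c where "c = (\<integral>x. f x \<partial>semicircle)"
  have Y [measurable]: "Y n \<in> borel_measurable M" if "1 \<le> n" for n
    unfolding Y_def using integral_esd_measurable[OF that f(1)] .
  \<comment> \<open>The terms of the summable series tend to 0; \<open>B'\<close> is positive so
    that the comparison of reciprocal cubes can be inverted.\<close>
  have large: "eventually (\<lambda>n. B \<le> real (b n)) sequentially" for B
  proof -
    define B' where "B' = max B 1"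
    have "eventually (\<lambda>n. 1 / real (b n) ^ 3 < 1 / B' ^ 3) sequentially"
      using summable_LIMSEQ_zero[OF summ] by (intro order_tendstoD(2)) (auto simp: B'_def)
    with eventually_ge_at_top[of 1] show ?thesis
    proof eventually_elim
      case (elim n)
      then have "B' ^ 3 < real (b n) ^ 3"
        using b_ge_1[OF elim(1)] by (simp add: B'_def divide_less_cancel frac_less2 divide_strict_left_mono_neg field_simps)
      then have "B' < real (b n)" by (rule power_less_imp_less_base) simp
      then show ?case by (simp add: B'_def)
    qed
  qed
  have rate_le: "rate n \<le> 2 * (1 / real (b n) ^ 3) + real n powr (- 3 / 2)"
    if n: "1 \<le> n" for n
  proof -
    have b1: "1 \<le> real (b n)" using b_ge_1[OF n] by simp
    have "1 / (real n * real (b n)) \<le> 1 / real (b n) ^ 3 + real n powr (- 3 / 2)"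
    \<comment> \<open>If \<open>b ^ 2 \<le> n\<close>, then \<open>n * b\<close> is at least
      \<open>b ^ 3\<close>; otherwise \<open>b\<close> exceeds \<open>sqrt n\<close> and
      \<open>n * b\<close> is at least \<open>n powr (3 / 2)\<close>, whose reciprocal is summable
      by itself.\<close>
    proof (cases "real (b n) ^ 2 \<le> real n")
      case True
      have "1 / (real n * real (b n)) \<le> 1 / (real (b n) ^ 2 * real (b n))"
        using True b1 n by (intro divide_left_mono mult_right_mono) auto
      also have "\<dots> = 1 / real (b n) ^ 3" by (simp add: power2_eq_square power3_eq_cube)
      finally show ?thesis by (simp add: add_increasing2)
    next
      case False
      then have s: "sqrt (real n) \<le> real (b n)" by (intro real_le_lsqrt) auto
      have "1 / (real n * real (b n)) \<le> 1 / (real n * sqrt (real n))"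
        using s n b1 by (intro divide_left_mono mult_left_mono) auto
      also have "real n * sqrt (real n) = real n powr (3 / 2)"
        using n powr_add[of "real n" 1 "1 / 2"] by (simp add: powr_half_sqrt)
      also have "1 / real n powr (3 / 2) = real n powr (- 3 / 2)" by (simp add: powr_minus_divide)
      finally show ?thesis using b1 by (simp add: add_increasing)
    qed
    moreover have "1 / real (b n) ^ 4 \<le> 1 / real (b n) ^ 3"
      using b1 by (intro divide_left_mono power_increasing) auto
    ultimately show ?thesis by simp
  qed
  have "AE \<omega> in M. eventually (\<lambda>n. \<bar>Y n \<omega> - c\<bar> \<le> \<epsilon>) sequentially" if \<epsilon>: "0 < \<epsilon>" for \<epsilon>
  proof -
    obtain K B where K: "0 \<le> K" and KB: "\<And>n. 1 \<le> n \<Longrightarrow> B \<le> real (b n) \<Longrightarrow>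
      prob {\<omega> \<in> space M. \<bar>Y n \<omega> - c\<bar> > \<epsilon>} \<le> K * rate n"
      unfolding Y_def c_def by (rule prob_integral_deviation[OF f \<epsilon>]) blast
    \<comment> \<open>Index 0 is emptied, as measurability of \<open>Y n\<close> is available only
      from 1 on.\<close>
    define E where "E n = (if 1 \<le> n then {\<omega> \<in> space M. \<bar>Y n \<omega> - c\<bar> > \<epsilon>} else {})" for n
    have E: "E n \<in> events" for n
      unfolding E_def using Y[of n] by (cases "1 \<le> n") auto
    have "summable (\<lambda>n. prob (E n))"
    proof (rule summable_comparison_test_ev)
      show "summable (\<lambda>n. K * (2 * (1 / real (b n) ^ 3) + real n powr (- 3 / 2)))"
        by (intro summable_mult summable_add summ) (simp add: summable_real_powr_iff)
      from large[of B] eventually_ge_at_top[of 1]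
      show "eventually (\<lambda>n. norm (prob (E n)) \<le> K * (2 * (1 / real (b n) ^ 3) + real n powr (- 3 / 2))) sequentially"
      proof eventually_elim
        case (elim n)
        have "norm (prob (E n)) \<le> K * rate n"
          using KB[OF elim(2,1)] elim(2) by (simp add: E_def)
        also have "\<dots> \<le> K * (2 * (1 / real (b n) ^ 3) + real n powr (- 3 / 2))"
          by (rule mult_left_mono[OF rate_le[OF elim(2)] K])
        finally show ?case .
      qed
    qed
    then have "AE \<omega> in M. eventually (\<lambda>n. \<omega> \<in> space M - E n) sequentially"
      using E by (intro borel_cantelli_AE1) (auto simp: less_top[symmetric])
    then show ?thesis
    proof eventually_elim
      case (elim \<omega>)
      with eventually_ge_at_top[of 1] show ?case
        by eventually_elim (auto simp: E_def not_less)
    qed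
  qed
  \<comment> \<open>Countably many tolerances suffice, so the exceptional null sets can be
    united.\<close>
  then have "AE \<omega> in M. \<forall>j::nat. eventually (\<lambda>n. \<bar>Y n \<omega> - c\<bar> \<le> 1 / real (Suc j)) sequentially"
    by (subst AE_all_countable) simp
  then have "AE \<omega> in M. (\<lambda>n. Y n \<omega>) \<longlonglongrightarrow> c"
  proof eventually_elim
    case (elim \<omega>)
    show ?case
    proof (rule tendstoI)
      fix e :: real assume "0 < e"
      then obtain j where j: "1 / real (Suc j) < e" using nat_approx_posE by blast
      have "eventually (\<lambda>n. \<bar>Y n \<omega> - c\<bar> \<le> 1 / real (Suc j)) sequentially" using elim by blast
      then show "eventually (\<lambda>n. dist (Y n \<omega>) c < e) sequentially"
        by eventually_elim (use j in \<open>simp add: dist_real_def\<close>)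
    qed
  qed
  then show "AE \<omega> in M. (\<lambda>n. \<integral>x. f x \<partial>esd (X n \<omega>)) \<longlonglongrightarrow> (\<integral>x. f x \<partial>semicircle)"
    by (simp add: Y_def c_def)
qed

end

theorem theorem3p5:
  fixes M :: "'w measure"
    and \<beta> :: real
    and a' a :: "nat \<Rightarrow> nat \<Rightarrow> nat \<Rightarrow> 'w \<Rightarrow> real"
    and b :: "nat \<Rightarrow> nat"
  assumes "prob_space M"
    and "0 < \<beta>" and "\<beta> \<le> 1"
    and "\<And>n. n \<ge> 1 \<Longrightarrow> curie_weiss M \<beta> (square n) (\<lambda>(i, j). a' n i j)"
    and "\<And>n i j. n \<ge> 1 \<Longrightarrow> (i, j) \<in> square n \<Longrightarrow>
           a n i j = (if i \<le> j then a' n i j else a' n j i)"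
    and "\<And>n. n \<ge> 1 \<Longrightarrow> bandwidth n (b n)"
  shows "almost_uncorrelated M (1 / 2) a \<and>
         (filterlim b at_top sequentially \<longrightarrow> semicircle_law_in_prob M (band_matrix a b)) \<and>
         (summable (\<lambda>n. 1 / real (b n) ^ 3) \<longrightarrow>
            semicircle_law_almost_surely M (band_matrix a b)) \<and>
         ((\<forall>n\<ge>1. b n = n) \<longrightarrow> semicircle_law_almost_surely M (band_matrix a b))"
proof -
  interpret prob_space M by (rule assms(1))
  interpret curie_weiss_band M \<beta> a' a b
    by unfold_locales (rule assms; assumption)+
  have "summable (\<lambda>n. 1 / real (b n) ^ 3)" if full: "\<forall>n\<ge>1. b n = n"
  proof -
    \<comment> \<open>\<open>b 0\<close> is unconstrained, so the two series are known to agree only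
      from index 1 on.\<close>
    have ev: "eventually (\<lambda>n. 1 / real n ^ 3 = 1 / real (b n) ^ 3) sequentially"
      using eventually_ge_at_top[of 1] by eventually_elim (use full in simp)
    have "summable (\<lambda>n. 1 / real n ^ 3)"
      using inverse_power_summable[of 3, where 'a = real] by (simp add: inverse_eq_divide)
    then show ?thesis unfolding summable_cong[OF ev] .
  qed
  then show ?thesis
    using almost_uncorrelated_scheme semicircle_law_prob semicircle_law_as by blast
qed

end
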